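(* Let $\Omega_\lambda=(1+\lambda)\Omega$ and $c(\lambda)=c_{\Omega_\lambda}$ for $\lambda\in(-\varepsilon_0,\varepsilon_0)$. (i) The map $\lambda\mapsto c(\lambda)$ is Lipschitz and increasing (in the non-strict sense), and the one-sided derivatives $c'_+(\lambda)$ and $c'_-(\lambda)$ exist at every $\lambda\in(-\varepsilon_0,\varepsilon_0)$. (ii) $\lambda\mapsto c'_-(\lambda)$ is left-continuous and $\lambda\mapsto c'_+(\lambda)$ is right-continuous. (iii) The set of points where $\lambda\mapsto c(\lambda)$ is not differentiable is at most countable.
   Context: Standing assumptions. $\varepsilon>0$ is fixed, $p>2$, $U\subset\mathbb{R}^n$ is open and bounded with smooth boundary, $f\in C^1(\overline U)$, and $H(x,\xi)=|\xi|^p-f(x)$. $\Omega\subset\mathbb{R}^n$ is open, bounded, connected, with $C^2$ boundary, $\overline\Omega\subset U$, star-shaped with respect to the origin, and there is $\kappa>0$ such that $\overline{B(0,\kappa)}\subset\Omega$ and $\mathrm{dist}(x,\overline\Omega)\ge\kappa s$ for all $x\in(1+s)\partial\Omega$ and all $s>0$. The number $\varepsilon_0\in(0,1)$ is such that $(1+\lambda)\Omega\subset U$ for $|\lambda|<\varepsilon_0$. Viscosity subsolutions. For an open set $\mathcal{O}$ and $c\in\mathbb{R}$, $w$ satisfies $H(x,Dw)-\varepsilon\Delta w\le c$ in $\mathcal{O}$ if for every $x\in\mathcal{O}$ and $\varphi\in C^2(\mathcal{O})$ such that $w-\varphi$ has a local maximum at $x$, $H(x,D\varphi(x))-\varepsilon\Delta\varphi(x)\le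 c$. Additive eigenvalue. $c_{\mathcal{O}}=\min\{c\in\mathbb{R}: H(x,Du)-\varepsilon\Delta u\le c\text{ in }\mathcal{O}\text{ has a (continuous viscosity) solution}\}$. $c'_\pm(\lambda)=\lim_{h\to0^\pm}(c(\lambda+h)-c(\lambda))/h$. *)

theory Defs
  imports "HOL-Analysis.Analysis"
begin

definition partial_deriv :: "'a::euclidean_space \<Rightarrow> ('a \<Rightarrow> real) \<Rightarrow> 'a \<Rightarrow> real" where
  "partial_deriv b f x = frechet_derivative f (at x) b"

definition grad :: "('a::euclidean_space \<Rightarrow> real) \<Rightarrow> 'a \<Rightarrow> 'a" where
  "grad f x = (\<Sum>b\<in>Basis. partial_deriv b f x *\<^sub>R b)"

definition laplacian :: "('a::euclidean_space \<Rightarrow> real) \<Rightarrow> 'a \<Rightarrow> real" where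
  "laplacian f x = (\<Sum>b\<in>Basis. partial_deriv b (partial_deriv b f) x)"

(* Intended for open S only: all derivatives are two-sided, so the values of f outside S do not
   matter. *)
primrec Ck_on :: "nat \<Rightarrow> 'a::euclidean_space set \<Rightarrow> ('a \<Rightarrow> real) \<Rightarrow> bool" where
  "Ck_on 0 S f \<longleftrightarrow> continuous_on S f"
| "Ck_on (Suc k) S f \<longleftrightarrow>
     (\<forall>x\<in>S. f differentiable (at x)) \<and> (\<forall>b\<in>Basis. Ck_on k S (partial_deriv b f))"

definition smooth_on :: "'a::euclidean_space set \<Rightarrow> ('a \<Rightarrow> real) \<Rightarrow> bool" where
  "smooth_on S f \<longleftrightarrow> (\<forall>k. Ck_on k S f)"

(* C^1 up to the boundary: f and its first partial derivatives extend continuously from the open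
   set S to its closure. *)
definition C1_on_closure :: "'a::euclidean_space set \<Rightarrow> ('a \<Rightarrow> real) \<Rightarrow> bool" where
  "C1_on_closure S f \<longleftrightarrow>
     Ck_on 1 S f \<and> continuous_on (closure S) f \<and>
     (\<forall>b\<in>Basis. \<exists>g. continuous_on (closure S) g \<and> (\<forall>x\<in>S. g x = partial_deriv b f x))"

(* Near each boundary point, S is the region strictly above a graph in some direction v. The graph
   function is a function of the variables orthogonal to v; it is encoded as a function on the
   whole space that is constant along v. R prescribes its regularity. *)
definition graph_boundary ::
    "(('a::euclidean_space \<Rightarrow> real) \<Rightarrow> bool) \<Rightarrow> 'a set \<Rightarrow> bool" where
  "graph_boundary R S \<longleftrightarrow>
     (\<forall>x\<in>frontier S. \<exists>r>0. \<exists>v \<gamma>.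
        norm v = 1 \<and> R \<gamma> \<and> (\<forall>y t. \<gamma> (y + t *\<^sub>R v) = \<gamma> y) \<and>
        S \<inter> ball x r = {y \<in> ball x r. \<gamma> y < y \<bullet> v})"

definition C2_boundary :: "'a::euclidean_space set \<Rightarrow> bool" where
  "C2_boundary S \<longleftrightarrow> graph_boundary (Ck_on 2 UNIV) S"

definition smooth_boundary :: "'a::euclidean_space set \<Rightarrow> bool" where
  "smooth_boundary S \<longleftrightarrow> graph_boundary (smooth_on UNIV) S"

definition viscosity_subsolution ::
    "('a::euclidean_space \<Rightarrow> 'a \<Rightarrow> real) \<Rightarrow> real \<Rightarrow> 'a set \<Rightarrow> real \<Rightarrow> ('a \<Rightarrow> real) \<Rightarrow> bool" where
  "viscosity_subsolution H \<epsilon> S c w \<longleftrightarrow>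
     continuous_on S w \<and>
     (\<forall>x\<in>S. \<forall>\<phi>. Ck_on 2 S \<phi> \<and> (\<forall>\<^sub>F y in nhds x. w y - \<phi> y \<le> w x - \<phi> x) \<longrightarrow>
        H x (grad \<phi> x) - \<epsilon> * laplacian \<phi> x \<le> c)"

(* A minimum, not merely an infimum: the value is unspecified unless the minimum is attained. *)
definition additive_eigenvalue ::
    "('a::euclidean_space \<Rightarrow> 'a \<Rightarrow> real) \<Rightarrow> real \<Rightarrow> 'a set \<Rightarrow> real" where
  "additive_eigenvalue H \<epsilon> S = (LEAST c. \<exists>u. viscosity_subsolution H \<epsilon> S c u)"

(* Meaningful only where the limits exist. *)
definition right_deriv :: "(real \<Rightarrow> real) \<Rightarrow> real \<Rightarrow> real" where
  "right_deriv c x = Lim (at_right 0) (\<lambda>h. (c (x + h) - c x) / h)"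

definition left_deriv :: "(real \<Rightarrow> real) \<Rightarrow> real \<Rightarrow> real" where
  "left_deriv c x = Lim (at_left 0) (\<lambda>h. (c (x + h) - c x) / h)"

end

theory Submission
  imports Defs
begin

text \<open>
  Write \<open>\<mu> = 1 + t\<close>. Pulling a subsolution on \<open>\<mu> \<Omega>\<close> back to \<open>\<Omega>\<close> by
  \<open>v x = u (\<mu> x)\<close> and multiplying by \<open>\<mu>\<^sup>2\<close> turns the inequality into
  \<open>\<mu> powr (2 - p) * norm (Dv) powr p - \<epsilon> * \<Delta>v \<le> \<mu>\<^sup>2 * (c + f (\<mu> x))\<close>,
  whose Hamiltonian is jointly convex in \<open>\<mu>\<close> and \<open>Dv\<close>. Convex combinations of subsolutions
  therefore show that \<open>\<Gamma> t = \<mu>\<^sup>2 * c t\<close> is convex up to the second differences of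
  \<open>\<mu>\<^sup>2 * f (\<mu> x)\<close> in \<open>\<mu>\<close>, which are of lower order because \<open>f\<close> is \<open>C\<^sup>1\<close>.
  Such semiconvex functions have one-sided derivatives with the stated one-sided continuity, and any
  function with one-sided derivatives everywhere is differentiable off a countable set.

  Since the subsolutions are only continuous, their convex combinations are handled by replacing the
  Hamiltonian by a supporting affine function; an exponential weight removes the drift, and what
  remains is additivity of viscosity subsolutions of Poisson's equation, proved by comparison
  with harmonic polynomials that approximate one of the summands on a small sphere. That the
  minimum defining \<open>c t\<close> is attained follows from the interior equicontinuity of subsolutions,
  where \<open>p > 2\<close> is essential.
\<close>

subsection \<open>Calculus of the classes \<open>C\<^sup>k\<close>\<close>

text \<open>The factor \<open>\<mu>\<^sup>2\<close> does two things. It leaves the coefficient of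
  the Laplacian independent of \<mu>, so inequalities for different \<mu> can be added under one
  operator. And it makes the gradient term homogeneous of degree 2; in \<mu> and the norm of the
  gradient its Hessian determinant is a positive multiple of \<open>p * (p - 2)\<close>. The
  obstacle is that a test function touching a sum yields no test function for either summand. The
  supporting affine function is taken at the gradient of the test function at the contact point.
  Once chosen it is a lower bound everywhere, so both summands satisfy linear inequalities with the
  same constant drift. Removing the drift creates a term of order zero, which is treated as
  continuous data on the right-hand side. Freezing the data on a small ball leaves constant
  right-hand sides, for which polynomials are explicit solutions. Since \<open>f\<close> is only of
  class C^1, the convexity defect has no rate, hence semiconvexity with an unspecified modulus. The
  interior estimates do not depend on boundary values of the subsolutions, so no boundary condition
  is needed for compactness.\<close>

lemma partial_deriv_eq: "(f has_derivative f') (at x) \<Longrightarrow> partial_deriv b f x = f' b"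
  unfolding partial_deriv_def using frechet_derivative_at by force

lemma partial_deriv_cong:
  assumes "open S" "x \<in> S" "\<And>y. y \<in> S \<Longrightarrow> f y = g y"
  shows "partial_deriv b f x = partial_deriv b g x"
proof -
  have "(f has_derivative D) (at x) \<longleftrightarrow> (g has_derivative D) (at x)" for D
    using has_derivative_transform_within_open[of f D x UNIV S g]
      has_derivative_transform_within_open[of g D x UNIV S f] assms by auto
  then show ?thesis unfolding partial_deriv_def frechet_derivative_def by simp
qed

lemma differentiable_cong_open:
  assumes "open S" "x \<in> S" "\<And>y. y \<in> S \<Longrightarrow> f y = g y" "f differentiable (at x)"
  shows "g differentiable (at x)"
  using assms has_derivative_transform_within_open[of f _ x UNIV S g] unfolding differentiable_def by blast

lemma Ck_on_subset: "Ck_on k S f \<Longrightarrow> T \<subseteq> S \<Longrightarrow> Ck_on k T f"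
  by (induction k arbitrary: f) (auto intro: continuous_on_subset)

lemma Ck_on_cong:
  assumes "open S" "Ck_on k S f" "\<And>x. x \<in> S \<Longrightarrow> f x = g x"
  shows "Ck_on k S g"
  using assms(2,3)
proof (induction k arbitrary: f g)
  case 0 then show ?case using continuous_on_cong by force
next
  case (Suc k)
  have "g differentiable (at x)" if "x \<in> S" for x
    using differentiable_cong_open[OF assms(1) that, of f g] Suc.prems that by auto
  moreover have "Ck_on k S (partial_deriv b g)" if "b \<in> Basis" for b
    using Suc.IH[of "partial_deriv b f" "partial_deriv b g"] Suc.prems that
      partial_deriv_cong[OF assms(1), of _ f g b] by auto
  ultimately show ?case by simp
qed

lemma Ck_on_Un:
  assumes "open S" "open T" "Ck_on k S f" "Ck_on k T f"
  shows "Ck_on k (S \<union> T) f"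
  using assms(3,4) by (induction k arbitrary: f) (auto intro: continuous_on_open_Un assms)

lemma Ck_on_Suc_imp:
  assumes "open S" "Ck_on (Suc k) S f" shows "Ck_on k S f"
  using assms(2)
proof (induction k arbitrary: f)
  case 0 then show ?case
    by (auto intro!: continuous_at_imp_continuous_on differentiable_imp_continuous_within)
next
  case (Suc k) then show ?case by auto
qed

lemma Ck_on_imp_differentiable: "Ck_on k S f \<Longrightarrow> k > 0 \<Longrightarrow> x \<in> S \<Longrightarrow> f differentiable (at x)"
  by (cases k) auto

lemma Ck_on_imp_continuous_on: assumes "open S" "Ck_on k S f" shows "continuous_on S f"
  using assms(2) by (induction k) (auto simp del: Ck_on.simps(2) dest: Ck_on_Suc_imp[OF assms(1)])

lemma Ck_on_SucI:
  assumes "open S" "\<And>x. x \<in> S \<Longrightarrow> (f has_derivative f' x) (at x)"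
    "\<And>b. b \<in> Basis \<Longrightarrow> Ck_on k S (\<lambda>x. f' x b)"
  shows "Ck_on (Suc k) S f"
proof -
  have "Ck_on k S (partial_deriv b f)" if "b \<in> Basis" for b
    by (rule Ck_on_cong[OF assms(1) assms(3)[OF that]]) (simp add: partial_deriv_eq[OF assms(2)])
  then show ?thesis using assms(2) by (auto simp: differentiable_def)
qed

lemma has_derivative_frechet:
  "f differentiable (at x) \<Longrightarrow> (f has_derivative frechet_derivative f (at x)) (at x)"
  by (simp add: frechet_derivative_works)

lemma partial_deriv_const [simp]: "partial_deriv b (\<lambda>_. c) x = 0"
  by (simp add: partial_deriv_eq[OF has_derivative_const])

lemma partial_deriv_add:
  "f differentiable (at x) \<Longrightarrow> g differentiable (at x) \<Longrightarrow>
   partial_deriv b (\<lambda>y. f y + g y) x = partial_deriv b f x + partial_deriv b g x"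
  using partial_deriv_eq[OF has_derivative_add[OF has_derivative_frechet has_derivative_frechet]]
  by (simp add: partial_deriv_def)

lemma partial_deriv_mult:
  fixes f g :: "'a::euclidean_space \<Rightarrow> real"
  shows "f differentiable (at x) \<Longrightarrow> g differentiable (at x) \<Longrightarrow>
   partial_deriv b (\<lambda>y. f y * g y) x = f x * partial_deriv b g x + partial_deriv b f x * g x"
  using partial_deriv_eq[OF has_derivative_mult[OF has_derivative_frechet has_derivative_frechet], of f x g]
  by (simp add: partial_deriv_def)

lemma partial_deriv_inner [simp]: "partial_deriv b (\<lambda>y. y \<bullet> v) x = b \<bullet> v"
  by (rule partial_deriv_eq) (auto intro!: derivative_eq_intros)

lemma partial_deriv_compose:
  fixes f :: "'a::euclidean_space \<Rightarrow> real" and F :: "real \<Rightarrow> real"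
  assumes "f differentiable (at x)" "(F has_real_derivative F') (at (f x))"
  shows "partial_deriv b (\<lambda>y. F (f y)) x = F' * partial_deriv b f x"
  using partial_deriv_eq[OF has_derivative_compose[OF has_derivative_frechet[OF assms(1)]
     assms(2)[unfolded has_field_derivative_def]]]
  by (simp add: partial_deriv_def)

lemma partial_deriv_affine:
  fixes f :: "'a::euclidean_space \<Rightarrow> real"
  assumes "f differentiable (at (a + s *\<^sub>R x))"
  shows "partial_deriv b (\<lambda>y. f (a + s *\<^sub>R y)) x = s * partial_deriv b f (a + s *\<^sub>R x)"
proof -
  have "((\<lambda>y. f (a + s *\<^sub>R y)) has_derivative (\<lambda>h. frechet_derivative f (at (a + s *\<^sub>R x)) (s *\<^sub>R h))) (at x)"
    by (rule has_derivative_compose[where f = "\<lambda>y. a + s *\<^sub>R y", OF _ has_derivative_frechet[OF assms]])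
      (auto intro!: derivative_eq_intros)
  from partial_deriv_eq[OF this, of b] show ?thesis
    using has_derivative_frechet[OF assms] linear_cmul[of "frechet_derivative f (at (a + s *\<^sub>R x))"]
    by (simp add: partial_deriv_def has_derivative_linear)
qed

lemma Ck_on_const [simp]: "Ck_on k S (\<lambda>_. c)"
  by (induction k arbitrary: c) (auto simp: partial_deriv_const[abs_def])

lemma Ck_on_inner [simp]: "Ck_on k S (\<lambda>y. y \<bullet> v)"
proof (cases k)
  case 0 then show ?thesis by (auto intro!: continuous_intros)
next
  case (Suc m)
  have "partial_deriv b (\<lambda>y. y \<bullet> v) = (\<lambda>_. b \<bullet> v)" for b by auto
  moreover have "(\<lambda>y. y \<bullet> v) differentiable (at x)" for x
    by (auto simp: differentiable_def intro!: derivative_eq_intros exI)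
  ultimately show ?thesis using Suc by auto
qed

lemma Ck_on_add:
  assumes "open S" "Ck_on k S f" "Ck_on k S g" shows "Ck_on k S (\<lambda>x. f x + g x)"
  using assms(2,3)
proof (induction k arbitrary: f g)
  case 0 then show ?case by (auto intro: continuous_intros)
next
  case (Suc k)
  have d: "f differentiable (at x)" "g differentiable (at x)" if "x \<in> S" for x
    using Suc.prems that by auto
  have "Ck_on k S (partial_deriv b (\<lambda>x. f x + g x))" if "b \<in> Basis" for b
    by (rule Ck_on_cong[OF assms(1) Suc.IH[of "partial_deriv b f" "partial_deriv b g"]])
       (use Suc.prems that d in \<open>auto simp: partial_deriv_add\<close>)
  then show ?case using d by auto
qed

lemma Ck_on_mult:
  assumes "open S" "Ck_on k S f" "Ck_on k S g" shows "Ck_on k S (\<lambda>x. f x * g x)"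
  using assms(2,3)
proof (induction k arbitrary: f g)
  case 0 then show ?case by (auto intro: continuous_intros)
next
  case (Suc k)
  have d: "f differentiable (at x)" "g differentiable (at x)" if "x \<in> S" for x
    using Suc.prems that by auto
  have fk: "Ck_on k S f" "Ck_on k S g" using Suc.prems Ck_on_Suc_imp[OF assms(1)] by blast+
  have "Ck_on k S (partial_deriv b (\<lambda>x. f x * g x))" if "b \<in> Basis" for b
    by (rule Ck_on_cong[OF assms(1) Ck_on_add[OF assms(1) Suc.IH[of f "partial_deriv b g"]
        Suc.IH[of "partial_deriv b f" g]]])
       (use Suc.prems that d fk in \<open>auto simp: partial_deriv_mult\<close>)
  then show ?case using d by auto
qed

lemma Ck_on_cmult: "open S \<Longrightarrow> Ck_on k S f \<Longrightarrow> Ck_on k S (\<lambda>x. c * f x)"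
  by (rule Ck_on_mult) auto

lemma Ck_on_diff:
  assumes "open S" "Ck_on k S f" "Ck_on k S g" shows "Ck_on k S (\<lambda>x. f x - g x)"
  using Ck_on_add[OF assms(1,2) Ck_on_cmult[OF assms(1,3), of "-1"]] by simp

lemma Ck_on_sum:
  assumes "open S" "\<And>i. i \<in> I \<Longrightarrow> Ck_on k S (f i)" shows "Ck_on k S (\<lambda>x. \<Sum>i\<in>I. f i x)"
  using assms(2) by (induction I rule: infinite_finite_induct) (auto intro!: Ck_on_add[OF assms(1)])

lemma Ck_on_compose:
  fixes F :: "real \<Rightarrow> real"
  assumes "open S" "open T" "f ` S \<subseteq> T" "Ck_on k S f" "Ck_on k T F"
  shows "Ck_on k S (\<lambda>x. F (f x))"
  using assms(4,5,3)
proof (induction k arbitrary: f F)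
  case 0 then show ?case by (auto intro: continuous_on_compose2)
next
  case (Suc k)
  have d: "f differentiable (at x)" "F differentiable (at (f x))" if "x \<in> S" for x
    using Suc.prems that by auto
  \<comment> \<open>The only basis vector of the reals is 1, so \<open>partial_deriv 1 F\<close> is
    the ordinary derivative of \<open>F\<close> and the induction hypothesis applies to it.\<close>
  have D: "(F has_real_derivative partial_deriv 1 F (f x)) (at (f x))" if "x \<in> S" for x
  proof -
    obtain D where "(F has_real_derivative D) (at (f x))"
      using d(2)[OF \<open>x \<in> S\<close>] by (auto simp: real_differentiable_def)
    moreover from this have "partial_deriv 1 F (f x) = D"
      using partial_deriv_eq[of F "(*) D" "f x" 1] by (simp add: has_field_derivative_def)
    ultimately show ?thesis by simp
  qed
  have fk: "Ck_on k S f" using Suc.prems Ck_on_Suc_imp[OF assms(1)] by blast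
  have "Ck_on k S (partial_deriv b (\<lambda>x. F (f x)))" if "b \<in> Basis" for b
    by (rule Ck_on_cong[OF assms(1) Ck_on_mult[OF assms(1)
          Suc.IH[of f "partial_deriv 1 F"], of "partial_deriv b f"]])
       (use Suc.prems that d fk D in \<open>auto simp: partial_deriv_compose[OF d(1) D]\<close>)
  moreover have "(\<lambda>x. F (f x)) differentiable (at x)" if "x \<in> S" for x
    using differentiable_chain_at[of f x F] d that by (auto simp: o_def)
  ultimately show ?case by auto
qed

lemma Ck_on_affine:
  assumes "open S" "Ck_on k S f"
  shows "Ck_on k {y. a + s *\<^sub>R y \<in> S} (\<lambda>y. f (a + s *\<^sub>R y))"
proof -
  have op: "open {y. a + s *\<^sub>R y \<in> S}"
    using continuous_open_vimage[OF assms(1), of "\<lambda>y. a + s *\<^sub>R y"]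
    by (auto simp: vimage_def intro!: continuous_intros)
  show ?thesis using assms(2)
  proof (induction k arbitrary: f)
    case 0 then show ?case by (auto intro!: continuous_on_compose2[of S f] continuous_intros)
  next
    case (Suc k)
    have "(\<lambda>y. f (a + s *\<^sub>R y)) differentiable (at x)" if "a + s *\<^sub>R x \<in> S" for x
      using differentiable_chain_at[of "\<lambda>y. a + s *\<^sub>R y" x f] Suc.prems that by (auto simp: o_def)
    moreover have "Ck_on k {y. a + s *\<^sub>R y \<in> S} (partial_deriv b (\<lambda>y. f (a + s *\<^sub>R y)))" if "b \<in> Basis" for b
      by (rule Ck_on_cong[OF op Ck_on_cmult[OF op Suc.IH[of "partial_deriv b f"], of s]])
         (use Suc.prems that in \<open>auto simp: partial_deriv_affine\<close>)
    ultimately show ?case by auto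
  qed
qed

lemma Ck_on_real_2:
  fixes F :: "real \<Rightarrow> real"
  assumes "open T" "\<And>t. t \<in> T \<Longrightarrow> (F has_real_derivative F' t) (at t)"
    "\<And>t. t \<in> T \<Longrightarrow> (F' has_real_derivative F'' t) (at t)" "continuous_on T F''"
  shows "Ck_on 2 T F"
proof -
  have "Ck_on 1 T F'" unfolding One_nat_def
    by (rule Ck_on_SucI[OF assms(1), of _ "\<lambda>x h. F'' x * h"])
      (use assms(3,4) in \<open>auto simp: has_field_derivative_def\<close>)
  then have "Ck_on (Suc 1) T F"
    by (intro Ck_on_SucI[OF assms(1), of _ "\<lambda>x h. F' x * h"])
      (use assms(2) in \<open>auto simp: has_field_derivative_def simp del: Ck_on.simps\<close>)
  then show ?thesis by (simp add: numeral_2_eq_2 del: Ck_on.simps)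
qed

section \<open>Gradient and Laplacian: sum, product, chain and scaling rules\<close>

lemma grad_inner_Basis: "b \<in> Basis \<Longrightarrow> grad f x \<bullet> b = partial_deriv b f x"
  by (simp add: grad_def inner_sum_left inner_Basis if_distrib[of "\<lambda>z. _ * z"] cong: if_cong)

lemma grad_eqI: "(\<And>b. b \<in> Basis \<Longrightarrow> partial_deriv b f x = v \<bullet> b) \<Longrightarrow> grad f x = v"
  by (rule euclidean_eqI) (simp add: grad_inner_Basis)

lemma has_derivative_grad:
  assumes "f differentiable (at x)"
  shows "(f has_derivative (\<lambda>h. grad f x \<bullet> h)) (at x)"
proof -
  have "frechet_derivative f (at x) h = grad f x \<bullet> h" for h
  proof -
    have "linear (frechet_derivative f (at x))"
      using has_derivative_frechet[OF assms] has_derivative_linear by blast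
    then have "frechet_derivative f (at x) (\<Sum>b\<in>Basis. (h \<bullet> b) *\<^sub>R b)
       = (\<Sum>b\<in>Basis. (h \<bullet> b) * frechet_derivative f (at x) b)"
      by (simp add: linear_sum linear_cmul)
    also have "\<dots> = grad f x \<bullet> h"
      by (simp add: grad_def partial_deriv_def inner_sum_left inner_commute[of h] mult.commute)
    finally show ?thesis by (simp add: euclidean_representation)
  qed
  then show ?thesis using has_derivative_frechet[OF assms] by (metis ext)
qed

lemma grad_cong: "open S \<Longrightarrow> x \<in> S \<Longrightarrow> (\<And>y. y \<in> S \<Longrightarrow> f y = g y) \<Longrightarrow> grad f x = grad g x"
  unfolding grad_def using partial_deriv_cong[of S x f g] by simp

lemma laplacian_cong:
  assumes "open S" "x \<in> S" "\<And>y. y \<in> S \<Longrightarrow> f y = g y" shows "laplacian f x = laplacian g x"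
  unfolding laplacian_def
  by (intro sum.cong refl partial_deriv_cong[OF assms(1,2)]) (use partial_deriv_cong[OF assms(1)] assms(3) in blast)

lemma Ck_on_2D:
  assumes "Ck_on 2 S f" "x \<in> S" "b \<in> Basis"
  shows "f differentiable (at x)" "partial_deriv b f differentiable (at x)"
  using assms by (auto simp: numeral_2_eq_2)

lemma partial2_add:
  assumes "open S" "x \<in> S" "Ck_on 2 S f" "Ck_on 2 S g" "b \<in> Basis"
  shows "partial_deriv b (partial_deriv b (\<lambda>y. f y + g y)) x
    = partial_deriv b (partial_deriv b f) x + partial_deriv b (partial_deriv b g) x"
  apply (subst partial_deriv_cong[OF assms(1,2), of _ "\<lambda>y. partial_deriv b f y + partial_deriv b g y"])
  using Ck_on_2D[OF assms(3) _ assms(5)] Ck_on_2D[OF assms(4) _ assms(5)] assms(2)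
  by (auto simp: partial_deriv_add)

lemma grad_add:
  "f differentiable (at x) \<Longrightarrow> g differentiable (at x) \<Longrightarrow> grad (\<lambda>y. f y + g y) x = grad f x + grad g x"
  by (simp add: grad_def partial_deriv_add sum.distrib algebra_simps)

lemma laplacian_add:
  assumes "open S" "x \<in> S" "Ck_on 2 S f" "Ck_on 2 S g"
  shows "laplacian (\<lambda>y. f y + g y) x = laplacian f x + laplacian g x"
  by (simp add: laplacian_def partial2_add[OF assms] sum.distrib)

lemma grad_const [simp]: "grad (\<lambda>_. c) x = 0" by (simp add: grad_def)

lemma laplacian_const [simp]: "laplacian (\<lambda>_. c) x = 0"
  by (simp add: laplacian_def partial_deriv_const[abs_def])

lemma grad_mult:
  "f differentiable (at x) \<Longrightarrow> g differentiable (at x) \<Longrightarrow>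
   grad (\<lambda>y. f y * g y) x = f x *\<^sub>R grad g x + g x *\<^sub>R grad f x"
  by (simp add: grad_def partial_deriv_mult sum.distrib scaleR_sum_right algebra_simps)

lemma grad_inner_grad: "grad f x \<bullet> grad g x = (\<Sum>b\<in>Basis. partial_deriv b f x * partial_deriv b g x)"
  by (subst euclidean_inner) (simp add: grad_inner_Basis)

lemma laplacian_mult:
  assumes "open S" "x \<in> S" "Ck_on 2 S f" "Ck_on 2 S g"
  shows "laplacian (\<lambda>y. f y * g y) x = f x * laplacian g x + 2 * (grad f x \<bullet> grad g x) + g x * laplacian f x"
proof -
  have "partial_deriv b (partial_deriv b (\<lambda>y. f y * g y)) x
    = f x * partial_deriv b (partial_deriv b g) x + 2 * (partial_deriv b f x * partial_deriv b g x)
     + g x * partial_deriv b (partial_deriv b f) x" if b: "b \<in> Basis" for b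
    apply (subst partial_deriv_cong[OF assms(1,2), of _ "\<lambda>y. f y * partial_deriv b g y + partial_deriv b f y * g y"])
    using Ck_on_2D[OF assms(3) _ b] Ck_on_2D[OF assms(4) _ b] assms(2)
    by (auto simp: partial_deriv_add partial_deriv_mult)
  then show ?thesis
    by (simp add: laplacian_def grad_inner_grad sum.distrib sum_distrib_left)
qed

lemma grad_cmult: "f differentiable (at x) \<Longrightarrow> grad (\<lambda>y. c * f y) x = c *\<^sub>R grad f x"
  using grad_mult[of "\<lambda>_. c" x f] by simp

lemma laplacian_cmult:
  "open S \<Longrightarrow> x \<in> S \<Longrightarrow> Ck_on 2 S f \<Longrightarrow> laplacian (\<lambda>y. c * f y) x = c * laplacian f x"
  using laplacian_mult[of S x "\<lambda>_. c" f] by simp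

lemma laplacian_diff:
  assumes "open S" "x \<in> S" "Ck_on 2 S f" "Ck_on 2 S g"
  shows "laplacian (\<lambda>y. f y - g y) x = laplacian f x - laplacian g x"
  using laplacian_add[OF assms(1-3) Ck_on_cmult[OF assms(1,4), of "-1"]] laplacian_cmult[OF assms(1,2,4), of "-1"]
  by simp

lemma grad_inner [simp]: "grad (\<lambda>y. y \<bullet> v) x = v"
  by (rule grad_eqI) (simp add: inner_commute)

lemma grad_compose:
  assumes "f differentiable (at x)" "(F has_real_derivative F') (at (f x))"
  shows "grad (\<lambda>y. F (f y)) x = F' *\<^sub>R grad f x"
  by (simp add: grad_def partial_deriv_compose[OF assms] scaleR_sum_right)

lemma laplacian_compose:
  assumes "open S" "x \<in> S" "Ck_on 2 S f"
    "\<And>y. y \<in> S \<Longrightarrow> (F has_real_derivative F' (f y)) (at (f y))"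
    "(F' has_real_derivative F'') (at (f x))"
  shows "laplacian (\<lambda>y. F (f y)) x = F'' * (norm (grad f x))\<^sup>2 + F' (f x) * laplacian f x"
proof -
  have "partial_deriv b (partial_deriv b (\<lambda>y. F (f y))) x
    = F'' * (partial_deriv b f x * partial_deriv b f x) + F' (f x) * partial_deriv b (partial_deriv b f) x"
    if b: "b \<in> Basis" for b
  proof -
    have "partial_deriv b (partial_deriv b (\<lambda>y. F (f y))) x = partial_deriv b (\<lambda>y. F' (f y) * partial_deriv b f y) x"
      by (rule partial_deriv_cong[OF assms(1,2)], rule partial_deriv_compose)
        (use Ck_on_2D[OF assms(3) _ b] assms(4) in auto)
    also have "\<dots> = F' (f x) * partial_deriv b (partial_deriv b f) x
        + partial_deriv b (\<lambda>y. F' (f y)) x * partial_deriv b f x"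
    proof (rule partial_deriv_mult)
      show "(\<lambda>y. F' (f y)) differentiable (at x)"
        using differentiable_chain_at[of f x F'] Ck_on_2D[OF assms(3,2) b] assms(5)
        by (auto simp: o_def real_differentiable_def)
    qed (use Ck_on_2D[OF assms(3,2) b] in auto)
    also have "partial_deriv b (\<lambda>y. F' (f y)) x = F'' * partial_deriv b f x"
      by (rule partial_deriv_compose[OF Ck_on_2D(1)[OF assms(3,2) b] assms(5)])
    finally show ?thesis by simp
  qed
  then show ?thesis
    by (simp add: laplacian_def power2_norm_eq_inner grad_inner_grad sum.distrib sum_distrib_left)
qed

lemma grad_affine:
  assumes "f differentiable (at (a + s *\<^sub>R x))"
  shows "grad (\<lambda>y. f (a + s *\<^sub>R y)) x = s *\<^sub>R grad f (a + s *\<^sub>R x)"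
  by (simp add: grad_def partial_deriv_affine[OF assms] scaleR_sum_right)

lemma laplacian_affine:
  fixes x :: "'a::euclidean_space"
  assumes "open S" "a + s *\<^sub>R x \<in> S" "Ck_on 2 S f"
  shows "laplacian (\<lambda>y. f (a + s *\<^sub>R y)) x = s\<^sup>2 * laplacian f (a + s *\<^sub>R x)"
proof -
  have op: "open {y. a + s *\<^sub>R y \<in> S}"
    using continuous_open_vimage[OF assms(1), of "\<lambda>y. a + s *\<^sub>R y"]
    by (auto simp: vimage_def intro!: continuous_intros)
  have "partial_deriv b (partial_deriv b (\<lambda>y. f (a + s *\<^sub>R y))) x
     = s * (s * partial_deriv b (partial_deriv b f) (a + s *\<^sub>R x))" if b: "b \<in> Basis" for b
  proof -
    have "partial_deriv b (partial_deriv b (\<lambda>y. f (a + s *\<^sub>R y))) x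
      = partial_deriv b (\<lambda>y. s * partial_deriv b f (a + s *\<^sub>R y)) x"
      by (rule partial_deriv_cong[OF op])
        (use assms Ck_on_2D[OF assms(3) _ b] in \<open>auto intro: partial_deriv_affine\<close>)
    also have "\<dots> = s * partial_deriv b (\<lambda>y. partial_deriv b f (a + s *\<^sub>R y)) x"
      using partial_deriv_mult[of "\<lambda>_. s" x "\<lambda>y. partial_deriv b f (a + s *\<^sub>R y)" b]
        differentiable_chain_at[of "\<lambda>y. a + s *\<^sub>R y" x "partial_deriv b f"] Ck_on_2D(2)[OF assms(3,2) b]
      by (simp add: o_def)
    finally show ?thesis using partial_deriv_affine[OF Ck_on_2D(2)[OF assms(3,2) b]] by simp
  qed
  then show ?thesis by (simp add: laplacian_def sum_distrib_left power2_eq_square mult.assoc)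
qed

lemma Ck_on_norm2: "Ck_on k S (\<lambda>y::'a::euclidean_space. (norm (y - x))\<^sup>2)"
proof -
  have "(norm (y - x))\<^sup>2 = (\<Sum>b\<in>Basis. (y \<bullet> b - x \<bullet> b) * (y \<bullet> b - x \<bullet> b))" for y :: 'a
    by (subst power2_norm_eq_inner, subst euclidean_inner) (simp add: inner_diff_left)
  moreover have "Ck_on k UNIV (\<lambda>y. \<Sum>b\<in>Basis. (y \<bullet> b - x \<bullet> b) * (y \<bullet> b - x \<bullet> b))"
    by (intro Ck_on_sum Ck_on_mult Ck_on_diff) auto
  ultimately show ?thesis using Ck_on_subset by (metis (no_types, lifting) ext subset_UNIV)
qed

lemma partial_deriv_norm2: "partial_deriv b (\<lambda>y. (norm (y - x))\<^sup>2) y = 2 * (b \<bullet> (y - x))"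
  by (rule partial_deriv_eq)
    (auto simp: power2_norm_eq_inner inner_commute intro!: derivative_eq_intros)

lemma grad_norm2: "grad (\<lambda>y. (norm (y - x))\<^sup>2) y = 2 *\<^sub>R (y - x)"
  by (rule grad_eqI) (simp add: partial_deriv_norm2 inner_commute)

lemma laplacian_norm2: "laplacian (\<lambda>y. (norm (y - x))\<^sup>2) (y::'a::euclidean_space) = 2 * real DIM('a)"
proof -
  have "partial_deriv b (partial_deriv b (\<lambda>y. (norm (y - x))\<^sup>2)) y = 2" if "b \<in> Basis" for b
  proof -
    have "partial_deriv b (\<lambda>y. 2 * (b \<bullet> (y - x))) y = 2 * (b \<bullet> b)"
      by (rule partial_deriv_eq) (auto intro!: derivative_eq_intros)
    then show ?thesis using that by (simp add: partial_deriv_norm2[abs_def])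
  qed
  then show ?thesis by (simp add: laplacian_def)
qed

lemma open_eventually_ball: "open S \<Longrightarrow> x \<in> S \<Longrightarrow> \<exists>r>0. ball x r \<subseteq> S"
  by (simp add: open_contains_ball)

subsection \<open>Local test functions and comparison\<close>

text \<open>A C^1 function with derivative \<open>2 * \<bar>t\<bar>\<close>; it lets the cube of the
  positive part be differentiated twice by the product rule alone.\<close>

definition signed_sq :: "real \<Rightarrow> real" where "signed_sq t = t * \<bar>t\<bar>"

lemma has_real_derivative_signed_sq: "(signed_sq has_real_derivative 2 * \<bar>t\<bar>) (at t)"
proof -
  consider "t = 0" | "t > 0" | "t < 0" by linarith
  then show ?thesis
  proof cases
    case 1
    have "(\<lambda>h::real. \<bar>h\<bar>) \<midarrow>0\<rightarrow> 0" by (rule tendsto_rabs_zero) (rule tendsto_ident_at)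
    then have "(\<lambda>h::real. h * \<bar>h\<bar> / h) \<midarrow>0\<rightarrow> 0"
      by (rule Lim_transform_within[of _ _ _ _ 1]) auto
    then show ?thesis using 1 by (simp add: DERIV_def signed_sq_def)
  next
    case 2
    have "((\<lambda>t. t * t) has_real_derivative 2 * t) (at t)" by (auto intro!: derivative_eq_intros)
    from has_field_derivative_transform_within_open[OF this, of "{0<..}" signed_sq] 2
    show ?thesis by (simp add: signed_sq_def)
  next
    case 3
    have "((\<lambda>t. - (t * t)) has_real_derivative - 2 * t) (at t)" by (auto intro!: derivative_eq_intros)
    from has_field_derivative_transform_within_open[OF this, of "{..<0}" signed_sq] 3
    show ?thesis by (simp add: signed_sq_def)
  qed
qed

text \<open>The cube of the positive part of \<open>t\<close>: the lowest integer power of the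
  positive part that is of class C^2.\<close>

definition pos_cube :: "real \<Rightarrow> real" where "pos_cube t = (t ^ 3 + t * signed_sq t) / 2"

lemma pos_cube_nonpos: "t \<le> 0 \<Longrightarrow> pos_cube t = 0"
  by (simp add: pos_cube_def signed_sq_def power3_eq_cube)

lemma pos_cube_nonneg: "t \<ge> 0 \<Longrightarrow> pos_cube t = t ^ 3"
  by (simp add: pos_cube_def signed_sq_def power3_eq_cube)

lemma Ck_on_pos_cube: "Ck_on 2 UNIV pos_cube"
proof (rule Ck_on_real_2)
  show "(pos_cube has_real_derivative (3 * t\<^sup>2 + 3 * signed_sq t) / 2) (at t)" for t
    unfolding pos_cube_def
    by (rule derivative_eq_intros has_real_derivative_signed_sq refl)+
       (simp_all add: eval_nat_numeral signed_sq_def field_simps)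
  show "((\<lambda>t. (3 * t\<^sup>2 + 3 * signed_sq t) / 2) has_real_derivative 3 * t + 3 * \<bar>t\<bar>) (at t)" for t
    by (auto intro!: derivative_eq_intros has_real_derivative_signed_sq)
qed (auto intro!: continuous_intros)

lemma C2_cutoff:
  fixes x :: "'a::euclidean_space"
  assumes "r > 0"
  obtains \<eta> where "Ck_on 2 UNIV \<eta>" "\<And>y. y \<in> ball x (r/2) \<Longrightarrow> \<eta> y = 1"
    "\<And>y. dist x y \<ge> 3/4 * r \<Longrightarrow> \<eta> y = 0"
proof
  \<comment> \<open>The inner cube vanishes for distance at most \<open>r / 2\<close>, which gives
    the plateau \<open>pos_cube 1 = 1\<close>. It is at least 1 once the squared distance reaches
    \<open>r\<^sup>2 / 2\<close>, hence beyond \<open>3/4 * r\<close>, and there the outer cube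
    vanishes.\<close>
  define \<eta> where "\<eta> y = pos_cube (1 - pos_cube ((4 / r\<^sup>2) * (norm (y - x))\<^sup>2 - 1))" for y :: 'a
  show "Ck_on 2 UNIV \<eta>"
    unfolding \<eta>_def
    by (intro Ck_on_compose[OF _ _ _ _ Ck_on_pos_cube] Ck_on_diff Ck_on_cmult Ck_on_norm2 Ck_on_const) auto
  show "\<eta> y = 1" if "y \<in> ball x (r/2)" for y
  proof -
    have "norm (y - x) \<le> r/2" using that by (simp add: dist_norm norm_minus_commute)
    then have "(norm (y - x))\<^sup>2 \<le> (r/2)\<^sup>2" by (simp add: power_mono)
    then have "(4 / r\<^sup>2) * (norm (y - x))\<^sup>2 - 1 \<le> 0" using assms by (simp add: field_simps power2_eq_square)
    then show ?thesis by (simp add: \<eta>_def pos_cube_nonpos pos_cube_nonneg)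
  qed
  show "\<eta> y = 0" if "dist x y \<ge> 3/4 * r" for y
  proof -
    have "norm (y - x) \<ge> 3/4 * r" using that by (simp add: dist_norm norm_minus_commute)
    then have "(norm (y - x))\<^sup>2 \<ge> (3/4*r)\<^sup>2" using assms by (intro power_mono) auto
    moreover have "(3/4*r)\<^sup>2 \<ge> r\<^sup>2 / 2" by (simp add: power_mult_distrib power2_eq_square)
    ultimately have "(norm (y - x))\<^sup>2 \<ge> r\<^sup>2 / 2" by linarith
    then have ge: "(4 / r\<^sup>2) * (norm (y - x))\<^sup>2 - 1 \<ge> 1" using assms
      by (simp add: field_simps)
    then have "1 ^ 3 \<le> ((4 / r\<^sup>2) * (norm (y - x))\<^sup>2 - 1) ^ 3" by (intro power_mono) auto
    then show ?thesis using ge by (simp add: \<eta>_def pos_cube_nonpos pos_cube_nonneg)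
  qed
qed

text \<open>The definition of a viscosity subsolution admits only test functions of class C^2 on the
  whole open set, while the arguments below produce them on small balls. This bridges the
  gap.\<close>

lemma C2_extension:
  fixes x :: "'a::euclidean_space"
  assumes "r > 0" "Ck_on 2 (ball x r) \<phi>"
  obtains \<psi> where "Ck_on 2 UNIV \<psi>" "\<And>y. y \<in> ball x (r/2) \<Longrightarrow> \<psi> y = \<phi> y"
proof -
  obtain \<eta> where \<eta>: "Ck_on 2 UNIV \<eta>" "\<And>y. y \<in> ball x (r/2) \<Longrightarrow> \<eta> y = 1"
    "\<And>y. dist x y \<ge> 3/4 * r \<Longrightarrow> \<eta> y = 0" using C2_cutoff[OF assms(1)] by metis
  \<comment> \<open>The product with the cutoff, continued by 0, is of class C^2 on the ball and on
    the complement of the smaller closed ball; these two open sets cover the space.\<close>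
  define \<psi> where "\<psi> y = (if y \<in> ball x r then \<eta> y * \<phi> y else 0)" for y
  have "Ck_on 2 (ball x r) \<psi>"
    by (rule Ck_on_cong[OF _ Ck_on_mult[OF _ Ck_on_subset[OF \<eta>(1)] assms(2)]]) (auto simp: \<psi>_def)
  moreover have op: "open (- cball x (3/4*r))" by auto
  moreover have "Ck_on 2 (- cball x (3/4*r)) \<psi>"
    by (rule Ck_on_cong[OF op Ck_on_const[of _ _ 0]]) (use \<eta>(3) in \<open>auto simp: \<psi>_def\<close>)
  ultimately have "Ck_on 2 (ball x r \<union> - cball x (3/4*r)) \<psi>" by (intro Ck_on_Un) auto
  moreover have "ball x r \<union> - cball x (3/4*r) = UNIV" using assms(1) by auto
  ultimately have "Ck_on 2 UNIV \<psi>" by simp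
  moreover have "\<psi> y = \<phi> y" if "y \<in> ball x (r/2)" for y
    using that \<eta>(2)[OF that] assms(1) by (auto simp: \<psi>_def)
  ultimately show ?thesis using that by blast
qed

lemma DERIV_along_Basis:
  fixes \<phi> :: "'a::euclidean_space \<Rightarrow> real"
  assumes "\<phi> differentiable (at (x + t *\<^sub>R b))"
  shows "((\<lambda>t. \<phi> (x + t *\<^sub>R b)) has_real_derivative partial_deriv b \<phi> (x + t *\<^sub>R b)) (at t)"
proof -
  have D: "(\<phi> has_derivative (\<lambda>h. grad \<phi> (x + t *\<^sub>R b) \<bullet> h)) (at (x + t *\<^sub>R b))"
    by (rule has_derivative_grad[OF assms])
  have "((\<lambda>t. \<phi> (x + t *\<^sub>R b)) has_derivative (\<lambda>h. grad \<phi> (x + t *\<^sub>R b) \<bullet> (h *\<^sub>R b))) (at t)"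
    by (rule has_derivative_compose[where f = "\<lambda>t. x + t *\<^sub>R b", OF _ D]) (auto intro!: derivative_eq_intros)
  then show ?thesis using partial_deriv_eq[OF D, of b]
    by (simp add: has_field_derivative_def mult_commute_abs)
qed

lemma second_derivative_test:
  fixes x :: "'a::euclidean_space"
  assumes "r > 0" "Ck_on 2 (ball x r) \<phi>" "\<And>y. y \<in> ball x r \<Longrightarrow> \<phi> x \<le> \<phi> y"
  shows "grad \<phi> x = 0" "laplacian \<phi> x \<ge> 0"
proof -
  have b: "partial_deriv b \<phi> x = 0 \<and> partial_deriv b (partial_deriv b \<phi>) x \<ge> 0" if b: "b \<in> Basis" for b
  proof -
    have inb: "x + t *\<^sub>R b \<in> ball x r" if "\<bar>t\<bar> < r" for t
      using that b by (simp add: dist_norm)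
    have g1: "((\<lambda>t. \<phi> (x + t *\<^sub>R b)) has_real_derivative partial_deriv b \<phi> (x + t *\<^sub>R b)) (at t)" if "\<bar>t\<bar> < r" for t
      by (intro DERIV_along_Basis Ck_on_2D[OF assms(2) inb[OF that] b])
    have g2: "((\<lambda>t. partial_deriv b \<phi> (x + t *\<^sub>R b)) has_real_derivative partial_deriv b (partial_deriv b \<phi>) x) (at 0)"
      using DERIV_along_Basis[of "partial_deriv b \<phi>" x 0 b] Ck_on_2D(2)[OF assms(2) _ b] assms(1) by simp
    have z: "partial_deriv b \<phi> x = 0"
      using DERIV_local_min[OF g1[of 0] assms(1)] inb assms(1,3) by simp
    \<comment> \<open>If it were negative, the first derivative, which vanishes at the centre, would
      be negative just to its right, and the mean value theorem would give a value below the
      minimum.\<close>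
    have "partial_deriv b (partial_deriv b \<phi>) x \<ge> 0"
    proof (rule ccontr)
      assume "\<not> ?thesis"
      then obtain d where d: "d > 0" "\<And>h. h > 0 \<Longrightarrow> h < d \<Longrightarrow> partial_deriv b \<phi> (x + h *\<^sub>R b) < 0"
        using DERIV_neg_dec_right[OF g2] z by auto
      define h where "h = min d r / 2"
      have h: "0 < h" "h < d" "h < r" using d assms(1) by (auto simp: h_def)
      obtain s where s: "0 < s" "s < h" "\<phi> (x + h *\<^sub>R b) - \<phi> (x + 0 *\<^sub>R b) = (h - 0) * partial_deriv b \<phi> (x + s *\<^sub>R b)"
        using MVT2[OF h(1), of "\<lambda>t. \<phi> (x + t *\<^sub>R b)" "\<lambda>t. partial_deriv b \<phi> (x + t *\<^sub>R b)"] g1 h by auto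
      have "(h - 0) * partial_deriv b \<phi> (x + s *\<^sub>R b) < 0" using d(2)[of s] s h by (simp add: mult_pos_neg)
      then show False using s(3) assms(3)[OF inb, of h] h by simp
    qed
    with z show ?thesis by simp
  qed
  then show "grad \<phi> x = 0" "laplacian \<phi> x \<ge> 0"
    by (auto intro!: grad_eqI sum_nonneg simp: laplacian_def)
qed

text \<open>The test function need only be defined near \<open>x\<close> and need not agree with
  \<open>w\<close> there; its own additive constant is free.\<close>

definition touches_above :: "('a::euclidean_space \<Rightarrow> real) \<Rightarrow> ('a \<Rightarrow> real) \<Rightarrow> 'a \<Rightarrow> bool" where
  "touches_above \<phi> w x \<longleftrightarrow> (\<exists>r>0. Ck_on 2 (ball x r) \<phi> \<and> (\<forall>y\<in>ball x r. w y - \<phi> y \<le> w x - \<phi> x))"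

text \<open>The relation \<open>P\<close> between position, gradient and Laplacian is left abstract
  so that drift terms, variable right-hand sides and rescaled inequalities share one notion.
  Continuity of \<open>w\<close> is kept separate.\<close>

definition vsub :: "('a::euclidean_space \<Rightarrow> 'a \<Rightarrow> real \<Rightarrow> bool) \<Rightarrow> 'a set \<Rightarrow> ('a \<Rightarrow> real) \<Rightarrow> bool" where
  "vsub P S w \<longleftrightarrow> (\<forall>x\<in>S. \<forall>\<phi>. touches_above \<phi> w x \<longrightarrow> P x (grad \<phi> x) (laplacian \<phi> x))"

lemma vsubD: "vsub P S w \<Longrightarrow> x \<in> S \<Longrightarrow> touches_above \<phi> w x \<Longrightarrow> P x (grad \<phi> x) (laplacian \<phi> x)"
  by (simp add: vsub_def)

lemma vsub_subset: "vsub P S w \<Longrightarrow> T \<subseteq> S \<Longrightarrow> vsub P T w"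
  by (auto simp: vsub_def)

lemma vsub_mono: "vsub P S w \<Longrightarrow> (\<And>x \<xi> l. x \<in> S \<Longrightarrow> P x \<xi> l \<Longrightarrow> Q x \<xi> l) \<Longrightarrow> vsub Q S w"
  by (auto simp: vsub_def)

lemma touches_aboveE:
  assumes "touches_above \<phi> w x" "open S" "x \<in> S"
  obtains r where "r > 0" "ball x r \<subseteq> S" "Ck_on 2 (ball x r) \<phi>" "\<And>y. y \<in> ball x r \<Longrightarrow> w y - \<phi> y \<le> w x - \<phi> x"
proof -
  obtain r where r: "r > 0" "Ck_on 2 (ball x r) \<phi>" "\<And>y. y \<in> ball x r \<Longrightarrow> w y - \<phi> y \<le> w x - \<phi> x"
    using assms(1) unfolding touches_above_def by auto
  obtain s where s: "s > 0" "ball x s \<subseteq> S" using open_eventually_ball assms(2,3) by blast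
  have sub: "ball x (min r s) \<subseteq> ball x r" by auto
  show ?thesis
    by (rule that[of "min r s"]) (use r s Ck_on_subset[OF r(2) sub] in auto)
qed

lemma touches_aboveI:
  assumes "open S" "x \<in> S" "Ck_on 2 S \<phi>" "\<And>y. y \<in> S \<Longrightarrow> w y - \<phi> y \<le> w x - \<phi> x"
  shows "touches_above \<phi> w x"
proof -
  obtain r where "r > 0" "ball x r \<subseteq> S" using open_eventually_ball assms(1,2) by blast
  then show ?thesis using Ck_on_subset[OF assms(3)] assms(4) unfolding touches_above_def by blast
qed

lemma viscosity_subsolution_iff_vsub:
  assumes "open S"
  shows "viscosity_subsolution H \<epsilon> S c w \<longleftrightarrow> continuous_on S w \<and> vsub (\<lambda>x \<xi> l. H x \<xi> - \<epsilon> * l \<le> c) S w"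
    (is "?A \<longleftrightarrow> ?B")
proof
  assume B: ?B
  show ?A unfolding viscosity_subsolution_def
  proof (intro conjI ballI allI impI)
    fix x \<phi> assume x: "x \<in> S" and *: "Ck_on 2 S \<phi> \<and> (\<forall>\<^sub>F y in nhds x. w y - \<phi> y \<le> w x - \<phi> x)"
    then obtain T where T: "open T" "x \<in> T" "\<And>y. y \<in> T \<Longrightarrow> w y - \<phi> y \<le> w x - \<phi> x"
      by (auto simp: eventually_nhds)
    have "touches_above \<phi> w x"
      by (rule touches_aboveI[of "S \<inter> T"]) (use T x * assms Ck_on_subset[of 2 S \<phi> "S \<inter> T"] in auto)
    with B x show "H x (grad \<phi> x) - \<epsilon> * laplacian \<phi> x \<le> c" unfolding vsub_def by blast
  qed (use B in auto)
next
  assume A: ?A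
  have "H x (grad \<phi> x) - \<epsilon> * laplacian \<phi> x \<le> c" if x: "x \<in> S" and t: "touches_above \<phi> w x" for x \<phi>
  proof -
    obtain r where r: "r > 0" "ball x r \<subseteq> S" "Ck_on 2 (ball x r) \<phi>" "\<And>y. y \<in> ball x r \<Longrightarrow> w y - \<phi> y \<le> w x - \<phi> x"
      using touches_aboveE[OF t assms x] by metis
    obtain \<psi> where \<psi>: "Ck_on 2 UNIV \<psi>" "\<And>y. y \<in> ball x (r/2) \<Longrightarrow> \<psi> y = \<phi> y"
      using C2_extension[OF r(1,3)] by metis
    have "\<forall>\<^sub>F y in nhds x. w y - \<psi> y \<le> w x - \<psi> x"
      unfolding eventually_nhds by (rule exI[of _ "ball x (r/2)"]) (use r \<psi> in auto)
    then have "H x (grad \<psi> x) - \<epsilon> * laplacian \<psi> x \<le> c"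
      using A x Ck_on_subset[OF \<psi>(1)] unfolding viscosity_subsolution_def by blast
    moreover have "grad \<psi> x = grad \<phi> x" "laplacian \<psi> x = laplacian \<phi> x"
      using grad_cong[of "ball x (r/2)" x \<psi> \<phi>] laplacian_cong[of "ball x (r/2)" x \<psi> \<phi>] \<psi>(2) r(1) by auto
    ultimately show ?thesis by simp
  qed
  then show ?B using A unfolding vsub_def viscosity_subsolution_def by blast
qed

text \<open>For a constant right-hand side and a classical supersolution, comparison needs no
  doubling of variables: the supersolution, made strict by a small quadratic, is itself the test
  function at a maximum of the difference.\<close>

lemma vsub_comparison:
  fixes a :: "'a::euclidean_space"
  assumes r: "r > 0" and v: "continuous_on (cball a r) v" "vsub (\<lambda>x \<xi> l. - l \<le> k) (ball a r) v"
    and \<phi>: "continuous_on (cball a r) \<phi>" "Ck_on 2 (ball a r) \<phi>" "\<And>x. x \<in> ball a r \<Longrightarrow> k \<le> - laplacian \<phi> x"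
    and le: "\<And>x. x \<in> sphere a r \<Longrightarrow> v x \<le> \<phi> x" and x: "x \<in> ball a r"
  shows "v x \<le> \<phi> x"
proof (rule ccontr)
  assume "\<not> v x \<le> \<phi> x"
  define m where "m = v x - \<phi> x"
  have m: "m > 0" using \<open>\<not> _\<close> by (simp add: m_def)
  \<comment> \<open>On the sphere the quadratic adds only
    \<open>\<sigma> * r\<^sup>2 = m / 2\<close>, less than the assumed excess \<open>m\<close> in
    the interior, so the maximum cannot move to the sphere.\<close>
  define \<sigma> where "\<sigma> = m / (2 * r\<^sup>2)"
  have \<sigma>: "\<sigma> > 0" using m r by (simp add: \<sigma>_def)
  define \<psi> where "\<psi> y = \<phi> y - \<sigma> * (norm (y - a))\<^sup>2" for y
  have "continuous_on (cball a r) (\<lambda>y. v y - \<psi> y)"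
    unfolding \<psi>_def by (intro continuous_intros v \<phi>)
  then obtain y where y: "y \<in> cball a r" "\<And>z. z \<in> cball a r \<Longrightarrow> v z - \<psi> z \<le> v y - \<psi> y"
    using continuous_attains_sup[of "cball a r"] r by force
  have "m \<le> v x - \<psi> x" using \<sigma> by (simp add: m_def \<psi>_def)
  also have "\<dots> \<le> v y - \<psi> y" using y(2)[of x] x by simp
  finally have my: "m \<le> v y - \<psi> y" .
  have "y \<notin> sphere a r"
  proof
    assume "y \<in> sphere a r"
    then have "norm (y - a) = r" by (simp add: dist_norm norm_minus_commute)
    then have "v y - \<psi> y \<le> \<sigma> * r\<^sup>2" using le[OF \<open>y \<in> sphere a r\<close>] by (simp add: \<psi>_def)
    also have "\<dots> = m / 2" using r by (simp add: \<sigma>_def)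
    finally show False using my m by simp
  qed
  then have yb: "y \<in> ball a r" using y(1) by auto
  have C\<psi>: "Ck_on 2 (ball a r) \<psi>" unfolding \<psi>_def
    by (intro Ck_on_diff Ck_on_cmult Ck_on_norm2 \<phi>) auto
  have "touches_above \<psi> v y"
    by (rule touches_aboveI[OF _ yb C\<psi>]) (use y in auto)
  from vsubD[OF v(2) yb this] have "- laplacian \<psi> y \<le> k" .
  moreover have "laplacian \<psi> y = laplacian \<phi> y - \<sigma> * (2 * real DIM('a))"
    unfolding \<psi>_def
    by (subst laplacian_diff[OF _ yb \<phi>(2)])
      (auto intro!: Ck_on_cmult Ck_on_norm2 simp: laplacian_cmult[OF open_UNIV UNIV_I Ck_on_norm2] laplacian_norm2)
  moreover have "\<sigma> * (2 * real DIM('a)) > 0" using \<sigma> by simp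
  ultimately show False using \<phi>(3)[OF yb] by linarith
qed

subsection \<open>Density of traces of harmonic polynomials on spheres\<close>

text \<open>Homogeneous polynomials of degree \<open>d\<close>, generated by rules so that closure
  properties and Euler's identity follow by rule induction. The zero function belongs to every
  degree.\<close>

inductive homog :: "nat \<Rightarrow> ('a::euclidean_space \<Rightarrow> real) \<Rightarrow> bool" where
  zero: "homog d (\<lambda>_. 0)"
| const: "homog 0 (\<lambda>_. c)"
| mult: "homog d f \<Longrightarrow> b \<in> Basis \<Longrightarrow> homog (Suc d) (\<lambda>x. (x \<bullet> b) * f x)"
| add: "homog d f \<Longrightarrow> homog d g \<Longrightarrow> homog d (\<lambda>x. f x + g x)"

lemma homog_Ck: "homog d f \<Longrightarrow> Ck_on k S f"
proof -
  assume "homog d f"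
  then have "Ck_on k UNIV f"
    by (induction) (auto intro: Ck_on_add Ck_on_mult)
  then show ?thesis using Ck_on_subset by blast
qed

lemma homog_differentiable: "homog d f \<Longrightarrow> f differentiable (at x)"
  using Ck_on_imp_differentiable[OF homog_Ck[of d f 1 UNIV], of x] by simp

lemma homog_cmult: "homog d f \<Longrightarrow> homog d (\<lambda>x. c * f x)"
proof (induction rule: homog.induct)
  case (mult d f b)
  from homog.mult[OF mult.IH mult.hyps(2)] show ?case by (simp add: mult.left_commute)
qed (auto simp: distrib_left intro: homog.intros)

lemma homog_sum: "(\<And>i. i \<in> I \<Longrightarrow> homog d (f i)) \<Longrightarrow> homog d (\<lambda>x. \<Sum>i\<in>I. f i x)"
  by (induction I rule: infinite_finite_induct) (auto intro: homog.intros)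

lemma homog_mult:
  assumes "homog d f" "homog e g" shows "homog (d + e) (\<lambda>x. f x * g x)"
  using assms(1)
proof (induction rule: homog.induct)
  case (const c) then show ?case using homog_cmult[OF assms(2)] by simp
next
  case (mult d f b)
  from homog.mult[OF mult.IH mult.hyps(2)] show ?case by (simp add: mult.assoc)
qed (auto simp: distrib_right intro: homog.intros)

lemma homog_norm2: "homog 2 (\<lambda>x::'a::euclidean_space. (norm x)\<^sup>2)"
proof -
  have h: "homog 2 (\<lambda>x. (x \<bullet> b) * ((x \<bullet> b) * 1))" if "b \<in> Basis" for b :: 'a
    unfolding numeral_2_eq_2 by (intro homog.mult homog.const that)
  have "(norm x)\<^sup>2 = (\<Sum>b\<in>Basis. (x \<bullet> b) * ((x \<bullet> b) * 1))" for x :: 'a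
    by (subst power2_norm_eq_inner, subst euclidean_inner) simp
  then show ?thesis using homog_sum[of Basis 2, OF h] by simp
qed

text \<open>Degree 0 is separated because truncated subtraction would only give degree 0 again,
  while the vanishing of the Laplacian below degree 2 needs the derivative to be zero.\<close>

lemma homog_partial_deriv:
  assumes "homog d f"
  shows "(if d = 0 then partial_deriv b f = (\<lambda>_. 0) else homog (d - 1) (partial_deriv b f))"
  using assms
proof (induction rule: homog.induct)
  case (zero d) then show ?case by (auto simp: partial_deriv_const[abs_def] intro: homog.intros)
next
  case (const c) then show ?case by (auto simp: partial_deriv_const[abs_def])
next
  case (mult d f v)
  have eq: "partial_deriv b (\<lambda>x. (x \<bullet> v) * f x) = (\<lambda>x. (x \<bullet> v) * partial_deriv b f x + (b \<bullet> v) * f x)"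
  proof
    fix x
    show "partial_deriv b (\<lambda>x. (x \<bullet> v) * f x) x = (x \<bullet> v) * partial_deriv b f x + (b \<bullet> v) * f x"
      by (subst partial_deriv_mult)
        (auto intro!: homog_differentiable[OF mult.hyps(1)] Ck_on_imp_differentiable[of 1 UNIV] Ck_on_inner)
  qed
  have "homog d (\<lambda>x. (x \<bullet> v) * partial_deriv b f x)"
    using mult.IH homog.mult[OF _ mult.hyps(2), of "d - 1" "partial_deriv b f"]
    by (cases d) (auto intro: homog.intros)
  then show ?case
    using homog.add[OF _ homog_cmult[OF mult.hyps(1), of "b \<bullet> v"]] by (simp add: eq)
next
  case (add d f g)
  have eq: "partial_deriv b (\<lambda>x. f x + g x) = (\<lambda>x. partial_deriv b f x + partial_deriv b g x)"
    using partial_deriv_add[OF homog_differentiable[OF add.hyps(1)] homog_differentiable[OF add.hyps(2)]] by auto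
  show ?case unfolding eq using add.IH by (auto split: if_splits intro: homog.intros)
qed

lemma homog_laplacian:
  assumes "homog d f"
  shows "if d < 2 then laplacian f = (\<lambda>_. 0) else homog (d - 2) (laplacian f)"
proof -
  have eq: "laplacian f = (\<lambda>x. \<Sum>b\<in>Basis. partial_deriv b (partial_deriv b f) x)"
    by (auto simp: laplacian_def)
  have "if d < 2 then partial_deriv b (partial_deriv b f) = (\<lambda>_. 0)
     else homog (d - 2) (partial_deriv b (partial_deriv b f))" for b
    using homog_partial_deriv[OF assms, of b] homog_partial_deriv[of "d - 1" "partial_deriv b f" b]
    by (cases "d = 0"; cases "d = 1") (auto simp: partial_deriv_const[abs_def] numeral_2_eq_2)
  then show ?thesis unfolding eq by (auto intro!: homog_sum split: if_splits)
qed

lemma homog_euler: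
  assumes "homog d f" shows "x \<bullet> grad f x = real d * f x"
  using assms
proof (induction rule: homog.induct)
  case (mult d f b)
  have "grad (\<lambda>x. (x \<bullet> b) * f x) x = (x \<bullet> b) *\<^sub>R grad f x + f x *\<^sub>R b"
    by (subst grad_mult)
      (auto intro!: homog_differentiable[OF mult.hyps(1)] Ck_on_imp_differentiable[of 1 UNIV] Ck_on_inner)
  then show ?case using mult.IH by (simp add: inner_add_right algebra_simps)
next
  case (add d f g)
  then show ?case using grad_add[OF homog_differentiable[OF add.hyps(1)] homog_differentiable[OF add.hyps(2)]]
    by (simp add: inner_add_right algebra_simps)
qed auto

lemma homog_norm_pow: "homog (2 * j) (\<lambda>x::'a::euclidean_space. ((norm x)\<^sup>2) ^ j)"
proof (induction j)
  case (Suc j)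
  from homog_mult[OF homog_norm2 Suc] show ?case by simp
qed (auto intro: homog.const)

text \<open>Euler's identity turns the mixed gradient term of the product rule into a multiple of
  \<open>q\<close>; this is what makes the Dirichlet problem for polynomials algebraic.\<close>

lemma laplacian_norm2_mult_homog:
  fixes x :: "'a::euclidean_space"
  assumes "homog m q"
  shows "laplacian (\<lambda>x. (norm x)\<^sup>2 * q x) x = (norm x)\<^sup>2 * laplacian q x + (2 * real DIM('a) + 4 * real m) * q x"
proof -
  have "laplacian (\<lambda>x. (norm x)\<^sup>2 * q x) x
     = (norm x)\<^sup>2 * laplacian q x + 2 * (grad (\<lambda>x. (norm x)\<^sup>2) x \<bullet> grad q x) + q x * laplacian (\<lambda>x. (norm x)\<^sup>2) x"
    by (rule laplacian_mult[of UNIV]) (use homog_Ck[OF assms] homog_Ck[OF homog_norm2] in auto)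
  moreover have "grad (\<lambda>x::'a. (norm x)\<^sup>2) x = 2 *\<^sub>R x" "laplacian (\<lambda>x::'a. (norm x)\<^sup>2) x = 2 * real DIM('a)"
    using grad_norm2[of 0 x] laplacian_norm2[of 0 x] by auto
  ultimately show ?thesis using homog_euler[OF assms, of x] by (simp add: algebra_simps)
qed

lemma laplacian_norm_pow_mult_homog:
  fixes x :: "'a::euclidean_space"
  assumes "homog m q"
  shows "laplacian (\<lambda>x. ((norm x)\<^sup>2) ^ Suc j * q x) x = ((norm x)\<^sup>2) ^ Suc j * laplacian q x
     + 2 * real (Suc j) * (real DIM('a) + 2 * real m + 2 * real j) * (((norm x)\<^sup>2) ^ j * q x)"
proof (induction j)
  case 0 then show ?case using laplacian_norm2_mult_homog[OF assms, of x] by (simp add: algebra_simps)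
next
  case (Suc j)
  have h: "homog (2 * Suc j + m) (\<lambda>x. ((norm x)\<^sup>2) ^ Suc j * q x)"
    by (rule homog_mult[OF homog_norm_pow assms])
  have "laplacian (\<lambda>x. (norm x)\<^sup>2 * (((norm x)\<^sup>2) ^ Suc j * q x)) x
    = (norm x)\<^sup>2 * laplacian (\<lambda>x. ((norm x)\<^sup>2) ^ Suc j * q x) x + (2 * real DIM('a) + 4 * real (2 * Suc j + m)) * (((norm x)\<^sup>2) ^ Suc j * q x)"
    by (rule laplacian_norm2_mult_homog[OF h])
  also have "\<dots> = ((norm x)\<^sup>2) ^ Suc (Suc j) * laplacian q x
     + 2 * real (Suc (Suc j)) * (real DIM('a) + 2 * real m + 2 * real (Suc j)) * (((norm x)\<^sup>2) ^ Suc j * q x)"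
    unfolding Suc.IH by (simp add: algebra_simps)
  finally show ?case by (simp add: mult.assoc)
qed

text \<open>The leading candidate is a multiple of \<open>((norm x)\<^sup>2) ^ Suc j * q x\<close>.
  Its Laplacian is right up to an error containing \<open>laplacian q\<close>, whose degree is lower
  by 2 and whose power of the norm is higher by one; the induction on the degree, for all
  \<open>j\<close> at once, removes it.\<close>

lemma homog_solve_laplacian:
  fixes q :: "'a::euclidean_space \<Rightarrow> real"
  assumes "homog m q"
  shows "\<exists>s. homog (m + 2 * j) s \<and> (\<forall>x. laplacian (\<lambda>x. (norm x)\<^sup>2 * s x) x = ((norm x)\<^sup>2) ^ j * q x)"
  using assms
proof (induction m arbitrary: q j rule: less_induct)
  case (less m)
  \<comment> \<open>The coefficient found in \<open>laplacian_norm_pow_mult_homog\<close>; its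
    positivity is all that the division requires.\<close>
  define C where "C = 2 * real (Suc j) * (real DIM('a) + 2 * real m + 2 * real j)"
  have "0 < real DIM('a) + 2 * real m + 2 * real j"
    by (intro add_pos_nonneg) auto
  then have C: "C > 0" unfolding C_def by (intro mult_pos_pos) auto
  obtain s' where s': "homog (m + 2 * j) s'"
    "\<And>x. laplacian (\<lambda>x. (norm x)\<^sup>2 * s' x) x = ((norm x)\<^sup>2) ^ Suc j * laplacian q x"
  proof (cases "m < 2")
    case True
    then have "laplacian q = (\<lambda>_. 0)" using homog_laplacian[OF less.prems] by simp
    then show ?thesis using that[of "\<lambda>_. 0"] by (simp add: homog.zero)
  next
    case False
    then have "homog (m - 2) (laplacian q)" using homog_laplacian[OF less.prems] by simp
    then obtain s' where "homog (m - 2 + 2 * Suc j) s'"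
      "\<And>x. laplacian (\<lambda>x. (norm x)\<^sup>2 * s' x) x = ((norm x)\<^sup>2) ^ Suc j * laplacian q x"
      using less.IH[of "m - 2" "laplacian q" "Suc j"] False by auto
    moreover have "m - 2 + 2 * Suc j = m + 2 * j" using False by simp
    ultimately show ?thesis using that by metis
  qed
  define s where "s x = (1 / C) * (((norm x)\<^sup>2) ^ j * q x + - 1 * s' x)" for x
  have hq: "homog (m + 2 * j) (\<lambda>x. ((norm x)\<^sup>2) ^ j * q x)"
    using homog_mult[OF homog_norm_pow less.prems, of j] by (simp add: add.commute)
  have hs: "homog (m + 2 * j) s"
    unfolding s_def by (intro homog_cmult homog.add hq s')
  have "laplacian (\<lambda>x. (norm x)\<^sup>2 * s x) x = ((norm x)\<^sup>2) ^ j * q x" for x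
  proof -
    have eq: "(\<lambda>x. (norm x)\<^sup>2 * s x) = (\<lambda>x. (1 / C) * (((norm x)\<^sup>2) ^ Suc j * q x - (norm x)\<^sup>2 * s' x))"
      by (auto simp: s_def algebra_simps)
    have h1: "Ck_on 2 UNIV (\<lambda>x. ((norm x)\<^sup>2) ^ Suc j * q x)"
      by (rule homog_Ck[OF homog_mult[OF homog_norm_pow less.prems]])
    have h2: "Ck_on 2 UNIV (\<lambda>x. (norm x)\<^sup>2 * s' x)"
      by (rule homog_Ck[OF homog_mult[OF homog_norm2 s'(1)]])
    have "laplacian (\<lambda>x. (norm x)\<^sup>2 * s x) x
       = (1 / C) * (laplacian (\<lambda>x. ((norm x)\<^sup>2) ^ Suc j * q x) x - laplacian (\<lambda>x. (norm x)\<^sup>2 * s' x) x)"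
      unfolding eq
      by (simp only: laplacian_cmult[OF open_UNIV UNIV_I Ck_on_diff[OF open_UNIV h1 h2]]
          laplacian_diff[OF open_UNIV UNIV_I h1 h2])
    also have "\<dots> = (1 / C) * (C * (((norm x)\<^sup>2) ^ j * q x))"
      unfolding laplacian_norm_pow_mult_homog[OF less.prems] s'(2) C_def by simp
    finally show ?thesis using C by simp
  qed
  with hs show ?case by blast
qed

text \<open>Subtract \<open>(norm x)\<^sup>2 * s x\<close> with the same Laplacian as
  \<open>f\<close>. The result is harmonic, and on the sphere the correction is
  \<open>r\<^sup>2 * s x\<close>, a datum of degree \<open>d - 2\<close>, to which the induction
  hypothesis applies. Below degree 2 the datum is already harmonic.\<close>

lemma homog_Dirichlet:
  fixes f :: "'a::euclidean_space \<Rightarrow> real"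
  assumes "homog d f"
  shows "\<exists>h. Ck_on 2 UNIV h \<and> (\<forall>x. laplacian h x = 0) \<and> (\<forall>x\<in>sphere 0 r. h x = f x)"
  using assms
proof (induction d arbitrary: f rule: less_induct)
  case (less d)
  show ?case
  proof (cases "d < 2")
    case True
    then have "laplacian f = (\<lambda>_. 0)" using homog_laplacian[OF less.prems] by simp
    then show ?thesis using homog_Ck[OF less.prems] by (intro exI[of _ f]) auto
  next
    case False
    then have "homog (d - 2) (laplacian f)" using homog_laplacian[OF less.prems] by simp
    then obtain s where s: "homog (d - 2) s" "\<And>x. laplacian (\<lambda>x. (norm x)\<^sup>2 * s x) x = laplacian f x"
      using homog_solve_laplacian[of "d - 2" "laplacian f" 0] by auto
    obtain h where h: "Ck_on 2 UNIV h" "\<And>x. laplacian h x = 0" "\<And>x. x \<in> sphere 0 r \<Longrightarrow> h x = s x"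
      using less.IH[OF _ s(1)] False by auto
    have Cf: "Ck_on 2 UNIV f" by (rule homog_Ck[OF less.prems])
    have Cs: "Ck_on 2 UNIV (\<lambda>x. (norm x)\<^sup>2 * s x)"
      by (rule homog_Ck[OF homog_mult[OF homog_norm2 s(1)]])
    let ?H = "\<lambda>x. (f x - (norm x)\<^sup>2 * s x) + r\<^sup>2 * h x"
    note CH = Ck_on_diff[OF open_UNIV Cf Cs] and Ch = Ck_on_cmult[OF open_UNIV h(1), of "r\<^sup>2"]
    show ?thesis
    proof (intro exI[of _ ?H] conjI allI ballI)
      show "Ck_on 2 UNIV ?H" by (rule Ck_on_add[OF open_UNIV CH Ch])
      show "laplacian ?H x = 0" for x
        by (simp add: laplacian_add[OF open_UNIV UNIV_I CH Ch] laplacian_diff[OF open_UNIV UNIV_I Cf Cs]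
            laplacian_cmult[OF open_UNIV UNIV_I h(1)] h(2) s(2))
      show "?H x = f x" if "x \<in> sphere 0 r" for x
        using h(3)[OF that] that by simp
    qed
  qed
qed

text \<open>Sums of homogeneous polynomials of mixed degrees. This class contains all real
  polynomial functions, the form in which the Stone-Weierstrass theorem delivers its
  approximants.\<close>

inductive homog_sum_pred :: "('a::euclidean_space \<Rightarrow> real) \<Rightarrow> bool" where
  homog: "homog d f \<Longrightarrow> homog_sum_pred f"
| add: "homog_sum_pred f \<Longrightarrow> homog_sum_pred g \<Longrightarrow> homog_sum_pred (\<lambda>x. f x + g x)"

lemma homog_sum_pred_mult:
  assumes "homog_sum_pred f" "homog_sum_pred g" shows "homog_sum_pred (\<lambda>x. f x * g x)"
proof -
  have *: "homog_sum_pred (\<lambda>x. f x * g x)" if f: "homog d f" for d f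
    using assms(2)
  proof (induction rule: homog_sum_pred.induct)
    case (homog e g) then show ?case using homog_sum_pred.homog[OF homog_mult[OF f homog.hyps]] by simp
  next
    case (add g h) from homog_sum_pred.add[OF add.IH] show ?case by (simp add: distrib_left)
  qed
  show ?thesis using assms(1)
  proof (induction rule: homog_sum_pred.induct)
    case (homog d f) then show ?case by (rule *)
  next
    case (add f h) from homog_sum_pred.add[OF add.IH] show ?case by (simp add: distrib_right)
  qed
qed

lemma real_polynomial_function_homog_sum:
  fixes f :: "'a::euclidean_space \<Rightarrow> real"
  assumes "real_polynomial_function f" shows "homog_sum_pred f"
  using assms
proof (induction rule: real_polynomial_function.induct)
  case (linear f)
  have h: "homog 1 (\<lambda>x. f b * ((x \<bullet> b) * 1))" if "b \<in> Basis" for b :: 'a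
    unfolding One_nat_def by (intro homog_cmult homog.mult homog.const that)
  have "f x = (\<Sum>b\<in>Basis. f b * ((x \<bullet> b) * 1))" for x
  proof -
    have "f x = f (\<Sum>b\<in>Basis. (x \<bullet> b) *\<^sub>R b)" by (simp add: euclidean_representation)
    also have "\<dots> = (\<Sum>b\<in>Basis. f ((x \<bullet> b) *\<^sub>R b))"
      by (rule linear_sum[OF bounded_linear.linear[OF linear]])
    also have "\<dots> = (\<Sum>b\<in>Basis. f b * ((x \<bullet> b) * 1))"
      by (intro sum.cong refl) (subst linear_cmul[OF bounded_linear.linear[OF linear]], simp)
    finally show ?thesis .
  qed
  then have eq: "f = (\<lambda>x. \<Sum>b\<in>Basis. f b * ((x \<bullet> b) * 1))" by (rule ext)
  have "homog_sum_pred (\<lambda>x. \<Sum>b\<in>Basis. f b * ((x \<bullet> b) * 1))"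
    by (rule homog_sum_pred.homog[OF homog_sum]) (rule h)
  from back_subst[of homog_sum_pred, OF this eq[symmetric]] show ?case .
qed (auto intro: homog_sum_pred.intros homog.intros homog_sum_pred_mult)

lemma homog_sum_Dirichlet:
  fixes f :: "'a::euclidean_space \<Rightarrow> real"
  assumes "homog_sum_pred f"
  shows "\<exists>h. Ck_on 2 UNIV h \<and> (\<forall>x. laplacian h x = 0) \<and> (\<forall>x\<in>sphere 0 r. h x = f x)"
  using assms
proof (induction rule: homog_sum_pred.induct)
  case (homog d f) then show ?case by (rule homog_Dirichlet)
next
  case (add f g)
  then obtain h k where h: "Ck_on 2 UNIV h" "\<And>x. laplacian h x = 0" "\<And>x. x \<in> sphere 0 r \<Longrightarrow> h x = f x"
    and k: "Ck_on 2 UNIV k" "\<And>x. laplacian k x = 0" "\<And>x. x \<in> sphere 0 r \<Longrightarrow> k x = g x" by metis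
  then show ?case
    by (intro exI[of _ "\<lambda>x. h x + k x"]) (auto intro!: Ck_on_add simp: laplacian_add[OF open_UNIV UNIV_I h(1) k(1)])
qed

lemma Poisson_sphere_approx:
  fixes a :: "'a::euclidean_space"
  assumes "continuous_on (sphere a r) g" "\<eta> > 0"
  obtains h where "Ck_on 2 UNIV h" "\<And>x. laplacian h x = l" "\<And>x. x \<in> sphere a r \<Longrightarrow> \<bar>h x - g x\<bar> < \<eta>"
proof -
  define n where "n = real DIM('a)"
  have n: "n > 0" by (simp add: n_def)
  have "continuous_on (sphere 0 r) (\<lambda>z. g (a + z))"
    by (rule continuous_on_compose2[OF assms(1)]) (auto intro!: continuous_intros simp: dist_norm)
  then obtain P where P: "real_polynomial_function P" "\<And>z. z \<in> sphere 0 r \<Longrightarrow> \<bar>g (a + z) - P z\<bar> < \<eta>"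
    using Stone_Weierstrass_real_polynomial_function[OF compact_sphere[of "0::'a" r] _ assms(2), of "\<lambda>z. g (a + z)"] by blast
  obtain h where h: "Ck_on 2 UNIV h" "\<And>x. laplacian h x = 0" "\<And>x. x \<in> sphere 0 r \<Longrightarrow> h x = P x"
    using homog_sum_Dirichlet[OF real_polynomial_function_homog_sum[OF P(1)]] by blast
  define k where "k x = h (- a + 1 *\<^sub>R x)" for x
  have k: "Ck_on 2 UNIV k" unfolding k_def using Ck_on_affine[OF open_UNIV h(1), of "-a" 1] by simp
  have lk: "laplacian k x = 0" for x
    unfolding k_def by (subst laplacian_affine[OF open_UNIV UNIV_I h(1)]) (simp add: h(2))
  \<comment> \<open>The added quadratic has Laplacian \<open>l\<close> and vanishes on the sphere,
    so it prescribes the Laplacian without disturbing the boundary values.\<close>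
  define u where "u x = k x + (l / (2 * n)) * ((norm (x - a))\<^sup>2 - r\<^sup>2)" for x
  have C1: "Ck_on 2 UNIV (\<lambda>x. (norm (x - a))\<^sup>2 - r\<^sup>2)"
    by (intro Ck_on_diff Ck_on_norm2) auto
  show ?thesis
  proof (rule that[of u])
    show "Ck_on 2 UNIV u" unfolding u_def
      by (intro Ck_on_add Ck_on_cmult C1 k) auto
    show "laplacian u x = l" for x
    proof -
      have "laplacian u x = laplacian k x + laplacian (\<lambda>x. (l / (2 * n)) * ((norm (x - a))\<^sup>2 - r\<^sup>2)) x"
        unfolding u_def by (rule laplacian_add[OF open_UNIV UNIV_I k Ck_on_cmult[OF open_UNIV C1]])
      also have "laplacian (\<lambda>x. (l / (2 * n)) * ((norm (x - a))\<^sup>2 - r\<^sup>2)) x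
          = (l / (2 * n)) * laplacian (\<lambda>x. (norm (x - a))\<^sup>2 - r\<^sup>2) x"
        by (rule laplacian_cmult[OF open_UNIV UNIV_I C1])
      also have "laplacian (\<lambda>x. (norm (x - a))\<^sup>2 - r\<^sup>2) x = 2 * n"
        by (subst laplacian_diff[OF open_UNIV UNIV_I Ck_on_norm2 Ck_on_const])
          (simp add: laplacian_norm2 n_def)
      finally show ?thesis using n by (simp add: lk)
    qed
    show "\<bar>u x - g x\<bar> < \<eta>" if "x \<in> sphere a r" for x
    proof -
      have 1: "norm (x - a) = r" using that by (simp add: dist_norm norm_minus_commute)
      then have "x - a \<in> sphere 0 r" by simp
      from P(2)[OF this] h(3)[OF this] 1 show ?thesis
        by (simp add: u_def k_def abs_minus_commute)
    qed
  qed
qed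

subsection \<open>Convex combinations of viscosity subsolutions\<close>

lemma Ck_on_exp_inner: "Ck_on k S (\<lambda>y. exp (y \<bullet> t))"
proof -
  have "Ck_on k UNIV (\<lambda>y. exp (y \<bullet> t))"
  proof (induction k)
    case 0 then show ?case by (auto intro!: continuous_intros)
  next
    case (Suc k)
    show ?case
      by (rule Ck_on_SucI[OF open_UNIV, of _ "\<lambda>x h. exp (x \<bullet> t) * (h \<bullet> t)"])
        (auto intro!: derivative_eq_intros Ck_on_mult Suc)
  qed
  then show ?thesis using Ck_on_subset by blast
qed

lemma partial_deriv_exp_inner: "partial_deriv b (\<lambda>y. exp (y \<bullet> t)) x = exp (x \<bullet> t) * (b \<bullet> t)"
  by (rule partial_deriv_eq) (auto intro!: derivative_eq_intros)

lemma grad_exp_inner: "grad (\<lambda>y. exp (y \<bullet> t)) x = exp (x \<bullet> t) *\<^sub>R t"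
  by (rule grad_eqI) (simp add: partial_deriv_exp_inner inner_commute)

lemma laplacian_exp_inner: "laplacian (\<lambda>y. exp (y \<bullet> t)) x = exp (x \<bullet> t) * (norm t)\<^sup>2"
proof -
  have "partial_deriv b (partial_deriv b (\<lambda>y. exp (y \<bullet> t))) x = exp (x \<bullet> t) * ((b \<bullet> t) * (b \<bullet> t))" for b
  proof -
    have "partial_deriv b (\<lambda>y. exp (y \<bullet> t) * (b \<bullet> t)) x = exp (x \<bullet> t) * ((b \<bullet> t) * (b \<bullet> t))"
      by (rule partial_deriv_eq) (auto intro!: derivative_eq_intros)
    then show ?thesis by (simp add: partial_deriv_exp_inner[abs_def])
  qed
  moreover have "(norm t)\<^sup>2 = (\<Sum>b\<in>Basis. (b \<bullet> t) * (b \<bullet> t))"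
    by (subst power2_norm_eq_inner, subst euclidean_inner) (simp add: inner_commute)
  ultimately show ?thesis by (simp add: laplacian_def sum_distrib_left)
qed

lemma continuous_on_laplacian: "Ck_on 2 S f \<Longrightarrow> continuous_on S (laplacian f)"
  unfolding laplacian_def[abs_def] by (intro continuous_on_sum) (auto simp: numeral_2_eq_2)

text \<open>On a small ball \<open>v1\<close> is replaced by a smooth \<open>h\<close> with constant
  Laplacian that almost equals \<open>v1\<close> on the sphere; comparison gives
  \<open>v1 \<le> h + \<eta>\<close> at the centre. Then \<phi> minus \<open>h\<close>, with a
  quadratic correction, is a smooth supersolution for \<open>v0\<close>. Adding the two comparisons
  at the centre contradicts a failure of the inequality for \<phi>.\<close>

lemma vsub_add_Poisson:
  fixes v0 v1 :: "'a::euclidean_space \<Rightarrow> real"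
  assumes S: "open S" and v: "continuous_on S v0" "continuous_on S v1"
    and G: "continuous_on S G0" "continuous_on S G1"
    and sub: "vsub (\<lambda>x \<xi> l. - l \<le> G0 x) S v0" "vsub (\<lambda>x \<xi> l. - l \<le> G1 x) S v1"
  shows "vsub (\<lambda>x \<xi> l. - l \<le> G0 x + G1 x) S (\<lambda>x. v0 x + v1 x)"
  unfolding vsub_def
proof (intro ballI allI impI)
  fix x \<phi> assume x: "x \<in> S" and t: "touches_above \<phi> (\<lambda>x. v0 x + v1 x) x"
  show "- laplacian \<phi> x \<le> G0 x + G1 x"
  proof (rule ccontr)
    assume neg: "\<not> ?thesis"
    \<comment> \<open>Of the four parts of the gap, three pay for freezing \<open>G0\<close>,
      \<open>G1\<close> and the Laplacian of \<phi> at \<open>x\<close>; the fourth is the Laplacian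
      of the quadratic in \<psi>.\<close>
    define \<delta> where "\<delta> = (- laplacian \<phi> x - G0 x - G1 x) / 4"
    have \<delta>: "\<delta> > 0" using neg by (simp add: \<delta>_def)
    define n where "n = real DIM('a)"
    have n: "n > 0" by (simp add: n_def)
    obtain r0 where r0: "r0 > 0" "ball x r0 \<subseteq> S" "Ck_on 2 (ball x r0) \<phi>"
      "\<And>y. y \<in> ball x r0 \<Longrightarrow> (v0 y + v1 y) - \<phi> y \<le> (v0 x + v1 x) - \<phi> x"
      using touches_aboveE[OF t S x] by metis
    have ev: "\<exists>d>0. \<forall>y\<in>ball x d. \<bar>F y - F x\<bar> < \<delta>" if F: "continuous_on (ball x r0) F" for F :: "'a \<Rightarrow> real"
    proof -
      have "isCont F x" using F r0(1) by (simp add: continuous_on_eq_continuous_at)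
      then show ?thesis using \<delta> unfolding continuous_at_eps_delta
        by (metis mem_ball dist_real_def dist_commute)
    qed
    obtain d0 where d0: "d0 > 0" "\<And>y. y \<in> ball x d0 \<Longrightarrow> \<bar>G0 y - G0 x\<bar> < \<delta>"
      using ev[of G0] continuous_on_subset[OF G(1) r0(2)] by blast
    obtain d1 where d1: "d1 > 0" "\<And>y. y \<in> ball x d1 \<Longrightarrow> \<bar>G1 y - G1 x\<bar> < \<delta>"
      using ev[of G1] continuous_on_subset[OF G(2) r0(2)] by blast
    obtain d2 where d2: "d2 > 0" "\<And>y. y \<in> ball x d2 \<Longrightarrow> \<bar>laplacian \<phi> y - laplacian \<phi> x\<bar> < \<delta>"
      using ev[OF continuous_on_laplacian[OF r0(3)]] by blast
    define r where "r = min r0 (min d0 (min d1 d2)) / 2"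
    have r: "r > 0" "r < r0" "r < d0" "r < d1" "r < d2"
      using r0(1) d0(1) d1(1) d2(1) by (auto simp: r_def)
    have cb: "cball x r \<subseteq> ball x r0" using r by auto
    have cbS: "cball x r \<subseteq> S" using cb r0(2) by blast
    have bS: "ball x r \<subseteq> S" "ball x r \<subseteq> ball x r0" using cbS cb by auto
    define k0 where "k0 = G0 x + \<delta>"
    define k1 where "k1 = G1 x + \<delta>"
    have est: "G0 y \<le> k0" "G1 y \<le> k1" "k0 + k1 + \<delta> \<le> - laplacian \<phi> y" if "y \<in> ball x r" for y
    proof -
      have *: "y \<in> ball x d0" "y \<in> ball x d1" "y \<in> ball x d2" using that r by auto
      have D: "- laplacian \<phi> x = G0 x + G1 x + 4 * \<delta>" by (simp add: \<delta>_def field_simps)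
      show "G0 y \<le> k0" "G1 y \<le> k1" using d0(2)[OF *(1)] d1(2)[OF *(2)] by (auto simp: k0_def k1_def)
      show "k0 + k1 + \<delta> \<le> - laplacian \<phi> y" using d2(2)[OF *(3)] D by (auto simp: k0_def k1_def)
    qed
    have s0: "vsub (\<lambda>x \<xi> l. - l \<le> k0) (ball x r) v0"
      by (rule vsub_mono[OF vsub_subset[OF sub(1) bS(1)]]) (use est(1) in force)
    have s1: "vsub (\<lambda>x \<xi> l. - l \<le> k1) (ball x r) v1"
      by (rule vsub_mono[OF vsub_subset[OF sub(2) bS(1)]]) (use est(2) in force)
    have cv: "continuous_on (cball x r) v0" "continuous_on (cball x r) v1"
      using v cbS continuous_on_subset by blast+
    \<comment> \<open>The quadratic in \<psi> is lower at the centre than on the sphere by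
      \<open>\<delta> / (2 * n) * r\<^sup>2\<close>, that is by \<open>4 * \<eta>\<close>, while the
      approximation of \<open>v1\<close> is paid for twice.\<close>
    define \<eta> where "\<eta> = \<delta> * r\<^sup>2 / (8 * n)"
    have \<eta>: "\<eta> > 0" using \<delta> r n by (simp add: \<eta>_def)
    have "continuous_on (sphere x r) v1" using cv(2) sphere_cball continuous_on_subset by blast
    then obtain h where h: "Ck_on 2 UNIV h" "\<And>y. laplacian h y = - k1" "\<And>y. y \<in> sphere x r \<Longrightarrow> \<bar>h y - v1 y\<bar> < \<eta>"
      using Poisson_sphere_approx[OF _ \<eta>, of x r v1 "- k1"] by metis
    note hb = Ck_on_subset[OF h(1) subset_UNIV]
    have ch: "continuous_on A h" for A
      using Ck_on_imp_continuous_on[OF open_UNIV h(1)] continuous_on_subset by blast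
    have xr: "x \<in> ball x r" using r by simp
    have A: "v1 x \<le> h x + \<eta>"
    proof (rule vsub_comparison[OF r(1) cv(2) s1 _ _ _ _ xr])
      show "continuous_on (cball x r) (\<lambda>y. h y + \<eta>)" by (intro continuous_intros ch)
      show "Ck_on 2 (ball x r) (\<lambda>y. h y + \<eta>)" by (intro Ck_on_add hb) auto
      show "k1 \<le> - laplacian (\<lambda>y. h y + \<eta>) y" for y
        by (subst laplacian_add[OF open_UNIV UNIV_I h(1) Ck_on_const]) (simp add: h(2))
      show "v1 y \<le> h y + \<eta>" if "y \<in> sphere x r" for y using h(3)[OF that] by auto
    qed
    define D where "D = v0 x + v1 x - \<phi> x"
    \<comment> \<open>The constant that makes \<open>\<psi> = \<phi> - h + D + \<eta>\<close> on the
      sphere, the smallest margin that dominates \<open>v0\<close> there.\<close>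
    define C where "C = D + \<eta> - \<delta> / (2 * n) * r\<^sup>2"
    define \<psi> where "\<psi> y = ((\<phi> y - h y) + (\<delta> / (2 * n)) * (norm (y - x))\<^sup>2) + C" for y
    have C\<phi>: "Ck_on 2 (ball x r) \<phi>" by (rule Ck_on_subset[OF r0(3) bS(2)])
    have C\<phi>h: "Ck_on 2 (ball x r) (\<lambda>y. \<phi> y - h y)" by (rule Ck_on_diff[OF open_ball C\<phi> hb])
    have CN: "Ck_on 2 (ball x r) (\<lambda>y. (\<delta> / (2 * n)) * (norm (y - x))\<^sup>2)"
      by (rule Ck_on_cmult[OF open_ball Ck_on_norm2])
    have c\<phi>: "continuous_on (cball x r) \<phi>"
      using Ck_on_imp_continuous_on[OF _ r0(3)] continuous_on_subset[OF _ cb] by blast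
    have B: "v0 x \<le> \<psi> x"
    proof (rule vsub_comparison[OF r(1) cv(1) s0 _ _ _ _ xr])
      show "continuous_on (cball x r) \<psi>" unfolding \<psi>_def by (intro continuous_intros ch c\<phi>)
      show "Ck_on 2 (ball x r) \<psi>" unfolding \<psi>_def
        by (intro Ck_on_add C\<phi>h CN) auto
      show "k0 \<le> - laplacian \<psi> y" if y: "y \<in> ball x r" for y
      proof -
        have "laplacian \<psi> y = laplacian (\<lambda>y. (\<phi> y - h y) + (\<delta> / (2 * n)) * (norm (y - x))\<^sup>2) y + 0"
          unfolding \<psi>_def
          by (subst laplacian_add[OF open_ball y Ck_on_add[OF open_ball C\<phi>h CN] Ck_on_const]) simp
        also have "\<dots> = (laplacian \<phi> y - laplacian h y) + (\<delta> / (2 * n)) * (2 * n)"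
          by (subst laplacian_add[OF open_ball y C\<phi>h CN], subst laplacian_diff[OF open_ball y C\<phi> hb],
              subst laplacian_cmult[OF open_ball y Ck_on_norm2]) (simp add: laplacian_norm2 n_def)
        also have "\<dots> = laplacian \<phi> y + k1 + \<delta>" using n by (simp add: h(2))
        finally show ?thesis using est(3)[OF y] by simp
      qed
      show "v0 y \<le> \<psi> y" if y: "y \<in> sphere x r" for y
      proof -
        have nr: "norm (y - x) = r" using y by (simp add: dist_norm norm_minus_commute)
        have "y \<in> ball x r0" using y cb by auto
        then have "v0 y + v1 y - \<phi> y \<le> D" using r0(4) by (simp add: D_def)
        then show ?thesis using h(3)[OF y] by (simp add: \<psi>_def C_def nr)
      qed
    qed
    have "v0 x + v1 x \<le> \<phi> x + D + 2 * \<eta> - \<delta> / (2 * n) * r\<^sup>2"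
      using A B by (simp add: \<psi>_def C_def)
    also have "\<dots> = v0 x + v1 x - 2 * \<eta>" using n by (simp add: D_def \<eta>_def field_simps)
    finally show False using \<eta> by simp
  qed
qed

text \<open>The product rule for an exponential weight, carried out on test functions:
  \<open>P\<close> is evaluated at the gradient and Laplacian that
  \<open>exp (- (x \<bullet> t)) * u x\<close> would have.\<close>

lemma vsub_exp_mult:
  fixes v :: "'a::euclidean_space \<Rightarrow> real"
  assumes S: "open S" and sub: "vsub P S v" and u: "\<And>x. x \<in> S \<Longrightarrow> u x = exp (x \<bullet> t) * v x"
  shows "vsub (\<lambda>x \<xi> l. P x (exp (- (x \<bullet> t)) *\<^sub>R (\<xi> - u x *\<^sub>R t))
           (exp (- (x \<bullet> t)) * (l - 2 * (t \<bullet> \<xi>) + (norm t)\<^sup>2 * u x))) S u"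
  unfolding vsub_def
proof (intro ballI allI impI)
  fix x \<phi> assume x: "x \<in> S" and t: "touches_above \<phi> u x"
  obtain r where r: "r > 0" "ball x r \<subseteq> S" "Ck_on 2 (ball x r) \<phi>" "\<And>y. y \<in> ball x r \<Longrightarrow> u y - \<phi> y \<le> u x - \<phi> x"
    using touches_aboveE[OF t S x] by metis
  \<comment> \<open>With this shift the test function meets \<open>u\<close> with value zero, so
    that multiplying by the positive, nonconstant weight preserves the touching.\<close>
  define D where "D = u x - \<phi> x"
  define E where "E y = exp (y \<bullet> (- t))" for y :: 'a
  define \<psi> where "\<psi> y = E y * (\<phi> y + D)" for y
  have xb: "x \<in> ball x r" using r by simp
  have CE: "Ck_on 2 (ball x r) E" unfolding E_def by (rule Ck_on_exp_inner)
  have C1: "Ck_on 2 (ball x r) (\<lambda>y. \<phi> y + D)" by (intro Ck_on_add r) auto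
  have C\<psi>: "Ck_on 2 (ball x r) \<psi>" unfolding \<psi>_def by (intro Ck_on_mult CE C1) auto
  have vE: "v y = E y * u y" if "y \<in> S" for y
    using u[OF that] by (simp add: E_def exp_minus field_simps)
  have "touches_above \<psi> v x"
  proof (rule touches_aboveI[OF open_ball xb C\<psi>])
    fix y assume y: "y \<in> ball x r"
    have "E y * (u y - \<phi> y - D) \<le> 0"
      using r(4)[OF y] by (intro mult_nonneg_nonpos) (auto simp: E_def D_def)
    then have "v y - \<psi> y \<le> 0" using vE y r(2) by (auto simp: \<psi>_def algebra_simps)
    also have "0 = v x - \<psi> x" using vE[OF x] by (simp add: \<psi>_def D_def)
    finally show "v y - \<psi> y \<le> v x - \<psi> x" .
  qed
  from vsubD[OF sub x this] have "P x (grad \<psi> x) (laplacian \<psi> x)" .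
  moreover have d: "E differentiable (at x)" "(\<lambda>y. \<phi> y + D) differentiable (at x)" "\<phi> differentiable (at x)"
    using Ck_on_imp_differentiable[OF CE _ xb] Ck_on_imp_differentiable[OF C1 _ xb]
      Ck_on_imp_differentiable[OF r(3) _ xb] by auto
  have Ex: "E x = exp (- (x \<bullet> t))" by (simp add: E_def)
  have gE: "grad E x = - (E x *\<^sub>R t)" "laplacian E x = E x * (norm t)\<^sup>2"
    unfolding E_def by (simp_all only: grad_exp_inner laplacian_exp_inner) simp_all
  have g1: "grad (\<lambda>y. \<phi> y + D) x = grad \<phi> x" "laplacian (\<lambda>y. \<phi> y + D) x = laplacian \<phi> x"
    using grad_add[OF d(3), of "\<lambda>_. D"] laplacian_add[OF open_ball xb r(3) Ck_on_const, of D] by simp_all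
  have "grad \<psi> x = exp (- (x \<bullet> t)) *\<^sub>R (grad \<phi> x - u x *\<^sub>R t)"
    unfolding \<psi>_def
    by (subst grad_mult[OF d(1,2)]) (simp only: gE g1, simp add: D_def Ex algebra_simps)
  moreover have "laplacian \<psi> x = exp (- (x \<bullet> t)) * (laplacian \<phi> x - 2 * (t \<bullet> grad \<phi> x) + (norm t)\<^sup>2 * u x)"
    unfolding \<psi>_def
    by (subst laplacian_mult[OF open_ball xb CE C1]) (simp only: gE g1, simp add: D_def Ex algebra_simps)
  ultimately show "P x (exp (- (x \<bullet> t)) *\<^sub>R (grad \<phi> x - u x *\<^sub>R t))
           (exp (- (x \<bullet> t)) * (laplacian \<phi> x - 2 * (t \<bullet> grad \<phi> x) + (norm t)\<^sup>2 * u x))" by simp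
qed

text \<open>With the weight \<open>E x = exp (x \<bullet> - s)\<close> the drift operator applied to
  \<open>v\<close>, times \<open>E\<close>, equals \<open>- laplacian\<close> of
  \<open>E * v\<close> plus \<open>(norm s)\<^sup>2 * (E * v)\<close>. The last term is moved to the
  right-hand side as known continuous data; being linear in \<open>v\<close>, it reappears correctly
  for the sum when the weight is undone.\<close>

lemma vsub_add_drift:
  fixes v0 v1 :: "'a::euclidean_space \<Rightarrow> real"
  assumes S: "open S" and v: "continuous_on S v0" "continuous_on S v1"
    and G: "continuous_on S G0" "continuous_on S G1"
    and sub: "vsub (\<lambda>x \<xi> l. - l + 2 * (s \<bullet> \<xi>) \<le> G0 x) S v0" "vsub (\<lambda>x \<xi> l. - l + 2 * (s \<bullet> \<xi>) \<le> G1 x) S v1"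
  shows "vsub (\<lambda>x \<xi> l. - l + 2 * (s \<bullet> \<xi>) \<le> G0 x + G1 x) S (\<lambda>x. v0 x + v1 x)"
proof -
  define E where "E x = exp (x \<bullet> - s)" for x :: 'a
  have cE: "continuous_on S E" unfolding E_def by (intro continuous_intros)
  have z: "vsub (\<lambda>x \<xi> l. - l \<le> E x * G x - (norm s)\<^sup>2 * (E x * v x)) S (\<lambda>x. E x * v x)"
    if sub: "vsub (\<lambda>x \<xi> l. - l + 2 * (s \<bullet> \<xi>) \<le> G x) S v" for v G
  proof (rule vsub_mono[OF vsub_exp_mult[OF S sub, of "\<lambda>x. E x * v x" "- s"]])
    fix x \<xi> l
    let ?u = "E x * v x"
    assume *: "- (exp (- (x \<bullet> - s)) * (l - 2 * (- s \<bullet> \<xi>) + (norm (- s))\<^sup>2 * ?u)) +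
            2 * (s \<bullet> exp (- (x \<bullet> - s)) *\<^sub>R (\<xi> - ?u *\<^sub>R - s)) \<le> G x"
    have "- (exp (- (x \<bullet> - s)) * (l - 2 * (- s \<bullet> \<xi>) + (norm (- s))\<^sup>2 * ?u)) +
            2 * (s \<bullet> exp (- (x \<bullet> - s)) *\<^sub>R (\<xi> - ?u *\<^sub>R - s))
       = exp (x \<bullet> s) * (- l + (norm s)\<^sup>2 * ?u)"
      by (simp add: power2_norm_eq_inner algebra_simps)
    with * have "exp (x \<bullet> s) * (- l + (norm s)\<^sup>2 * ?u) \<le> G x" by simp
    then have "E x * (exp (x \<bullet> s) * (- l + (norm s)\<^sup>2 * ?u)) \<le> E x * G x"
      by (intro mult_left_mono) (simp_all add: E_def)
    moreover have "E x * exp (x \<bullet> s) = 1" by (simp add: E_def exp_minus)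
    ultimately show "- l \<le> E x * G x - (norm s)\<^sup>2 * ?u" by (simp flip: mult.assoc)
  qed (simp add: E_def)
  have sum: "vsub (\<lambda>x \<xi> l. - l \<le> (E x * G0 x - (norm s)\<^sup>2 * (E x * v0 x)) + (E x * G1 x - (norm s)\<^sup>2 * (E x * v1 x)))
     S (\<lambda>x. E x * v0 x + E x * v1 x)"
    by (rule vsub_add_Poisson[OF S _ _ _ _ z[OF sub(1)] z[OF sub(2)]])
      (intro continuous_intros cE v G)+
  have u: "v0 x + v1 x = exp (x \<bullet> s) * (E x * v0 x + E x * v1 x)" for x
    by (simp add: E_def exp_minus field_simps)
  show ?thesis
  proof (rule vsub_mono[OF vsub_exp_mult[OF S sum, of "\<lambda>x. v0 x + v1 x" s]])
    fix x \<xi> l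
    let ?u = "v0 x + v1 x"
    assume "- (exp (- (x \<bullet> s)) * (l - 2 * (s \<bullet> \<xi>) + (norm s)\<^sup>2 * ?u)) \<le>
            (E x * G0 x - (norm s)\<^sup>2 * (E x * v0 x)) + (E x * G1 x - (norm s)\<^sup>2 * (E x * v1 x))"
    then have "E x * (- l + 2 * (s \<bullet> \<xi>)) \<le> E x * (G0 x + G1 x)"
      by (simp add: E_def algebra_simps)
    then show "- l + 2 * (s \<bullet> \<xi>) \<le> G0 x + G1 x" by (simp add: E_def)
  qed (use u in auto)
qed

lemma vsub_cmult:
  fixes v :: "'a::euclidean_space \<Rightarrow> real"
  assumes S: "open S" and sub: "vsub P S v" and c: "c > 0"
  shows "vsub (\<lambda>x \<xi> l. P x (\<xi> /\<^sub>R c) (l / c)) S (\<lambda>x. c * v x)"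
  unfolding vsub_def
proof (intro ballI allI impI)
  fix x \<phi> assume x: "x \<in> S" and t: "touches_above \<phi> (\<lambda>x. c * v x) x"
  obtain r where r: "r > 0" "ball x r \<subseteq> S" "Ck_on 2 (ball x r) \<phi>" "\<And>y. y \<in> ball x r \<Longrightarrow> c * v y - \<phi> y \<le> c * v x - \<phi> x"
    using touches_aboveE[OF t S x] by metis
  have xb: "x \<in> ball x r" using r by simp
  have "touches_above (\<lambda>y. (1 / c) * \<phi> y) v x"
  proof (rule touches_aboveI[OF open_ball xb])
    show "Ck_on 2 (ball x r) (\<lambda>y. (1 / c) * \<phi> y)" by (rule Ck_on_cmult[OF open_ball r(3)])
    fix y assume "y \<in> ball x r"
    from r(4)[OF this] have "(c * v y - \<phi> y) / c \<le> (c * v x - \<phi> x) / c"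
      using c by (intro divide_right_mono) auto
    then show "v y - (1 / c) * \<phi> y \<le> v x - (1 / c) * \<phi> x" using c by (simp add: diff_divide_distrib)
  qed
  from vsubD[OF sub x this]
  show "P x (grad \<phi> x /\<^sub>R c) (laplacian \<phi> x / c)"
    using grad_cmult[OF Ck_on_imp_differentiable[OF r(3) _ xb], of "1 / c"]
      laplacian_cmult[OF open_ball xb r(3), of "1 / c"] by (simp add: divide_inverse mult.commute)
qed

text \<open>The tangent plane inequality of \<open>X powr p * Y powr (2 - p)\<close> at the point
  (1, 1). It is weighted arithmetic-geometric mean for \<open>A\<close>, \<open>Y / X\<close> and
  \<open>1 / X\<close> with weights 1, \<open>p - 2\<close> and 1: their weighted product is 1 and
  the weights add up to \<open>p\<close>.\<close>

lemma perspective_power_ineq: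
  fixes X Y p :: real
  assumes "X > 0" "Y > 0" "p > 2"
  shows "p * X \<le> X powr p * Y powr (2 - p) + (p - 2) * Y + 1"
proof -
  define A where "A = X powr (p - 1) * Y powr (2 - p)"
  have A: "A > 0" using assms by (simp add: A_def)
  have ge: "1 + ln z \<le> z" if "z > 0" for z :: real using ln_le_minus_one[OF that] by simp
  have lnA: "ln A = (p - 1) * ln X + (2 - p) * ln Y"
    using assms by (simp add: A_def ln_mult ln_powr)
  have "(p - 2) * (1 + ln (Y / X)) \<le> (p - 2) * (Y / X)"
    using assms by (intro mult_left_mono ge) auto
  moreover have "1 + ln A \<le> A" "1 + ln (1 / X) \<le> 1 / X" using assms A by (auto intro!: ge)
  ultimately have "(1 + ln A) + (p - 2) * (1 + ln (Y / X)) + (1 + ln (1 / X)) \<le> A + (p - 2) * (Y / X) + 1 / X"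
    by linarith
  moreover have "(1 + ln A) + (p - 2) * (1 + ln (Y / X)) + (1 + ln (1 / X)) = p"
    using assms by (simp add: lnA ln_div algebra_simps)
  ultimately have "p * X \<le> (A + (p - 2) * (Y / X) + 1 / X) * X" using assms by simp
  also have "\<dots> = A * X + (p - 2) * Y + 1" using assms by (simp add: field_simps)
  also have "A * X = X powr p * Y powr (2 - p)"
    using assms powr_mult_base[of X "p - 1"] by (simp add: A_def algebra_simps)
  finally show ?thesis .
qed

text \<open>Cauchy-Schwarz reduces the claim to norms, and scaling by the norm of \<xi> and by \<mu>
  reduces it to the tangent plane at (1, 1).\<close>

lemma perspective_power_subgradient:
  fixes \<xi> :: "'a::real_inner"
  assumes "\<mu> > 0" "p > 2"
  obtains b \<beta> \<gamma> where "\<mu> powr (2 - p) * norm \<xi> powr p = b \<bullet> \<xi> + \<beta> * \<mu> + \<gamma>"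
    "\<And>\<nu> \<zeta>. \<nu> > 0 \<Longrightarrow> b \<bullet> \<zeta> + \<beta> * \<nu> + \<gamma> \<le> \<nu> powr (2 - p) * norm \<zeta> powr p"
proof (cases "\<xi> = 0")
  case True
  then show ?thesis using that[of 0 0 0] assms by simp
next
  case False
  define a where "a = norm \<xi>"
  have a: "a > 0" using False by (simp add: a_def)
  define F where "F = \<mu> powr (2 - p) * a powr p"
  have F: "F > 0" using a assms by (simp add: F_def)
  show ?thesis
  \<comment> \<open>The coefficients are the partial derivatives at \<mu> and \<xi>. By Euler's
    identity for degree 2 the linear part equals \<open>2 * F\<close> there, which forces the
    constant \<open>- F\<close>.\<close>
  proof (rule that[of "(p * F / a\<^sup>2) *\<^sub>R \<xi>" "- (p - 2) * F / \<mu>" "- F"])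
    have "\<xi> \<bullet> \<xi> = a\<^sup>2" by (simp add: a_def power2_norm_eq_inner)
    then show "\<mu> powr (2 - p) * norm \<xi> powr p = (p * F / a\<^sup>2) *\<^sub>R \<xi> \<bullet> \<xi> + - (p - 2) * F / \<mu> * \<mu> + - F"
      using a assms by (simp add: F_def[symmetric] flip: a_def) (simp add: algebra_simps)
    fix \<nu> :: real and \<zeta> :: 'a assume \<nu>: "\<nu> > 0"
    show "(p * F / a\<^sup>2) *\<^sub>R \<xi> \<bullet> \<zeta> + - (p - 2) * F / \<mu> * \<nu> + - F \<le> \<nu> powr (2 - p) * norm \<zeta> powr p"
    proof -
      define X where "X = norm \<zeta> / a"
      define Y where "Y = \<nu> / \<mu>"
      have Y: "Y > 0" using \<nu> assms by (simp add: Y_def)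
      have "\<xi> \<bullet> \<zeta> \<le> a * norm \<zeta>" unfolding a_def by (rule norm_cauchy_schwarz)
      then have "(p * F / a\<^sup>2) * (\<xi> \<bullet> \<zeta>) \<le> (p * F / a\<^sup>2) * (a * norm \<zeta>)"
        using F assms by (intro mult_left_mono) auto
      also have "\<dots> = F * (p * X)" using a by (simp add: X_def power2_eq_square)
      finally have "(p * F / a\<^sup>2) *\<^sub>R \<xi> \<bullet> \<zeta> + - (p - 2) * F / \<mu> * \<nu> + - F \<le> F * (p * X - (p - 2) * Y - 1)"
        by (simp add: Y_def algebra_simps add_divide_distrib diff_divide_distrib)
      also have "\<dots> \<le> F * (X powr p * Y powr (2 - p))"
      proof (rule mult_left_mono)
        show "p * X - (p - 2) * Y - 1 \<le> X powr p * Y powr (2 - p)"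
        proof (cases "X = 0")
          case True
          have "0 \<le> (p - 2) * Y" using Y assms by (intro mult_nonneg_nonneg) auto
          then show ?thesis using True by simp
        next
          case False
          then have "X > 0" using a by (auto simp: X_def)
          from perspective_power_ineq[OF this Y assms(2)] show ?thesis by simp
        qed
      qed (use F in auto)
      also have "\<dots> = \<nu> powr (2 - p) * norm \<zeta> powr p"
        using a \<nu> assms by (simp add: F_def X_def Y_def powr_divide)
      finally show ?thesis .
    qed
  qed
qed

text \<open>One affine minorant, supporting the gradient term at \<mu> and at the gradient of the
  given test function, serves both summands throughout \<open>S\<close>. The inequalities become
  linear with a common drift, can be added, and equality at the contact point restores the nonlinear
  term.\<close>

lemma vsub_convex_combination:
  fixes v0 v1 :: "'a::euclidean_space \<Rightarrow> real"
  assumes S: "open S" and v: "continuous_on S v0" "continuous_on S v1"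
    and G: "continuous_on S g0" "continuous_on S g1"
    and pos: "\<mu>0 > 0" "\<mu>1 > 0" "0 < \<theta>" "\<theta> < 1" "p > 2" "\<epsilon> > 0"
    and \<mu>: "\<mu> = (1 - \<theta>) * \<mu>0 + \<theta> * \<mu>1"
    and sub: "vsub (\<lambda>x \<xi> l. \<mu>0 powr (2 - p) * norm \<xi> powr p - \<epsilon> * l \<le> g0 x) S v0"
      "vsub (\<lambda>x \<xi> l. \<mu>1 powr (2 - p) * norm \<xi> powr p - \<epsilon> * l \<le> g1 x) S v1"
  shows "vsub (\<lambda>x \<xi> l. \<mu> powr (2 - p) * norm \<xi> powr p - \<epsilon> * l \<le> (1 - \<theta>) * g0 x + \<theta> * g1 x) S
           (\<lambda>x. (1 - \<theta>) * v0 x + \<theta> * v1 x)"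
  unfolding vsub_def
proof (intro ballI allI impI)
  fix x \<phi> assume x: "x \<in> S" and t: "touches_above \<phi> (\<lambda>x. (1 - \<theta>) * v0 x + \<theta> * v1 x) x"
  define \<xi> where "\<xi> = grad \<phi> x"
  have "\<mu> > 0" unfolding \<mu> using pos by (intro add_pos_pos mult_pos_pos) auto
  then obtain b \<beta> \<gamma> where b: "\<mu> powr (2 - p) * norm \<xi> powr p = b \<bullet> \<xi> + \<beta> * \<mu> + \<gamma>"
    "\<And>\<nu> \<zeta>. \<nu> > 0 \<Longrightarrow> b \<bullet> \<zeta> + \<beta> * \<nu> + \<gamma> \<le> \<nu> powr (2 - p) * norm \<zeta> powr p"
    using perspective_power_subgradient[of \<mu> p \<xi>] pos by metis
  \<comment> \<open>Dividing by \<epsilon> normalises the Laplacian; the factor 2 matches the form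
    of the drift in \<open>vsub_add_drift\<close>.\<close>
  define s where "s = b /\<^sub>R (2 * \<epsilon>)"
  have bs: "b = (2 * \<epsilon>) *\<^sub>R s" using pos by (simp add: s_def)
  have lin: "vsub (\<lambda>x \<xi> l. - l + 2 * (s \<bullet> \<xi>) \<le> (c / \<epsilon>) * (g x - \<beta> * \<nu> - \<gamma>)) S (\<lambda>x. c * v x)"
    if sub: "vsub (\<lambda>x \<xi> l. \<nu> powr (2 - p) * norm \<xi> powr p - \<epsilon> * l \<le> g x) S v" and "\<nu> > 0" "c > 0" for \<nu> g v c
  proof (rule vsub_mono[OF vsub_cmult[OF S sub \<open>c > 0\<close>]])
    fix x \<zeta> :: 'a and l assume *: "\<nu> powr (2 - p) * norm (\<zeta> /\<^sub>R c) powr p - \<epsilon> * (l / c) \<le> g x"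
    have "b \<bullet> (\<zeta> /\<^sub>R c) + \<beta> * \<nu> + \<gamma> - \<epsilon> * (l / c) \<le> g x" using b(2)[OF \<open>\<nu> > 0\<close>, of "\<zeta> /\<^sub>R c"] * by linarith
    then have "(c / \<epsilon>) * (b \<bullet> (\<zeta> /\<^sub>R c) - \<epsilon> * (l / c)) \<le> (c / \<epsilon>) * (g x - \<beta> * \<nu> - \<gamma>)"
      using \<open>c > 0\<close> pos by (intro mult_left_mono) auto
    moreover have "(c / \<epsilon>) * (b \<bullet> (\<zeta> /\<^sub>R c) - \<epsilon> * (l / c)) = - l + 2 * (s \<bullet> \<zeta>)"
      using \<open>c > 0\<close> pos by (simp add: bs field_simps)
    ultimately show "- l + 2 * (s \<bullet> \<zeta>) \<le> (c / \<epsilon>) * (g x - \<beta> * \<nu> - \<gamma>)" by simp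
  qed
  have "vsub (\<lambda>x \<xi> l. - l + 2 * (s \<bullet> \<xi>) \<le> ((1 - \<theta>) / \<epsilon>) * (g0 x - \<beta> * \<mu>0 - \<gamma>) + (\<theta> / \<epsilon>) * (g1 x - \<beta> * \<mu>1 - \<gamma>)) S
     (\<lambda>x. (1 - \<theta>) * v0 x + \<theta> * v1 x)"
    by (rule vsub_add_drift[OF S _ _ _ _ lin[OF sub(1) pos(1)] lin[OF sub(2) pos(2,3)]])
      (use pos in \<open>(intro continuous_intros v G | simp)+\<close>)
  from vsubD[OF this x t]
  have "\<epsilon> * (- laplacian \<phi> x + 2 * (s \<bullet> \<xi>)) \<le> \<epsilon> * (((1 - \<theta>) / \<epsilon>) * (g0 x - \<beta> * \<mu>0 - \<gamma>) + (\<theta> / \<epsilon>) * (g1 x - \<beta> * \<mu>1 - \<gamma>))"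
    unfolding \<xi>_def using pos by (intro mult_left_mono) auto
  \<comment> \<open>Here the affine dependence on \<mu> matters: the two values at
    \<open>\<mu>0\<close> and \<open>\<mu>1\<close> average exactly to the value at \<mu>.\<close>
  also have "\<dots> = (1 - \<theta>) * g0 x + \<theta> * g1 x - \<beta> * \<mu> - \<gamma>"
    using pos by (simp add: \<mu> field_simps)
  finally have "b \<bullet> \<xi> + \<beta> * \<mu> + \<gamma> - \<epsilon> * laplacian \<phi> x \<le> (1 - \<theta>) * g0 x + \<theta> * g1 x"
    by (simp add: bs algebra_simps)
  then show "\<mu> powr (2 - p) * norm (grad \<phi> x) powr p - \<epsilon> * laplacian \<phi> x \<le> (1 - \<theta>) * g0 x + \<theta> * g1 x"
    using b(1) by (simp add: \<xi>_def)
qed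

subsection \<open>Interior modulus of continuity of subsolutions\<close>

abbreviation growth_ineq :: "real \<Rightarrow> real \<Rightarrow> real \<Rightarrow> 'a::euclidean_space \<Rightarrow> 'a \<Rightarrow> real \<Rightarrow> bool" where
  "growth_ineq p \<epsilon> K \<equiv> (\<lambda>x \<xi> l. norm \<xi> powr p - \<epsilon> * l \<le> K)"

abbreviation HJ_ineq :: "real \<Rightarrow> real \<Rightarrow> ('a::euclidean_space \<Rightarrow> real) \<Rightarrow> real \<Rightarrow> 'a \<Rightarrow> 'a \<Rightarrow> real \<Rightarrow> bool" where
  "HJ_ineq p \<epsilon> f c \<equiv> (\<lambda>x \<xi> l. norm \<xi> powr p - f x - \<epsilon> * l \<le> c)"

text \<open>Half of the exponent \<open>(p - 2) / (p - 1)\<close>, since the barrier takes the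
  squared distance. It is the exponent for which the \<open>p\<close>-th power of the gradient of a
  radial power and its Laplacian have the same order at the centre; \<open>p > 2\<close> makes it
  positive.\<close>

definition barrier_exp :: "real \<Rightarrow> real" where "barrier_exp p = (p - 2) / (2 * (p - 1))"

text \<open>As a function of the squared distance it composes with a smooth function of the point.
  The power is the modulus of continuity near the centre; the logarithm blows up as the squared
  distance tends to \<open>R\<^sup>2\<close>.\<close>

definition barrier :: "real \<Rightarrow> real \<Rightarrow> real \<Rightarrow> real" where
  "barrier p R \<rho> = \<rho> powr barrier_exp p - ln (1 - \<rho> / R\<^sup>2)"

definition barrier' :: "real \<Rightarrow> real \<Rightarrow> real \<Rightarrow> real" where
  "barrier' p R \<rho> = barrier_exp p * \<rho> powr (barrier_exp p - 1) + 1 / (R\<^sup>2 - \<rho>)"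

definition barrier'' :: "real \<Rightarrow> real \<Rightarrow> real \<Rightarrow> real" where
  "barrier'' p R \<rho> = barrier_exp p * (barrier_exp p - 1) * \<rho> powr (barrier_exp p - 2) + 1 / (R\<^sup>2 - \<rho>)\<^sup>2"

lemma barrier_exp_bounds: "p > 2 \<Longrightarrow> 0 < barrier_exp p \<and> barrier_exp p < 1 / 2"
  by (simp add: barrier_exp_def field_simps)

lemma barrier_deriv:
  assumes "p > 2" "0 < \<rho>" "\<rho> < R\<^sup>2"
  shows "(barrier p R has_real_derivative barrier' p R \<rho>) (at \<rho>)"
    "(barrier' p R has_real_derivative barrier'' p R \<rho>) (at \<rho>)"
proof -
  have R: "R\<^sup>2 > 0" "R \<noteq> 0" using assms by auto
  have 1: "1 - \<rho> / R\<^sup>2 > 0" using assms R by (simp add: field_simps)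
  have 2: "R\<^sup>2 * (1 - \<rho> / R\<^sup>2) = R\<^sup>2 - \<rho>" using R by (simp add: field_simps)
  have "((\<lambda>\<rho>. ln (1 - \<rho> / R\<^sup>2)) has_real_derivative (1 / (1 - \<rho> / R\<^sup>2)) * (- (1 / R\<^sup>2))) (at \<rho>)"
  proof -
    have "((\<lambda>\<rho>. ln (1 - \<rho> * k)) has_real_derivative (1 / (1 - \<rho> * k)) * (- k)) (at \<rho>)"
      if "1 - \<rho> * k > 0" for k
      using that by (auto intro!: derivative_eq_intros)
    from this[of "1 / R\<^sup>2"] 1 show ?thesis by simp
  qed
  moreover have "(1 / (1 - \<rho> / R\<^sup>2)) * (- (1 / R\<^sup>2)) = - (1 / (R\<^sup>2 - \<rho>))"
    using 2 by (simp add: mult.commute)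
  ultimately have L: "((\<lambda>\<rho>. ln (1 - \<rho> / R\<^sup>2)) has_real_derivative - (1 / (R\<^sup>2 - \<rho>))) (at \<rho>)" by simp
  have "((\<lambda>\<rho>. \<rho> powr barrier_exp p - ln (1 - \<rho> / R\<^sup>2)) has_real_derivative
      (barrier_exp p * \<rho> powr (barrier_exp p - 1)) - - (1 / (R\<^sup>2 - \<rho>))) (at \<rho>)"
    by (rule DERIV_diff[OF has_real_derivative_powr[OF assms(2)] L])
  then show "(barrier p R has_real_derivative barrier' p R \<rho>) (at \<rho>)"
    by (simp add: barrier_def[abs_def] barrier'_def)
  have P: "((\<lambda>\<rho>. \<rho> powr (barrier_exp p - 1)) has_real_derivative (barrier_exp p - 1) * \<rho> powr (barrier_exp p - 1 - 1)) (at \<rho>)"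
    by (rule has_real_derivative_powr[OF assms(2)])
  have Q: "((\<lambda>\<rho>. 1 / (R\<^sup>2 - \<rho>)) has_real_derivative 1 / (R\<^sup>2 - \<rho>)\<^sup>2) (at \<rho>)"
    using assms by (auto intro!: derivative_eq_intros simp: power2_eq_square)
  show "(barrier' p R has_real_derivative barrier'' p R \<rho>) (at \<rho>)"
    using DERIV_add[OF DERIV_cmult[OF P, of "barrier_exp p"] Q]
    by (simp add: barrier'_def[abs_def] barrier''_def mult.assoc)
qed

text \<open>At distance \<open>s\<close> the radial barrier has gradient of norm
  \<open>2 * s * barrier' p R (s\<^sup>2)\<close>, and the left side of the last inequality is its
  Laplacian when \<open>n\<close> is the dimension. The power part balances by the choice of
  exponent; the logarithm contributes at most a square of the gradient, absorbed because
  \<open>p > 2\<close> and the gradient is bounded away from 0.\<close>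

lemma barrier_gradient_dominates:
  fixes n :: real
  assumes p: "p > 2" and R: "R > 0" and n: "n \<ge> 0"
  obtains C where "C > 0"
    "\<And>s. 0 < s \<Longrightarrow> s < R \<Longrightarrow> 1 \<le> C * (2 * s * barrier' p R (s\<^sup>2)) powr p"
    "\<And>s. 0 < s \<Longrightarrow> s < R \<Longrightarrow>
       4 * s\<^sup>2 * barrier'' p R (s\<^sup>2) + 2 * n * barrier' p R (s\<^sup>2) \<le> C * (2 * s * barrier' p R (s\<^sup>2)) powr p"
proof -
  define \<beta> where "\<beta> = barrier_exp p"
  have \<beta>: "0 < \<beta>" "\<beta> < 1/2" using barrier_exp_bounds[OF p] by (auto simp: \<beta>_def)
  \<comment> \<open>A lower bound for the gradient norm \<open>D\<close>, coming from the power
    part: its exponent \<open>2 * \<beta> - 1\<close> is negative, so it is smallest at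
    \<open>s = R\<close>.\<close>
  define d where "d = 2 * \<beta> * R powr (2 * \<beta> - 1)"
  have d: "d > 0" using \<beta> R by (simp add: d_def)
  \<comment> \<open>In this order the terms pay for the constant 1, for the second derivative, and
    for the power part and the logarithmic part of the first derivative.\<close>
  define C where "C = 1 / d powr p + (d powr (2 - p) + 2 * n * \<beta> / (2 * \<beta>) powr p
      + 2 * n / R\<^sup>2 * (1 / d powr p + R / 2 * d powr (1 - p)))"
  have rest: "0 \<le> d powr (2 - p) + 2 * n * \<beta> / (2 * \<beta>) powr p
      + 2 * n / R\<^sup>2 * (1 / d powr p + R / 2 * d powr (1 - p))"
    using \<beta> R n by (intro add_nonneg_nonneg mult_nonneg_nonneg divide_nonneg_nonneg) auto
  have Cge: "C \<ge> 1 / d powr p" using rest by (simp add: C_def)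
  have C: "C > 0" using Cge d by (smt (verit) divide_pos_pos powr_gt_zero)
  have main: "1 \<le> C * (2 * s * barrier' p R (s\<^sup>2)) powr p \<and>
     4 * s\<^sup>2 * barrier'' p R (s\<^sup>2) + 2 * n * barrier' p R (s\<^sup>2) \<le> C * (2 * s * barrier' p R (s\<^sup>2)) powr p"
    if s: "0 < s" "s < R" for s
  proof -
    define D where "D = 2 * s * barrier' p R (s\<^sup>2)"
    have s2: "s\<^sup>2 < R\<^sup>2" using s by (simp add: power_strict_mono)
    have s2p: "s\<^sup>2 = s powr 2" using s by (simp add: powr_numeral)
    have pw: "(s\<^sup>2) powr e = s powr (2 * e)" for e by (simp add: s2p powr_powr)
    define a where "a = \<beta> * s powr (2 * \<beta> - 2)"
    define e where "e = 1 / (R\<^sup>2 - s\<^sup>2)"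
    have b': "barrier' p R (s\<^sup>2) = a + e"
      by (simp add: barrier'_def a_def e_def pw right_diff_distrib flip: \<beta>_def)
    have a0: "a > 0" and e0: "e > 0" using \<beta> s s2 by (auto simp: a_def e_def)
    have sa: "s * a = \<beta> * s powr (2 * \<beta> - 1)"
      using powr_mult_base[of s "2 * \<beta> - 2"] s by (simp add: a_def mult.left_commute)
    have D1: "2 * (s * a) \<le> D" and D2: "2 * (s * e) \<le> D"
      using s a0 e0 by (auto simp: D_def b' algebra_simps)
    have "R powr (2 * \<beta> - 1) \<le> s powr (2 * \<beta> - 1)"
      using \<beta> s by (intro powr_mono2') auto
    then have "2 * \<beta> * R powr (2 * \<beta> - 1) \<le> 2 * \<beta> * s powr (2 * \<beta> - 1)"
      using \<beta> by (intro mult_left_mono) auto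
    then have dD: "d \<le> D" using D1 by (simp add: sa d_def)
    have D: "D > 0" using d dD by linarith
    \<comment> \<open>Since \<open>D \<ge> d\<close>, every power of \<open>D\<close> below the
      \<open>p\<close>-th is controlled by the \<open>p\<close>-th.\<close>
    have q: "D powr k \<le> D powr p * d powr (k - p)" if "k \<le> p" for k
    proof -
      have "D powr (k - p) \<le> d powr (k - p)" using that d dD by (intro powr_mono2') auto
      then have "D powr p * D powr (k - p) \<le> D powr p * d powr (k - p)" by (intro mult_left_mono) auto
      then show ?thesis using D by (simp flip: powr_add)
    qed
    have q0: "1 \<le> D powr p / d powr p" using q[of 0] D d p by (simp add: powr_minus_divide)
    have q1: "D \<le> D powr p * d powr (1 - p)" using q[of 1] D p by simp
    have q2: "D\<^sup>2 \<le> D powr p * d powr (2 - p)" using q[of 2] D p by (simp add: powr_numeral)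
    have E1: "4 * s\<^sup>2 * barrier'' p R (s\<^sup>2) \<le> D\<^sup>2"
    proof -
      have "barrier'' p R (s\<^sup>2) \<le> e\<^sup>2"
        using \<beta> by (simp add: barrier''_def e_def power_divide mult_nonneg_nonpos mult_nonpos_nonneg flip: \<beta>_def)
      then have "4 * s\<^sup>2 * barrier'' p R (s\<^sup>2) \<le> 4 * s\<^sup>2 * e\<^sup>2" by (intro mult_left_mono) auto
      also have "\<dots> = (2 * (s * e))\<^sup>2" by (simp add: power_mult_distrib)
      also have "\<dots> \<le> D\<^sup>2" using D2 s e0 by (intro power_mono) auto
      finally show ?thesis .
    qed
    have E2: "s powr (2 * \<beta> - 2) \<le> D powr p / (2 * \<beta>) powr p"
    proof -
      have ex: "(2 * \<beta> - 1) * p = 2 * \<beta> - 2"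
        using p by (simp add: \<beta>_def barrier_exp_def field_simps)
      have "s powr (2 * \<beta> - 2) = (s powr (2 * \<beta> - 1)) powr p" by (simp add: powr_powr ex)
      also have "\<dots> \<le> (D / (2 * \<beta>)) powr p"
      proof (rule powr_mono2)
        have "2 * \<beta> * s powr (2 * \<beta> - 1) \<le> D" using D1 sa by simp
        then show "s powr (2 * \<beta> - 1) \<le> D / (2 * \<beta>)" using \<beta> by (simp add: field_simps)
      qed (use p in auto)
      also have "\<dots> = D powr p / (2 * \<beta>) powr p" using D \<beta> by (simp add: powr_divide)
      finally show ?thesis .
    qed
    have E3: "e \<le> 1 / R\<^sup>2 * (1 + R / 2 * D)"
    proof -
      \<comment> \<open>Only \<open>s * e\<close> is controlled by \<open>D\<close>; this identity
        recovers \<open>e\<close> itself near the centre, at the cost of a constant.\<close>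
      have "R\<^sup>2 * e = 1 + s * (s * e)" using s2 by (simp add: e_def field_simps power2_eq_square)
      also have "s * (s * e) \<le> R * (D / 2)" using D2 s e0 by (intro mult_mono) auto
      finally show ?thesis using R by (simp add: field_simps)
    qed
    have "1 \<le> D powr p / d powr p" by (rule q0)
    also have "\<dots> = (1 / d powr p) * D powr p" by simp
    also have "\<dots> \<le> C * D powr p" using Cge by (intro mult_right_mono) auto
    finally have r1: "1 \<le> C * D powr p" .
    have "2 * n * e \<le> 2 * n * (1 / R\<^sup>2 * (1 + R / 2 * D))" using E3 n by (intro mult_left_mono) auto
    also have "\<dots> = 2 * n / R\<^sup>2 * (1 + R / 2 * D)" by simp
    also have "\<dots> \<le> 2 * n / R\<^sup>2 * (D powr p / d powr p + R / 2 * (D powr p * d powr (1 - p)))"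
      using q0 q1 n R by (intro mult_left_mono add_mono mult_left_mono) auto
    finally have X: "2 * n * e \<le> 2 * n / R\<^sup>2 * (D powr p / d powr p + R / 2 * (D powr p * d powr (1 - p)))" .
    have Y: "2 * n * a \<le> 2 * n * (\<beta> * (D powr p / (2 * \<beta>) powr p))"
      unfolding a_def using E2 n \<beta> by (intro mult_left_mono) auto
    have "4 * s\<^sup>2 * barrier'' p R (s\<^sup>2) + 2 * n * barrier' p R (s\<^sup>2)
      \<le> D powr p * d powr (2 - p) + (2 * n * (\<beta> * (D powr p / (2 * \<beta>) powr p))
       + 2 * n / R\<^sup>2 * (D powr p / d powr p + R / 2 * (D powr p * d powr (1 - p))))"
      using E1 q2 X Y by (simp add: b' distrib_left)
    also have "\<dots> = (C - 1 / d powr p) * D powr p" by (simp add: C_def algebra_simps add_divide_distrib)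
    also have "\<dots> \<le> C * D powr p" by (intro mult_right_mono) auto
    finally show ?thesis using r1 by (simp add: D_def)
  qed
  show ?thesis using that[OF C] main by blast
qed

lemma continuous_on_barrier:
  assumes "p > 2" "R > 0" shows "continuous_on {0..<R\<^sup>2} (barrier p R)"
proof -
  have "continuous_on {0..<R\<^sup>2} (\<lambda>\<rho>. \<rho> powr barrier_exp p)"
    using barrier_exp_bounds[OF assms(1)] by (intro continuous_on_powr') (auto intro!: continuous_intros)
  moreover have "continuous_on {0..<R\<^sup>2} (\<lambda>\<rho>. ln (1 - \<rho> / R\<^sup>2))"
    using assms(2) by (intro continuous_intros) (auto simp: field_simps)
  ultimately show ?thesis unfolding barrier_def[abs_def] by (rule continuous_on_diff)
qed

lemma barrier_0 [simp]: "p > 2 \<Longrightarrow> barrier p R 0 = 0"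
  using barrier_exp_bounds[of p] by (simp add: barrier_def)

lemma barrier_ge: "barrier p R \<rho> \<ge> - ln (1 - \<rho> / R\<^sup>2)"
  by (simp add: barrier_def)

lemma barrier_mono:
  assumes "p > 2" "0 \<le> \<rho>" "\<rho> \<le> \<rho>'" "\<rho>' < R\<^sup>2"
  shows "barrier p R \<rho> \<le> barrier p R \<rho>'"
proof -
  have R: "R\<^sup>2 > 0" using assms by auto
  have "\<rho> powr barrier_exp p \<le> \<rho>' powr barrier_exp p"
    using assms barrier_exp_bounds[of p] by (intro powr_mono2) auto
  moreover have "ln (1 - \<rho>' / R\<^sup>2) \<le> ln (1 - \<rho> / R\<^sup>2)"
    using assms R by (subst ln_le_cancel_iff) (auto simp: divide_right_mono)
  ultimately show ?thesis by (simp add: barrier_def)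
qed

text \<open>Superlinear growth p > 2 makes the gradient term dominate, so a multiple of the barrier,
  which blows up at the boundary of the ball, is a strict supersolution away from its centre.\<close>
lemma subsolution_modulus:
  assumes p: "p > 2" and R: "R > 0" and \<epsilon>: "\<epsilon> > 0"
  obtains M where "M > 0"
    "\<And>S (u :: 'a::euclidean_space \<Rightarrow> real) x y. open S \<Longrightarrow> continuous_on S u \<Longrightarrow>
      vsub (growth_ineq p \<epsilon> K) S u \<Longrightarrow> cball x R \<subseteq> S \<Longrightarrow> y \<in> ball x R \<Longrightarrow>
      u y \<le> u x + M * barrier p R ((norm (y - x))\<^sup>2)"
proof -
  define n where "n = real DIM('a)"
  have n: "n \<ge> 0" by (simp add: n_def)
  obtain C where C: "C > 0"
    "\<And>s. 0 < s \<Longrightarrow> s < R \<Longrightarrow> 1 \<le> C * (2 * s * barrier' p R (s\<^sup>2)) powr p"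
    "\<And>s. 0 < s \<Longrightarrow> s < R \<Longrightarrow>
       4 * s\<^sup>2 * barrier'' p R (s\<^sup>2) + 2 * n * barrier' p R (s\<^sup>2) \<le> C * (2 * s * barrier' p R (s\<^sup>2)) powr p"
    using barrier_gradient_dominates[OF p R n] by metis
  \<comment> \<open>Since \<open>M \<ge> 1\<close> and \<open>p > 2\<close>, the gradient term gains
    at least \<open>M * M\<close> while the Laplacian gains only \<open>M\<close>. The summand
    \<open>\<epsilon> * C\<close> pays for the Laplacian, the last one exceeds
    \<open>K\<close>.\<close>
  define M where "M = 1 + \<epsilon> * C + (\<bar>K\<bar> + 1) * C"
  have M1: "M \<ge> 1" using C \<epsilon> by (simp add: M_def)
  have super: "K < (M * (2 * s * barrier' p R (s\<^sup>2))) powr p - \<epsilon> * (M * (4 * s\<^sup>2 * barrier'' p R (s\<^sup>2) + 2 * n * barrier' p R (s\<^sup>2)))"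
    if s: "0 < s" "s < R" for s
  proof -
    define D where "D = 2 * s * barrier' p R (s\<^sup>2)"
    define L where "L = 4 * s\<^sup>2 * barrier'' p R (s\<^sup>2) + 2 * n * barrier' p R (s\<^sup>2)"
    have cd: "1 \<le> C * D powr p" "L \<le> C * D powr p" using C(2,3)[OF s] by (auto simp: D_def L_def)
    have "M powr 2 \<le> M powr p" using M1 p by (intro powr_mono) auto
    then have MM: "M * M \<le> M powr p" using M1 by (simp add: powr_numeral power2_eq_square)
    have Dnn: "0 \<le> D"
    proof -
      have "s\<^sup>2 < R\<^sup>2" using s by (simp add: power_strict_mono)
      then show ?thesis using s barrier_exp_bounds[OF p] unfolding D_def barrier'_def
        by (intro mult_nonneg_nonneg add_nonneg_nonneg) auto
    qed
    have "\<bar>K\<bar> < \<bar>K\<bar> + 1" by simp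
    also have "\<dots> = 1 * ((\<bar>K\<bar> + 1) * 1)" by simp
    also have "\<dots> \<le> M * ((\<bar>K\<bar> + 1) * (C * D powr p))" using M1 cd by (intro mult_mono) auto
    also have "\<dots> = M * (((\<bar>K\<bar> + 1) * C) * D powr p)" by simp
    also have "\<dots> \<le> M * ((M - \<epsilon> * C) * D powr p)"
      using M1 by (intro mult_left_mono mult_right_mono) (auto simp: M_def)
    also have "\<dots> = M * M * D powr p - \<epsilon> * (M * (C * D powr p))" by (simp add: algebra_simps)
    also have "\<dots> \<le> M powr p * D powr p - \<epsilon> * (M * L)"
      using cd MM M1 \<epsilon> by (intro diff_mono mult_right_mono mult_left_mono) auto
    also have "\<dots> = (M * D) powr p - \<epsilon> * (M * L)" using M1 Dnn by (simp add: powr_mult)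
    finally show ?thesis by (simp add: D_def L_def)
  qed
  show ?thesis
  proof (rule that[of M])
    show "M > 0" using M1 by simp
    fix S and u :: "'a \<Rightarrow> real" and x y
    assume S: "open S" and u: "continuous_on S u"
      and sub: "vsub (growth_ineq p \<epsilon> K) S u" and cb: "cball x R \<subseteq> S" and y: "y \<in> ball x R"
    define \<psi> where "\<psi> z = M * barrier p R ((norm (z - x))\<^sup>2)" for z
    show "u y \<le> u x + M * barrier p R ((norm (y - x))\<^sup>2)"
    proof (rule ccontr)
      assume "\<not> ?thesis"
      define m where "m = u y - \<psi> y"
      have m: "m > u x" using \<open>\<not> _\<close> by (simp add: m_def \<psi>_def)
      have "compact (u ` cball x R)" using u cb by (intro compact_continuous_image continuous_on_subset[OF u]) auto
      then obtain B where B: "\<And>z. z \<in> cball x R \<Longrightarrow> u z \<le> B"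
        using compact_imp_bounded bounded_imp_bdd_above unfolding bdd_above_def by (metis imageI)
      \<comment> \<open>In the layer where \<open>1 - (norm (z - x))\<^sup>2 / R\<^sup>2\<close> is
        at most \<open>q\<close>, the logarithm alone lifts \<psi> above \<open>B - m\<close>; the
        halving makes this strict. The maximum is thus confined to the compact set
        \<open>T\<close>.\<close>
      define q where "q = exp (- ((B - m) / M)) / 2"
      have q: "q > 0" "B - m < - M * ln q"
        using M1 by (auto simp: q_def ln_div field_simps)
      have far: "u z - \<psi> z < m" if z: "z \<in> ball x R" "1 - (norm (z - x))\<^sup>2 / R\<^sup>2 \<le> q" for z
      proof -
        have "norm (z - x) < R" using z by (simp add: dist_norm norm_minus_commute)
        then have "(norm (z - x))\<^sup>2 < R\<^sup>2" by (simp add: power_strict_mono)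
        then have "0 < 1 - (norm (z - x))\<^sup>2 / R\<^sup>2" using R by (simp add: field_simps)
        then have "ln (1 - (norm (z - x))\<^sup>2 / R\<^sup>2) \<le> ln q" using z(2) by simp
        then have "- ln q \<le> barrier p R ((norm (z - x))\<^sup>2)" using barrier_ge[of "(norm (z - x))\<^sup>2" R p] by linarith
        then have "M * (- ln q) \<le> \<psi> z" unfolding \<psi>_def using M1 by (intro mult_left_mono) auto
        then have "B - m < \<psi> z" using q by simp
        moreover have "u z \<le> B" using B z by simp
        ultimately show ?thesis by simp
      qed
      define T where "T = {z \<in> cball x R. (norm (z - x))\<^sup>2 \<le> (1 - q) * R\<^sup>2}"
      have Tb: "z \<in> T \<Longrightarrow> z \<in> ball x R" for z
      proof -
        assume z: "z \<in> T"
        have "(norm (z - x))\<^sup>2 \<le> (1 - q) * R\<^sup>2" using z by (simp add: T_def)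
        also have "\<dots> < R\<^sup>2" using q R by (simp add: algebra_simps)
        finally have "norm (z - x) < R" using R by (intro power2_less_imp_less[of _ R]) auto
        then show ?thesis by (simp add: dist_norm norm_minus_commute)
      qed
      have nT: "u z - \<psi> z < m" if "z \<in> ball x R" "z \<notin> T" for z
        by (rule far) (use that R in \<open>auto simp: T_def field_simps\<close>)
      have yT: "y \<in> T" using nT[OF y] m_def by blast
      have "closed {z. (norm (z - x))\<^sup>2 \<le> (1 - q) * R\<^sup>2}"
        by (intro closed_Collect_le continuous_intros)
      then have cT: "compact T" unfolding T_def
        using compact_Int_closed[OF compact_cball, of "{z. (norm (z - x))\<^sup>2 \<le> (1 - q) * R\<^sup>2}" x R]
        by (simp add: Int_def)
      have "continuous_on T (\<lambda>z. u z - \<psi> z)" unfolding \<psi>_def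
      proof (intro continuous_on_diff continuous_on_mult continuous_on_const)
        show "continuous_on T u" by (rule continuous_on_subset[OF u]) (use cb in \<open>auto simp: T_def\<close>)
        show "continuous_on T (\<lambda>z. barrier p R ((norm (z - x))\<^sup>2))"
        proof (rule continuous_on_compose2[OF continuous_on_barrier[OF p R]])
          show "(\<lambda>z. (norm (z - x))\<^sup>2) ` T \<subseteq> {0..<R\<^sup>2}"
            using Tb by (auto simp: dist_norm norm_minus_commute intro!: power_strict_mono)
        qed (intro continuous_intros)
      qed
      then obtain z where z: "z \<in> T" "\<And>w. w \<in> T \<Longrightarrow> u w - \<psi> w \<le> u z - \<psi> z"
        using continuous_attains_sup[OF cT] yT by blast
      have mz: "m \<le> u z - \<psi> z" using z(2)[OF yT] by (simp add: m_def)
      have zmax: "u w - \<psi> w \<le> u z - \<psi> z" if "w \<in> ball x R" for w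
        using z(2)[of w] nT[OF that] mz by (cases "w \<in> T") auto
      \<comment> \<open>The barrier is not of class C^2 at the centre, but there it vanishes and the
        difference is only \<open>u x\<close>, which is below \<open>m\<close>.\<close>
      have zx: "z \<noteq> x" using mz m p by (auto simp: \<psi>_def)
      define V where "V = ball x R - {x}"
      have V: "open V" "z \<in> V" using Tb[OF z(1)] zx by (auto simp: V_def)
      have rng: "0 < (norm (w - x))\<^sup>2" "(norm (w - x))\<^sup>2 < R\<^sup>2" if "w \<in> V" for w
        using that by (auto simp: V_def dist_norm norm_minus_commute intro!: power_strict_mono)
      have Cb: "Ck_on 2 {0<..<R\<^sup>2} (barrier p R)"
      proof (rule Ck_on_real_2[of _ _ "barrier' p R" "barrier'' p R"])
        show "continuous_on {0<..<R\<^sup>2} (barrier'' p R)"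
          unfolding barrier''_def[abs_def] by (intro continuous_intros) auto
      qed (use barrier_deriv[OF p] in auto)
      have Cc: "Ck_on 2 V (\<lambda>z. barrier p R ((norm (z - x))\<^sup>2))"
        by (rule Ck_on_compose[OF V(1) _ _ Ck_on_norm2 Cb]) (use rng in auto)
      have C\<psi>: "Ck_on 2 V \<psi>" unfolding \<psi>_def by (rule Ck_on_cmult[OF V(1) Cc])
      have "touches_above \<psi> u z"
        by (rule touches_aboveI[OF V C\<psi>]) (use zmax in \<open>auto simp: V_def\<close>)
      moreover have "z \<in> S" using V cb by (auto simp: V_def)
      ultimately have le: "norm (grad \<psi> z) powr p - \<epsilon> * laplacian \<psi> z \<le> K" using vsubD[OF sub] by blast
      define s where "s = norm (z - x)"
      have s: "0 < s" "s < R" using V(2) by (auto simp: s_def V_def dist_norm norm_minus_commute)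
      have dN: "(\<lambda>z. (norm (z - x))\<^sup>2) differentiable (at z)"
        using Ck_on_imp_differentiable[OF Ck_on_norm2[of 2 UNIV x]] by simp
      have g1: "grad (\<lambda>z. barrier p R ((norm (z - x))\<^sup>2)) z = barrier' p R (s\<^sup>2) *\<^sub>R 2 *\<^sub>R (z - x)"
        using grad_compose[OF dN barrier_deriv(1)[OF p rng[OF V(2)]]] by (simp add: grad_norm2 s_def)
      have dB: "(\<lambda>z. barrier p R ((norm (z - x))\<^sup>2)) differentiable (at z)"
        using Ck_on_imp_differentiable[OF Cc _ V(2)] by simp
      have g2: "norm (grad \<psi> z) = M * (2 * s * barrier' p R (s\<^sup>2))"
      proof -
        have "barrier' p R (s\<^sup>2) \<ge> 0" using rng[OF V(2)] barrier_exp_bounds[OF p]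
          by (auto simp: barrier'_def s_def intro!: add_nonneg_nonneg)
        then show ?thesis using M1 unfolding \<psi>_def
          by (subst grad_cmult[OF dB]) (simp add: g1 s_def)
      qed
      have "laplacian (\<lambda>z. barrier p R ((norm (z - x))\<^sup>2)) z
        = barrier'' p R ((norm (z - x))\<^sup>2) * (norm (grad (\<lambda>z. (norm (z - x))\<^sup>2) z))\<^sup>2
          + barrier' p R ((norm (z - x))\<^sup>2) * laplacian (\<lambda>z. (norm (z - x))\<^sup>2) z"
        by (rule laplacian_compose[OF V Ck_on_norm2]) (use barrier_deriv[OF p] rng V(2) in auto)
      also have "\<dots> = 4 * s\<^sup>2 * barrier'' p R (s\<^sup>2) + 2 * n * barrier' p R (s\<^sup>2)"
        by (simp add: grad_norm2 laplacian_norm2 s_def n_def power_mult_distrib)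
      finally have l2: "laplacian \<psi> z = M * (4 * s\<^sup>2 * barrier'' p R (s\<^sup>2) + 2 * n * barrier' p R (s\<^sup>2))"
        unfolding \<psi>_def by (subst laplacian_cmult[OF V Cc]) simp
      show False using le super[OF s] unfolding g2 l2 by simp
    qed
  qed
qed

subsection \<open>Attainment of the additive eigenvalue\<close>

text \<open>The modulus estimate is centred at an arbitrary point of a small ball. With
  \<open>R = R0 / 2\<close> and \<open>r = R / 4\<close>, two points of \<open>ball z r\<close> are
  within \<open>R / 2\<close> of each other and the \<open>R\<close>-balls about them stay inside
  \<open>cball z R0\<close>; exchanging the points makes the estimate two-sided.\<close>

lemma subsolutions_equicontinuous:
  fixes z :: "'a::euclidean_space" and K :: real
  assumes p: "p > 2" and \<epsilon>: "\<epsilon> > 0" and S: "open S" and z: "z \<in> S"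
  defines "X \<equiv> {u. continuous_on S u \<and> vsub (growth_ineq p \<epsilon> K) S u}"
  obtains r W where "r > 0" "ball z r \<subseteq> S"
    "\<And>e. e > 0 \<Longrightarrow> \<exists>d>0. \<forall>u\<in>X. \<forall>x\<in>ball z r. \<forall>y\<in>ball z r. dist x y < d \<longrightarrow> u x - u y < e"
    "\<And>u x y. u \<in> X \<Longrightarrow> x \<in> ball z r \<Longrightarrow> y \<in> ball z r \<Longrightarrow> u x - u y \<le> W"
proof -
  obtain R0 where R0: "R0 > 0" "cball z R0 \<subseteq> S" using S z by (auto simp: open_contains_cball)
  define R where "R = R0 / 2"
  have R: "R > 0" using R0 by (simp add: R_def)
  define r where "r = R / 4"
  obtain M where M: "M > 0"
    "\<And>S (u :: 'a \<Rightarrow> real) x y. open S \<Longrightarrow> continuous_on S u \<Longrightarrow>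
      vsub (growth_ineq p \<epsilon> K) S u \<Longrightarrow> cball x R \<subseteq> S \<Longrightarrow> y \<in> ball x R \<Longrightarrow>
      u y \<le> u x + M * barrier p R ((norm (y - x))\<^sup>2)"
    using subsolution_modulus[OF p R \<epsilon>, where 'a='a and K=K] by metis
  have near: "u x - u y \<le> M * barrier p R ((dist x y)\<^sup>2)" "dist x y \<le> R / 2"
    if "u \<in> X" "x \<in> ball z r" "y \<in> ball z r" for u x y
  proof -
    have "dist x y \<le> dist z x + dist z y" by (metis dist_commute dist_triangle2)
    then show d: "dist x y \<le> R / 2" using that by (auto simp: r_def)
    have "dist z w \<le> R0" if "dist y w \<le> R" for w
      using dist_triangle[of z w y] that \<open>y \<in> ball z r\<close> R by (auto simp: r_def R_def)
    then have "cball y R \<subseteq> S" using R0(2) by auto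
    moreover have "x \<in> ball y R" using d R by (simp add: dist_commute)
    ultimately show "u x - u y \<le> M * barrier p R ((dist x y)\<^sup>2)"
      using M(2)[OF S, of u y x] that by (simp add: X_def dist_norm)
  qed
  have lt: "(R / 2)\<^sup>2 < R\<^sup>2" using R by (intro power_strict_mono) auto
  show ?thesis
  proof (rule that[of r "M * barrier p R ((R / 2)\<^sup>2)"])
    show "r > 0" using R by (simp add: r_def)
    show "ball z r \<subseteq> S" using R0 by (auto simp: r_def R_def)
    show "u x - u y \<le> M * barrier p R ((R / 2)\<^sup>2)" if "u \<in> X" "x \<in> ball z r" "y \<in> ball z r" for u x y
    proof -
      have "barrier p R ((dist x y)\<^sup>2) \<le> barrier p R ((R / 2)\<^sup>2)"
        using near(2)[OF that] by (intro barrier_mono[OF p _ _ lt] power_mono) auto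
      then have "M * barrier p R ((dist x y)\<^sup>2) \<le> M * barrier p R ((R / 2)\<^sup>2)" using M by (intro mult_left_mono) auto
      with near(1)[OF that] show ?thesis by linarith
    qed
    show "\<exists>d>0. \<forall>u\<in>X. \<forall>x\<in>ball z r. \<forall>y\<in>ball z r. dist x y < d \<longrightarrow> u x - u y < e" if e: "e > 0" for e
    proof -
      have "continuous_on {0..<R\<^sup>2} (\<lambda>\<rho>. M * barrier p R \<rho>)"
        by (intro continuous_intros continuous_on_barrier[OF p R])
      moreover have "0 \<in> {0..<R\<^sup>2}" using R by simp
      ultimately obtain d where d: "d > 0" "\<And>\<rho>. \<rho> \<in> {0..<R\<^sup>2} \<Longrightarrow> dist \<rho> 0 < d \<Longrightarrow> dist (M * barrier p R \<rho>) (M * barrier p R 0) < e"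
        using e unfolding continuous_on_iff by metis
      show ?thesis
      proof (intro exI[of _ "sqrt d"] conjI ballI impI)
        show "sqrt d > 0" using d by simp
        fix u x y assume *: "u \<in> X" "x \<in> ball z r" "y \<in> ball z r" "dist x y < sqrt d"
        have "(dist x y)\<^sup>2 < (sqrt d)\<^sup>2" using * by (intro power_strict_mono) auto
        then have "(dist x y)\<^sup>2 < d" using d(1) by simp
        moreover have "(dist x y)\<^sup>2 \<le> (R / 2)\<^sup>2" using near(2)[OF *(1-3)] by (intro power_mono) auto
        ultimately have "M * barrier p R ((dist x y)\<^sup>2) < e"
          using d(2)[of "(dist x y)\<^sup>2"] lt p by (auto simp: dist_real_def)
        then show "u x - u y < e" using near(1)[OF *(1-3)] by linarith
      qed
    qed
  qed
qed

text \<open>The bound depends only on the radius of a ball inside \<open>S\<close>. If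
  \<open>k\<close> is negative, the Poisson inequality pushes the centre value below the largest
  value on a sphere by an amount proportional to the absolute value of \<open>k\<close>, while the
  modulus estimate with \<open>K = 0\<close> bounds that drop by \<open>W\<close>.\<close>

lemma subsolution_constant_lower_bound:
  assumes p: "p > 2" and \<epsilon>: "\<epsilon> > 0" and R: "R > 0"
  obtains N where
    "\<And>S (u :: 'a::euclidean_space \<Rightarrow> real) x k. open S \<Longrightarrow> continuous_on S u \<Longrightarrow> cball x R \<subseteq> S \<Longrightarrow>
      vsub (growth_ineq p \<epsilon> k) S u \<Longrightarrow> N \<le> k"
proof -
  obtain M where M: "M > 0"
    "\<And>S (u :: 'a \<Rightarrow> real) x y. open S \<Longrightarrow> continuous_on S u \<Longrightarrow>
      vsub (growth_ineq p \<epsilon> 0) S u \<Longrightarrow> cball x R \<subseteq> S \<Longrightarrow> y \<in> ball x R \<Longrightarrow>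
      u y \<le> u x + M * barrier p R ((norm (y - x))\<^sup>2)"
    using subsolution_modulus[OF p R \<epsilon>, where 'a='a and K=0] by metis
  define r where "r = R / 2"
  have r: "r > 0" "r < R" using R by (auto simp: r_def)
  define W where "W = M * barrier p R (r\<^sup>2)"
  define n where "n = real DIM('a)"
  have n: "n > 0" by (simp add: n_def)
  show ?thesis
  proof (rule that[of "min 0 (- (2 * n * \<epsilon> * W / r\<^sup>2))"])
    fix S and u :: "'a \<Rightarrow> real" and x k
    assume S: "open S" and u: "continuous_on S u" and cb: "cball x R \<subseteq> S"
      and sub: "vsub (growth_ineq p \<epsilon> k) S u"
    show "min 0 (- (2 * n * \<epsilon> * W / r\<^sup>2)) \<le> k"
    proof (cases "k \<ge> 0")
      case False
      have sub0: "vsub (growth_ineq p \<epsilon> 0) S u"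
        by (rule vsub_mono[OF sub]) (use False in auto)
      have cr: "cball x r \<subseteq> S" "ball x r \<subseteq> S" using cb r by auto
      have sub1: "vsub (\<lambda>x \<xi> l. - l \<le> k / \<epsilon>) (ball x r) u"
      proof (rule vsub_mono[OF vsub_subset[OF sub cr(2)]])
        fix \<xi> :: 'a and l assume "norm \<xi> powr p - \<epsilon> * l \<le> k"
        moreover have "0 \<le> norm \<xi> powr p" by simp
        ultimately have "- (\<epsilon> * l) \<le> k" by linarith
        then show "- l \<le> k / \<epsilon>" using \<epsilon> by (simp add: field_simps)
      qed
      define \<phi> where "\<phi> y = (- k / (2 * n * \<epsilon>)) * (norm (y - x))\<^sup>2 + (u x + W + k / (2 * n * \<epsilon>) * r\<^sup>2)" for y
      have C1: "Ck_on 2 A (\<lambda>y. (- k / (2 * n * \<epsilon>)) * (norm (y - x))\<^sup>2)" for A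
        by (rule Ck_on_subset[OF Ck_on_cmult[OF open_UNIV Ck_on_norm2]]) auto
      have "u x \<le> \<phi> x"
      proof (rule vsub_comparison[OF r(1) continuous_on_subset[OF u cr(1)] sub1])
        show "continuous_on (cball x r) \<phi>" unfolding \<phi>_def by (intro continuous_intros)
        show "Ck_on 2 (ball x r) \<phi>" unfolding \<phi>_def by (intro Ck_on_add C1) auto
        show "k / \<epsilon> \<le> - laplacian \<phi> y" for y
          unfolding \<phi>_def using n
          by (subst laplacian_add[OF open_UNIV UNIV_I C1 Ck_on_const], subst laplacian_cmult[OF open_UNIV UNIV_I Ck_on_norm2])
             (simp add: laplacian_norm2 flip: n_def)
        show "u y \<le> \<phi> y" if y: "y \<in> sphere x r" for y
        proof -
          have "norm (y - x) = r" using y by (simp add: dist_norm norm_minus_commute)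
          moreover have "y \<in> ball x R" using y r by simp
          ultimately show ?thesis using M(2)[OF S u sub0 cb, of y] by (simp add: \<phi>_def W_def)
        qed
      qed (use r in auto)
      then have "0 \<le> W + k * (r\<^sup>2 / (2 * n * \<epsilon>))" by (simp add: \<phi>_def)
      then have "- (2 * n * \<epsilon> * W / r\<^sup>2) \<le> k" using r n \<epsilon> by (simp add: field_simps)
      then show ?thesis by simp
    qed auto
  qed
qed

lemma vsub_diff_const:
  assumes "vsub P S u" shows "vsub P S (\<lambda>x. u x - a)"
proof -
  have "touches_above \<phi> (\<lambda>x. u x - a) x \<Longrightarrow> touches_above \<phi> u x" for \<phi> x
    by (simp add: touches_above_def)
  then show ?thesis using assms by (simp add: vsub_def)
qed

text \<open>A real upper limit given by its two defining properties. The filter is arbitrary because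
  it is used for sequences and for difference quotients from the right.\<close>

lemma real_limsup_exists:
  fixes a :: "'b \<Rightarrow> real"
  assumes F: "F \<noteq> bot" and B: "\<forall>\<^sub>F k in F. \<bar>a k\<bar> \<le> B"
  shows "\<exists>L. \<forall>e>0. (\<forall>\<^sub>F k in F. a k < L + e) \<and> (\<exists>\<^sub>F k in F. a k > L - e)"
proof -
  define A where "A = {t. \<forall>\<^sub>F k in F. a k < t}"
  have "\<forall>\<^sub>F k in F. a k < B + 1" using B by eventually_elim linarith
  then have ne: "B + 1 \<in> A" by (simp add: A_def)
  have lb: "- B \<le> t" if "t \<in> A" for t
  proof -
    have "\<forall>\<^sub>F k in F. a k < t" using that by (simp add: A_def)
    then have "\<forall>\<^sub>F k in F. - B \<le> t" using B by eventually_elim linarith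
    then show ?thesis using F by simp
  qed
  have bdd: "bdd_below A" using lb by (auto simp: bdd_below_def)
  show ?thesis
  proof (intro exI[of _ "Inf A"] allI impI conjI)
    fix e :: real assume e: "e > 0"
    obtain t where t: "t \<in> A" "t < Inf A + e"
      using cInf_lessD[of A "Inf A + e"] ne e by auto
    show "\<forall>\<^sub>F k in F. a k < Inf A + e"
      using t unfolding A_def by (auto elim: eventually_mono)
    show "\<exists>\<^sub>F k in F. a k > Inf A - e"
    proof (rule ccontr)
      assume "\<not> ?thesis"
      then have "\<forall>\<^sub>F k in F. a k < Inf A - e / 2"
        unfolding frequently_def using e by (auto elim!: eventually_mono)
      then have "Inf A - e / 2 \<in> A" by (simp add: A_def)
      then show False using cInf_lower[OF _ bdd] e by fastforce
    qed
  qed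
qed

text \<open>Half-relaxed limits: by equicontinuity the pointwise upper limit is continuous, and maxima of
  the approximants minus a strict test function converge to the contact point.\<close>
lemma subsolution_limit:
  fixes f :: "'a::euclidean_space \<Rightarrow> real"
  assumes p: "p > 2" and \<epsilon>: "\<epsilon> > 0" and S: "open S" "connected S"
    and f: "continuous_on S f" "\<And>x. x \<in> S \<Longrightarrow> f x \<le> B"
    and c: "c \<longlonglongrightarrow> c'"
    and u: "\<And>k. continuous_on S (u k)" "\<And>k. vsub (HJ_ineq p \<epsilon> f (c k)) S (u k)"
  obtains v where "continuous_on S v" "vsub (HJ_ineq p \<epsilon> f c') S v"
proof (cases "S = {}")
  case True then show ?thesis using that[of "\<lambda>_. 0"] by (simp add: vsub_def)
next
  case False
  then obtain z0 where z0: "z0 \<in> S" by blast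
  \<comment> \<open>Additive constants do not affect the inequality; this normalisation is what
    makes the sequence bounded at one point.\<close>
  define w where "w k x = u k x - u k z0" for k x
  obtain K0 where K0: "\<And>k. c k \<le> K0"
    using convergent_imp_Bseq[of c] c unfolding convergent_def Bseq_def by (metis abs_le_D1 real_norm_def)
  define K where "K = K0 + B"
  define X where "X = {u. continuous_on S u \<and> vsub (growth_ineq p \<epsilon> K) S u}"
  have wv: "vsub (HJ_ineq p \<epsilon> f (c k)) S (w k)" for k
    unfolding w_def by (rule vsub_diff_const[OF u(2)])
  have wX: "w k \<in> X" for k
  proof -
    have "continuous_on S (w k)" unfolding w_def by (intro continuous_intros u)
    moreover have "vsub (growth_ineq p \<epsilon> K) S (w k)"
    proof (rule vsub_mono[OF wv[of k]])
      fix x \<xi> l assume "x \<in> S" "norm (\<xi>::'a) powr p - f x - \<epsilon> * l \<le> c k"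
      then show "norm \<xi> powr p - \<epsilon> * l \<le> K" using f(2)[of x] K0[of k] by (simp add: K_def)
    qed
    ultimately show ?thesis by (simp add: X_def)
  qed
  have loc: "\<exists>r W. r > 0 \<and> ball z r \<subseteq> S \<and>
     (\<forall>e>0. \<exists>d>0. \<forall>k. \<forall>x\<in>ball z r. \<forall>y\<in>ball z r. dist x y < d \<longrightarrow> w k x - w k y < e) \<and>
     (\<forall>k. \<forall>x\<in>ball z r. \<forall>y\<in>ball z r. w k x - w k y \<le> W)" if z: "z \<in> S" for z
  proof -
    obtain r W where r: "r > 0" "ball z r \<subseteq> S"
      and eq: "\<And>e. e > 0 \<Longrightarrow> \<exists>d>0. \<forall>u\<in>X. \<forall>x\<in>ball z r. \<forall>y\<in>ball z r. dist x y < d \<longrightarrow> u x - u y < e"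
      and bd: "\<And>u x y. u \<in> X \<Longrightarrow> x \<in> ball z r \<Longrightarrow> y \<in> ball z r \<Longrightarrow> u x - u y \<le> W"
      by (rule subsolutions_equicontinuous[OF p \<epsilon> S(1) z, where K = K, folded X_def]) (rule that; assumption)
    have "\<exists>d>0. \<forall>k. \<forall>x\<in>ball z r. \<forall>y\<in>ball z r. dist x y < d \<longrightarrow> w k x - w k y < e" if "e > 0" for e
      using eq[OF that] wX by blast
    moreover have "\<forall>k. \<forall>x\<in>ball z r. \<forall>y\<in>ball z r. w k x - w k y \<le> W" using bd wX by blast
    ultimately show ?thesis using r by blast
  qed
  \<comment> \<open>The interior estimate bounds only local oscillations; connectedness chains these
    bounds from \<open>z0\<close> to every other point.\<close>
  have bounded_w: "bounded (range (\<lambda>k. w k x))" if x: "x \<in> S" for x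
  proof (rule connected_induction_simple[OF S(2) z0 x])
    show "bounded (range (\<lambda>k. w k z0))" by (simp add: w_def)
    fix z assume z: "z \<in> S"
    obtain r W where r: "r > 0" "ball z r \<subseteq> S" "\<And>k x y. x \<in> ball z r \<Longrightarrow> y \<in> ball z r \<Longrightarrow> w k x - w k y \<le> W"
      using loc[OF z] by blast
    have step: "bounded (range (\<lambda>k. w k y))" if xy: "x \<in> ball z r" "y \<in> ball z r" and b: "bounded (range (\<lambda>k. w k x))" for x y
    proof -
      obtain b where b: "\<And>k. \<bar>w k x\<bar> \<le> b" using b by (auto simp: bounded_iff)
      have "\<bar>w k y\<bar> \<le> b + W" for k using r(3)[of x y k] r(3)[of y x k] b[of k] xy by linarith
      then show ?thesis by (auto simp: bounded_iff)
    qed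
    show "\<exists>T. openin (top_of_set S) T \<and> z \<in> T \<and>
       (\<forall>x\<in>T. \<forall>y\<in>T. bounded (range (\<lambda>k. w k x)) \<longrightarrow> bounded (range (\<lambda>k. w k y)))"
    proof (intro exI[of _ "ball z r"] conjI ballI impI)
      show "openin (top_of_set S) (ball z r)" by (rule open_subset[OF r(2) open_ball])
      show "z \<in> ball z r" using r(1) by simp
    qed (rule step)
  qed
  have "\<exists>v. \<forall>x\<in>S. \<forall>e>0. (\<forall>\<^sub>F k in sequentially. w k x < v x + e) \<and> (\<exists>\<^sub>F k in sequentially. w k x > v x - e)"
  proof (intro bchoice ballI)
    fix x assume "x \<in> S"
    then obtain b where "\<And>k. \<bar>w k x\<bar> \<le> b" using bounded_w by (force simp: bounded_iff)
    then show "\<exists>y. \<forall>e>0. (\<forall>\<^sub>F k in sequentially. w k x < y + e) \<and> (\<exists>\<^sub>F k in sequentially. w k x > y - e)"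
      by (intro real_limsup_exists[of _ _ b]) auto
  qed
  then obtain v where v: "\<And>x e. x \<in> S \<Longrightarrow> e > 0 \<Longrightarrow> \<forall>\<^sub>F k in sequentially. w k x < v x + e"
    "\<And>x e. x \<in> S \<Longrightarrow> e > 0 \<Longrightarrow> \<exists>\<^sub>F k in sequentially. w k x > v x - e" by blast
  \<comment> \<open>An upper limit is approached only frequently, but the bound from above at the
    other point holds eventually, so some index serves both.\<close>
  have v_le: "v x - v y \<le> e" if "x \<in> S" "y \<in> S" "\<And>k. w k x - w k y \<le> e" for x y e
  proof (rule field_le_epsilon)
    fix \<eta> :: real assume \<eta>: "\<eta> > 0"
    have "\<exists>\<^sub>F k in sequentially. w k x > v x - \<eta>/2 \<and> w k y < v y + \<eta>/2"
      using \<eta> by (intro frequently_eventually_frequently v(2)[OF that(1)] v(1)[OF that(2)]) auto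
    then obtain k where "w k x > v x - \<eta>/2" "w k y < v y + \<eta>/2" using frequently_ex by blast
    then show "v x - v y \<le> e + \<eta>" using that(3)[of k] by linarith
  qed
  have cv: "continuous_on S v"
    unfolding continuous_on_iff
  proof (intro ballI allI impI)
    fix x e assume x: "x \<in> S" and e: "(e::real) > 0"
    obtain r W where r: "r > 0" "ball x r \<subseteq> S"
      "\<And>e. e>0 \<Longrightarrow> \<exists>d>0. \<forall>k. \<forall>y\<in>ball x r. \<forall>z\<in>ball x r. dist y z < d \<longrightarrow> w k y - w k z < e"
      using loc[OF x] by blast
    obtain d where d: "d > 0" "\<And>k y z. y \<in> ball x r \<Longrightarrow> z \<in> ball x r \<Longrightarrow> dist y z < d \<Longrightarrow> w k y - w k z < e/2"
      using r(3)[of "e/2"] e by auto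
    show "\<exists>d>0. \<forall>x'\<in>S. dist x' x < d \<longrightarrow> dist (v x') (v x) < e"
    proof (intro exI[of _ "min d r"] conjI ballI impI)
      show "min d r > 0" using d r by simp
      fix y assume y: "y \<in> S" "dist y x < min d r"
      then have "y \<in> ball x r" "x \<in> ball x r" "dist y x < d" "dist x y < d" using r by (auto simp: dist_commute)
      then have "w k y - w k x < e/2" "w k x - w k y < e/2" for k
        using d(2)[of y x k] d(2)[of x y k] by blast+
      then have "v y - v x \<le> e/2" "v x - v y \<le> e/2"
        by (intro v_le y(1) x less_imp_le, simp)+
      then show "dist (v y) (v x) < e" using e by (auto simp: dist_real_def)
    qed
  qed
  have vs: "vsub (HJ_ineq p \<epsilon> f c') S v"
    unfolding vsub_def
  proof (intro ballI allI impI)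
    fix x \<phi> assume x: "x \<in> S" and t: "touches_above \<phi> v x"
    define n where "n = real DIM('a)"
    have n: "n > 0" by (simp add: n_def)
    obtain r1 where r1: "r1 > 0" "ball x r1 \<subseteq> S" "Ck_on 2 (ball x r1) \<phi>" "\<And>y. y \<in> ball x r1 \<Longrightarrow> v y - \<phi> y \<le> v x - \<phi> x"
      using touches_aboveE[OF t S(1) x] by metis
    obtain r2 W where r2: "r2 > 0" "ball x r2 \<subseteq> S"
      "\<And>e. e>0 \<Longrightarrow> \<exists>d>0. \<forall>k. \<forall>y\<in>ball x r2. \<forall>z\<in>ball x r2. dist y z < d \<longrightarrow> w k y - w k z < e"
      using loc[OF x] by blast
    define r where "r = min r1 r2 / 2"
    have r: "r > 0" "r < r1" "r < r2" using r1 r2 by (auto simp: r_def)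
    have cS: "cball x r \<subseteq> S" using r r1(2) by auto
    have xb: "x \<in> ball x r1" using r1 by simp
    \<comment> \<open>The quadratic with factor \<sigma> makes the contact strict, so that maxima
      for the approximants must come close to \<open>x\<close>. Its Laplacian is the extra term,
      removed at the end.\<close>
    have key: "norm (grad \<phi> x) powr p - f x - \<epsilon> * (laplacian \<phi> x + \<sigma> * (2 * n)) \<le> c'" if \<sigma>: "\<sigma> > 0" for \<sigma>
    proof -
      define \<psi> where "\<psi> y = \<phi> y + \<sigma> * (norm (y - x))\<^sup>2" for y
      have CN: "Ck_on 2 (ball x r1) (\<lambda>y. \<sigma> * (norm (y - x))\<^sup>2)" by (rule Ck_on_cmult[OF open_ball Ck_on_norm2])
      have C\<psi>: "Ck_on 2 (ball x r1) \<psi>" unfolding \<psi>_def by (rule Ck_on_add[OF open_ball r1(3) CN])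
      have c\<psi>: "continuous_on (ball x r1) \<psi>" by (rule Ck_on_imp_continuous_on[OF open_ball C\<psi>])
      define D where "D = v x - \<phi> x"
      have strict: "v y - \<psi> y \<le> D - \<sigma> * (dist x y)\<^sup>2" if "y \<in> ball x r1" for y
        using r1(4)[OF that] by (simp add: \<psi>_def D_def dist_norm norm_minus_commute)
      \<comment> \<open>The pointwise bound from above becomes uniform on the closed ball: it is
        used at a finite net and spread by equicontinuity, \<open>e/3\<close> for each of three
        comparisons.\<close>
      have ev: "\<forall>\<^sub>F k in sequentially. \<forall>y\<in>cball x r. w k y < v y + e" if e: "e > 0" for e
      proof -
        obtain d where d: "d > 0" "\<And>k y z. y \<in> ball x r2 \<Longrightarrow> z \<in> ball x r2 \<Longrightarrow> dist y z < d \<Longrightarrow> w k y - w k z < e/3"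
          using r2(3)[of "e/3"] e by auto
        obtain N where N: "finite N" "N \<subseteq> cball x r" "cball x r \<subseteq> (\<Union>y\<in>N. ball y d)"
          using seq_compact_imp_totally_bounded[of "cball x r"] compact_imp_seq_compact[OF compact_cball] d(1) by metis
        have "\<forall>\<^sub>F k in sequentially. \<forall>y\<in>N. w k y < v y + e/3"
          using N cS e by (intro eventually_ball_finite ballI v(1)) auto
        then show ?thesis
        proof (rule eventually_mono, intro ballI)
          fix k y assume k: "\<forall>y\<in>N. w k y < v y + e/3" and y: "y \<in> cball x r"
          then obtain q where q: "q \<in> N" "y \<in> ball q d" using N by blast
          have *: "y \<in> ball x r2" "q \<in> ball x r2" "y \<in> S" "q \<in> S" using y q N(2) r cS by auto
          have "w k y - w k q < e/3" using d(2)[OF *(1,2), of k] q by (simp add: dist_commute)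
          moreover have "v q - v y \<le> e/3"
            by (rule v_le[OF *(4,3)]) (use d(2)[OF *(2,1)] q in \<open>auto intro: less_imp_le\<close>)
          moreover have "w k q < v q + e/3" using k q by blast
          ultimately show "w k y < v y + e" by linarith
        qed
      qed
      have pt: "\<exists>k y. k \<ge> m \<and> y \<in> ball x r \<and> dist x y < \<eta> \<and> touches_above \<psi> (w k) y" if \<eta>: "\<eta> > 0" for m :: nat and \<eta>
      proof -
        define \<eta>' where "\<eta>' = min \<eta> r / 2"
        have \<eta>': "\<eta>' > 0" "\<eta>' < \<eta>" "\<eta>' < r" using \<eta> r by (auto simp: \<eta>'_def)
        \<comment> \<open>Half of the strict gap at distance \<eta>': the upper error at a competing
          point and the lower error at \<open>x\<close> together cannot exceed the gap.\<close>
        define e where "e = \<sigma> * \<eta>'\<^sup>2 / 2"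
        have e: "e > 0" using \<sigma> \<eta>' by (simp add: e_def)
        have "\<forall>\<^sub>F k in sequentially. k \<ge> m \<and> (\<forall>y\<in>cball x r. w k y < v y + e)"
          using eventually_ge_at_top[of m] ev[OF e] by eventually_elim auto
        then have "\<exists>\<^sub>F k in sequentially. w k x > v x - e \<and> k \<ge> m \<and> (\<forall>y\<in>cball x r. w k y < v y + e)"
          by (rule frequently_eventually_frequently[OF v(2)[OF x e]])
        then obtain k where k: "w k x > v x - e" "k \<ge> m" "\<And>y. y \<in> cball x r \<Longrightarrow> w k y < v y + e"
          using frequently_ex by blast
        have cwk: "continuous_on (cball x r) (\<lambda>y. w k y - \<psi> y)"
        proof (intro continuous_on_diff)
          show "continuous_on (cball x r) (w k)" using wX[of k] cS continuous_on_subset unfolding X_def by blast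
          show "continuous_on (cball x r) \<psi>" by (rule continuous_on_subset[OF c\<psi>]) (use r in auto)
        qed
        have "cball x r \<noteq> {}" using r by auto
        then obtain y where y: "y \<in> cball x r" "\<And>z. z \<in> cball x r \<Longrightarrow> w k z - \<psi> z \<le> w k y - \<psi> y"
          using continuous_attains_sup[OF compact_cball _ cwk] by blast
        have "dist x y < \<eta>'"
        proof (rule ccontr)
          assume "\<not> ?thesis"
          then have "\<eta>'\<^sup>2 \<le> (dist x y)\<^sup>2" using \<eta>' by (intro power_mono) auto
          then have "\<sigma> * \<eta>'\<^sup>2 \<le> \<sigma> * (dist x y)\<^sup>2" using \<sigma> by simp
          moreover have "v y - \<psi> y \<le> D - \<sigma> * (dist x y)\<^sup>2" by (rule strict) (use y r in auto)
          moreover have "w k y < v y + e" by (rule k(3)[OF y(1)])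
          ultimately have "w k y - \<psi> y < D - e" by (simp add: e_def)
          also have "D - e < w k x - \<psi> x" using k(1) by (simp add: D_def \<psi>_def)
          finally show False using y(2)[of x] r by simp
        qed
        then have yb: "y \<in> ball x r" "dist x y < \<eta>" using \<eta>' by auto
        have "touches_above \<psi> (w k) y"
          by (rule touches_aboveI[OF open_ball yb(1)]) (use Ck_on_subset[OF C\<psi> subset_ball[of r r1]] y r in auto)
        then show ?thesis using k(2) yb by blast
      qed
      have "\<forall>m. \<exists>k y. k \<ge> m \<and> y \<in> ball x r \<and> dist x y < 1 / real (Suc m) \<and> touches_above \<psi> (w k) y"
        using pt by simp
      then obtain k y where ky: "\<And>m. k m \<ge> m" "\<And>m. y m \<in> ball x r" "\<And>m. dist x (y m) < 1 / real (Suc m)"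
        "\<And>m. touches_above \<psi> (w (k m)) (y m)" by metis
      have le: "norm (grad \<psi> (y m)) powr p - f (y m) - \<epsilon> * laplacian \<psi> (y m) \<le> c (k m)" for m
      proof -
        have "y m \<in> S" using ky(2)[of m] cS by (meson ball_subset_cball subsetD)
        from vsubD[OF wv this ky(4)] show ?thesis .
      qed
      have "(\<lambda>m. dist x (y m)) \<longlonglongrightarrow> 0"
        by (rule tendsto_sandwich[OF _ _ tendsto_const LIMSEQ_inverse_real_of_nat])
          (use ky(3) in \<open>auto intro!: always_eventually less_imp_le simp: inverse_eq_divide\<close>)
      then have yx: "y \<longlonglongrightarrow> x" by (subst tendsto_dist_iff) (simp add: dist_commute)
      \<comment> \<open>The chosen indices need not increase; \<open>k m \<ge> m\<close> is enough
        for the limit of the constants.\<close>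
      have kk: "filterlim k sequentially sequentially"
        by (rule filterlim_at_top_mono[OF filterlim_ident]) (use ky(1) in auto)
      have ck: "(\<lambda>m. c (k m)) \<longlonglongrightarrow> c'" by (rule filterlim_compose[OF c kk])
      have cont: "(\<lambda>m. F (y m)) \<longlonglongrightarrow> F x" if "continuous_on (ball x r1) F" for F :: "'a \<Rightarrow> real"
      proof -
        have "isCont F x" using that xb by (simp add: continuous_on_eq_continuous_at)
        then show ?thesis using yx isCont_tendsto_compose by blast
      qed
      have cont': "(\<lambda>m. F (y m)) \<longlonglongrightarrow> F x" if "continuous_on (ball x r1) F" for F :: "'a \<Rightarrow> 'a"
      proof -
        have "isCont F x" using that xb by (simp add: continuous_on_eq_continuous_at)
        then show ?thesis using yx isCont_tendsto_compose by blast
      qed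
      have cg: "continuous_on (ball x r1) (grad \<psi>)"
        unfolding grad_def[abs_def] using C\<psi>
        by (intro continuous_intros) (auto simp: numeral_2_eq_2 intro!: Ck_on_imp_continuous_on[OF open_ball, of "Suc 0"])
      have "(\<lambda>m. norm (grad \<psi> (y m)) powr p) \<longlonglongrightarrow> norm (grad \<psi> x) powr p"
        by (rule tendsto_powr'[OF tendsto_norm[OF cont'[OF cg]] tendsto_const]) (use p in auto)
      from tendsto_diff[OF tendsto_diff[OF this cont[OF continuous_on_subset[OF f(1) r1(2)]]]
          tendsto_mult[OF tendsto_const[of \<epsilon>] cont[OF continuous_on_laplacian[OF C\<psi>]]]]
      have "(\<lambda>m. norm (grad \<psi> (y m)) powr p - f (y m) - \<epsilon> * laplacian \<psi> (y m)) \<longlonglongrightarrow>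
         norm (grad \<psi> x) powr p - f x - \<epsilon> * laplacian \<psi> x" .
      from LIMSEQ_le[OF this ck] have "norm (grad \<psi> x) powr p - f x - \<epsilon> * laplacian \<psi> x \<le> c'"
        using le by blast
      moreover have "grad \<psi> x = grad \<phi> x"
      proof -
        have "grad \<psi> x = grad \<phi> x + \<sigma> *\<^sub>R grad (\<lambda>y. (norm (y - x))\<^sup>2) x"
          unfolding \<psi>_def
          using Ck_on_imp_differentiable[OF r1(3) _ xb] Ck_on_imp_differentiable[OF CN _ xb]
            Ck_on_imp_differentiable[OF Ck_on_norm2[of 2 UNIV x], of x]
          by (simp add: grad_add grad_cmult)
        then show ?thesis by (simp add: grad_norm2)
      qed
      moreover have "laplacian \<psi> x = laplacian \<phi> x + \<sigma> * (2 * n)"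
        unfolding \<psi>_def
        by (subst laplacian_add[OF open_ball xb r1(3) CN], subst laplacian_cmult[OF open_UNIV UNIV_I Ck_on_norm2])
          (simp add: laplacian_norm2 n_def)
      ultimately show ?thesis by simp
    qed
    show "norm (grad \<phi> x) powr p - f x - \<epsilon> * laplacian \<phi> x \<le> c'"
    proof (rule field_le_epsilon)
      fix e :: real assume e: "e > 0"
      \<comment> \<open>This \<sigma> makes the contribution of the added quadratic exactly
        \<open>e\<close>.\<close>
      have "\<epsilon> * (e / (2 * n * \<epsilon>) * (2 * n)) = e" using n \<epsilon> by simp
      then show "norm (grad \<phi> x) powr p - f x - \<epsilon> * laplacian \<phi> x \<le> c' + e"
        using key[of "e / (2 * n * \<epsilon>)"] e n \<epsilon> by (simp add: distrib_left)
    qed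
  qed
  show ?thesis using that cv vs by blast
qed

text \<open>The \<open>LEAST\<close> in the definition is informative only if a minimum exists. The
  set of admissible constants contains \<open>B\<close>, is bounded below through a ball inside
  \<open>S\<close>, and contains its infimum by stability of subsolutions under limits.\<close>

lemma additive_eigenvalue_attained:
  fixes f :: "'a::euclidean_space \<Rightarrow> real"
  assumes p: "p > 2" and \<epsilon>: "\<epsilon> > 0" and S: "open S" "connected S" "S \<noteq> {}"
    and f: "continuous_on S f" "\<And>x. x \<in> S \<Longrightarrow> \<bar>f x\<bar> \<le> B"
    and H: "\<And>x \<xi>. H x \<xi> = norm \<xi> powr p - f x"
  shows "\<exists>u. continuous_on S u \<and> vsub (HJ_ineq p \<epsilon> f (additive_eigenvalue H \<epsilon> S)) S u"
    and "\<And>c u. continuous_on S u \<Longrightarrow> vsub (HJ_ineq p \<epsilon> f c) S u \<Longrightarrow> additive_eigenvalue H \<epsilon> S \<le> c"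
    and "additive_eigenvalue H \<epsilon> S \<le> B"
proof -
  define A where "A = {c. \<exists>u. continuous_on S u \<and> vsub (HJ_ineq p \<epsilon> f c) S u}"
  have eq: "additive_eigenvalue H \<epsilon> S = (LEAST c. c \<in> A)"
    by (simp add: additive_eigenvalue_def viscosity_subsolution_iff_vsub[OF S(1)] A_def H)
  obtain z R where z: "R > 0" "cball z R \<subseteq> S" using S by (metis open_contains_cball all_not_in_conv)
  obtain N where N: "\<And>S (u :: 'a \<Rightarrow> real) x k. open S \<Longrightarrow> continuous_on S u \<Longrightarrow> cball x R \<subseteq> S \<Longrightarrow>
      vsub (growth_ineq p \<epsilon> k) S u \<Longrightarrow> N \<le> k"
    using subsolution_constant_lower_bound[OF p \<epsilon> z(1), where 'a='a] by metis
  have lb: "N - B \<le> c" if "c \<in> A" for c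
  proof -
    obtain u where u: "continuous_on S u" "vsub (HJ_ineq p \<epsilon> f c) S u"
      using \<open>c \<in> A\<close> by (auto simp: A_def)
    have "vsub (growth_ineq p \<epsilon> (c + B)) S u"
    proof (rule vsub_mono[OF u(2)])
      fix x \<xi> l assume "x \<in> S" "norm (\<xi>::'a) powr p - f x - \<epsilon> * l \<le> c"
      then show "norm \<xi> powr p - \<epsilon> * l \<le> c + B" using f(2)[of x] by linarith
    qed
    from N[OF S(1) u(1) z(2) this] show ?thesis by simp
  qed
  have BA: "B \<in> A"
  proof -
    \<comment> \<open>A function touching 0 from above has a local minimum, so its gradient vanishes
      and its Laplacian is nonnegative.\<close>
    have "vsub (HJ_ineq p \<epsilon> f B) S (\<lambda>_. 0)"
      unfolding vsub_def
    proof (intro ballI allI impI)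
      fix x \<phi> assume x: "x \<in> S" and "touches_above \<phi> (\<lambda>_. 0) x"
      then obtain r where r: "r > 0" "Ck_on 2 (ball x r) \<phi>" "\<And>y. y \<in> ball x r \<Longrightarrow> \<phi> x \<le> \<phi> y"
        unfolding touches_above_def by auto
      have "0 \<le> \<epsilon> * laplacian \<phi> x" using second_derivative_test(2)[OF r] \<epsilon> by simp
      then show "norm (grad \<phi> x) powr p - f x - \<epsilon> * laplacian \<phi> x \<le> B"
        using second_derivative_test(1)[OF r] f(2)[OF x] by simp
    qed
    then show ?thesis unfolding A_def by (auto intro!: exI[of _ "\<lambda>_. 0"])
  qed
  have bdd: "bdd_below A" using lb by (auto simp: bdd_below_def)
  have InfA: "Inf A \<in> A"
  proof -
    have "\<exists>c\<in>A. c < Inf A + 1 / real (Suc k)" for k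
      using cInf_lessD[of A "Inf A + 1 / real (Suc k)"] BA by auto
    then obtain c where c: "\<And>k. c k \<in> A" "\<And>k. c k < Inf A + 1 / real (Suc k)" by metis
    have "\<forall>k. \<exists>u. continuous_on S u \<and> vsub (HJ_ineq p \<epsilon> f (c k)) S u"
      using c(1) by (auto simp: A_def)
    then obtain u where u: "\<And>k. continuous_on S (u k)" "\<And>k. vsub (HJ_ineq p \<epsilon> f (c k)) S (u k)"
      by metis
    have "(\<lambda>k. Inf A + inverse (real (Suc k))) \<longlonglongrightarrow> Inf A + 0"
      by (intro tendsto_intros LIMSEQ_inverse_real_of_nat)
    then have up: "(\<lambda>k. Inf A + inverse (real (Suc k))) \<longlonglongrightarrow> Inf A" by simp
    have lim: "c \<longlonglongrightarrow> Inf A"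
      by (rule tendsto_sandwich[OF _ _ tendsto_const up])
        (use c cInf_lower[OF _ bdd] in \<open>auto intro!: always_eventually less_imp_le simp: inverse_eq_divide\<close>)
    have "f x \<le> B" if "x \<in> S" for x using f(2)[OF that] by simp
    from subsolution_limit[OF p \<epsilon> S(1,2) f(1) this lim u] show ?thesis unfolding A_def by blast
  qed
  have le: "Inf A \<le> c" if "c \<in> A" for c by (rule cInf_lower[OF that bdd])
  have L: "additive_eigenvalue H \<epsilon> S = Inf A"
    unfolding eq by (rule Least_equality) (use InfA le in auto)
  show "\<exists>u. continuous_on S u \<and> vsub (HJ_ineq p \<epsilon> f (additive_eigenvalue H \<epsilon> S)) S u"
    using InfA unfolding L A_def by blast
  show "additive_eigenvalue H \<epsilon> S \<le> c"
    if "continuous_on S u" "vsub (HJ_ineq p \<epsilon> f c) S u" for c u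
    unfolding L by (rule le) (use that in \<open>auto simp: A_def\<close>)
  show "additive_eigenvalue H \<epsilon> S \<le> B" unfolding L by (rule le[OF BA])
qed

subsection \<open>One-sided derivatives of semiconvex functions\<close>

abbreviation slope :: "(real \<Rightarrow> real) \<Rightarrow> real \<Rightarrow> real \<Rightarrow> real" where
  "slope G x y \<equiv> (G y - G x) / (y - x)"

text \<open>The three-slope inequality of convexity, with a defect that becomes arbitrarily small on
  short intervals. No rate is imposed, so this is weaker than convexity after adding a
  quadratic.\<close>

definition semiconvex_on :: "real \<Rightarrow> real \<Rightarrow> (real \<Rightarrow> real) \<Rightarrow> bool" where
  "semiconvex_on a b G \<longleftrightarrow> (\<forall>\<eta>>0. \<exists>\<delta>>0. \<forall>x z y. a < x \<and> x < z \<and> z < y \<and> y < b \<and> y - x < \<delta> \<longrightarrow>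
     slope G x z \<le> slope G z y + \<eta>)"

text \<open>The slope over the whole interval is the average of the slopes over its two parts,
  weighted by their lengths.\<close>

lemma slope_convex_combination:
  fixes G :: "real \<Rightarrow> real"
  assumes "x < z" "z < y" "slope G x z \<le> slope G z y + \<eta>" "\<eta> > 0"
  shows "slope G x z \<le> slope G x y + \<eta>"
    "slope G x y \<le> slope G z y + \<eta>"
proof -
  define s where "s = slope G x z"
  define t where "t = slope G z y"
  define \<theta> where "\<theta> = (z - x) / (y - x)"
  have \<theta>: "0 < \<theta>" "\<theta> < 1" using assms by (auto simp: \<theta>_def)
  have "1 - \<theta> = (y - z) / (y - x)" using assms by (simp add: \<theta>_def field_simps)
  then have st: "slope G x y = \<theta> * s + (1 - \<theta>) * t"
    using assms by (simp add: \<theta>_def s_def t_def add_divide_distrib[symmetric])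
  have le: "s \<le> t + \<eta>" using assms by (simp add: s_def t_def)
  have "(1 - \<theta>) * s \<le> (1 - \<theta>) * (t + \<eta>)" "\<theta> * s \<le> \<theta> * (t + \<eta>)" using \<theta> le by (auto intro!: mult_left_mono)
  moreover have "0 \<le> \<theta> * \<eta>" "0 \<le> (1 - \<theta>) * \<eta>" using \<theta> assms by auto
  ultimately have "s \<le> (\<theta> * s + (1 - \<theta>) * t) + \<eta>" "\<theta> * s + (1 - \<theta>) * t \<le> t + \<eta>"
    by (auto simp: algebra_simps)
  then show "slope G x z \<le> slope G x y + \<eta>"
    "slope G x y \<le> slope G z y + \<eta>"
    unfolding st by (auto simp: s_def t_def)
qed

text \<open>Slopes from a fixed left end are increasing up to \<eta>, so their upper limit is a
  limit; the Lipschitz bound makes it finite. Right continuity follows by bounding derivatives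
  through nearby slopes (\<open>F1\<close>, \<open>F2\<close>) and by continuity of
  \<open>G\<close>.\<close>

lemma semiconvex_right_derivative:
  assumes sc: "semiconvex_on a b G" and lip: "L-lipschitz_on {a<..<b} G"
  obtains D where "\<And>t. t \<in> {a<..<b} \<Longrightarrow> (slope G t \<longlongrightarrow> D t) (at_right t)"
    "\<And>t. t \<in> {a<..<b} \<Longrightarrow> (D \<longlongrightarrow> D t) (at_right t)"
proof -
  have slopes: "\<exists>\<delta>>0. \<forall>x z y. a < x \<and> x < z \<and> z < y \<and> y < b \<and> y - x < \<delta> \<longrightarrow>
      slope G x z \<le> slope G z y + \<eta> \<and>
      slope G x z \<le> slope G x y + \<eta> \<and>
      slope G x y \<le> slope G z y + \<eta>" if \<eta>: "\<eta> > 0" for \<eta>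
  proof -
    obtain \<delta> where \<delta>: "\<delta> > 0" "\<And>x z y. a < x \<Longrightarrow> x < z \<Longrightarrow> z < y \<Longrightarrow> y < b \<Longrightarrow> y - x < \<delta> \<Longrightarrow>
      slope G x z \<le> slope G z y + \<eta>"
      using sc \<eta> unfolding semiconvex_on_def by meson
    show ?thesis
      by (intro exI[of _ \<delta>] conjI allI impI \<delta>(1); elim conjE)
        (use \<delta>(2) slope_convex_combination \<eta> in blast)+
  qed
  have bnd: "\<bar>slope G t y\<bar> \<le> L" if "t \<in> {a<..<b}" "y \<in> {a<..<b}" "y \<noteq> t" for t y
    using lipschitz_onD[OF lip that(2,1)] that(3) by (simp add: dist_real_def field_simps)
  have evI: "\<forall>\<^sub>F y in at_right t. t < y \<and> y < min b (t + \<delta>)" if "t \<in> {a<..<b}" "\<delta> > 0" for t \<delta>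
    using eventually_at_right_real[of t "min b (t + \<delta>)"] that by (auto elim!: eventually_mono)
  have ex: "\<exists>l. (slope G t \<longlongrightarrow> l) (at_right t)" if t: "t \<in> {a<..<b}" for t
  proof -
    let ?q = "slope G t"
    have "\<forall>\<^sub>F y in at_right t. \<bar>?q y\<bar> \<le> L"
      using evI[OF t zero_less_one] by eventually_elim (rule bnd[OF t], use t in auto)
    from real_limsup_exists[OF trivial_limit_at_right_real this]
    obtain l where l: "\<And>e. e > 0 \<Longrightarrow> \<forall>\<^sub>F y in at_right t. ?q y < l + e"
      "\<And>e. e > 0 \<Longrightarrow> \<exists>\<^sub>F y in at_right t. ?q y > l - e" by blast
    have "(?q \<longlongrightarrow> l) (at_right t)"
    proof (rule order_tendstoI)
      fix u assume "l < u"
      then show "\<forall>\<^sub>F y in at_right t. ?q y < u" using l(1)[of "u - l"] by simp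
    next
      fix u assume u: "u < l"
      define \<eta> where "\<eta> = (l - u) / 2"
      have \<eta>: "\<eta> > 0" using u by (simp add: \<eta>_def)
      obtain \<delta> where \<delta>: "\<delta> > 0" "\<And>x z y. a < x \<Longrightarrow> x < z \<Longrightarrow> z < y \<Longrightarrow> y < b \<Longrightarrow> y - x < \<delta> \<Longrightarrow>
        slope G x z \<le> slope G x y + \<eta>" using slopes[OF \<eta>] by meson
      show "\<forall>\<^sub>F y in at_right t. u < ?q y"
        using evI[OF t \<delta>(1)]
      proof eventually_elim
        case (elim y)
        have "\<forall>\<^sub>F z in at_right t. t < z \<and> z < y"
          using eventually_at_right_real[of t y] elim by (auto elim!: eventually_mono)
        \<comment> \<open>The upper limit supplies a point \<open>z\<close> arbitrarily close to
          \<open>t\<close> with a large slope; near-monotonicity carries this bound to every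
          \<open>y\<close> beyond it.\<close>
        from frequently_ex[OF frequently_eventually_frequently[OF l(2)[OF \<eta>] this]]
        obtain z where z: "?q z > l - \<eta>" "t < z" "z < y" by blast
        have "?q z \<le> ?q y + \<eta>" by (rule \<delta>(2)) (use t z elim in auto)
        moreover have "l - 2 * \<eta> = u" by (simp add: \<eta>_def field_simps)
        ultimately show "u < ?q y" using z(1) by linarith
      qed
    qed
    then show ?thesis by blast
  qed
  then obtain D where D: "\<And>t. t \<in> {a<..<b} \<Longrightarrow> (slope G t \<longlongrightarrow> D t) (at_right t)"
    by metis
  have cont: "(D \<longlongrightarrow> D t) (at_right t)" if t: "t \<in> {a<..<b}" for t
  proof (rule tendstoI)
    fix e :: real assume e: "e > 0"
    define \<eta> where "\<eta> = e / 4"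
    have \<eta>: "\<eta> > 0" using e by (simp add: \<eta>_def)
    obtain \<delta> where \<delta>: "\<delta> > 0" and s1: "\<And>x z y. a < x \<Longrightarrow> x < z \<Longrightarrow> z < y \<Longrightarrow> y < b \<Longrightarrow> y - x < \<delta> \<Longrightarrow>
        slope G x z \<le> slope G z y + \<eta>"
      and s2: "\<And>x z y. a < x \<Longrightarrow> x < z \<Longrightarrow> z < y \<Longrightarrow> y < b \<Longrightarrow> y - x < \<delta> \<Longrightarrow>
        slope G x z \<le> slope G x y + \<eta>" using slopes[OF \<eta>] by meson
    have F1: "D x \<le> slope G x y + \<eta>" if "a < x" "x < y" "y < b" "y - x < \<delta>" for x y
    proof (rule tendsto_upperbound[OF D])
      have "\<forall>\<^sub>F z in at_right x. x < z \<and> z < min b (x + (y - x))" using that by (intro evI) auto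
      then show "\<forall>\<^sub>F z in at_right x. slope G x z \<le> slope G x y + \<eta>"
        by eventually_elim (rule s2, use that in auto)
    qed (use that in auto)
    have F2: "slope G x y - \<eta> \<le> D y" if "a < x" "x < y" "y < b" "y - x < \<delta>" for x y
    proof (rule tendsto_lowerbound[OF D])
      have "\<forall>\<^sub>F z in at_right y. y < z \<and> z < min b (y + (\<delta> - (y - x)))" using that by (intro evI) auto
      then show "\<forall>\<^sub>F z in at_right y. slope G x y - \<eta> \<le> slope G y z"
      proof eventually_elim
        case (elim z)
        have "slope G x y \<le> slope G y z + \<eta>" by (rule s1) (use that elim in auto)
        then show ?case by simp
      qed
    qed (use that in auto)
    \<comment> \<open>The right end \<open>z\<close> is fixed before the left end \<open>y\<close>
      tends to \<open>t\<close>, so continuity of \<open>G\<close> controls the slope from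
      \<open>y\<close> to \<open>z\<close> and, through \<open>F1\<close>, the derivative at
      \<open>y\<close>.\<close>
    have "\<forall>\<^sub>F z in at_right t. slope G t z < D t + \<eta>"
      using order_tendstoD(2)[OF D[OF t]] \<eta> by simp
    then have "\<forall>\<^sub>F z in at_right t. slope G t z < D t + \<eta> \<and> (t < z \<and> z < min b (t + \<delta>))"
      by (rule eventually_conj) (rule evI[OF t \<delta>])
    then obtain z where z: "slope G t z < D t + \<eta>" "t < z" "z < b" "z < t + \<delta>"
      using eventually_happens'[OF trivial_limit_at_right_real] by (metis (no_types, lifting) min_less_iff_conj)
    have "continuous_on {a<..<b} G" by (rule lipschitz_on_continuous_on[OF lip])
    then have "isCont G t" using t by (simp add: continuous_on_eq_continuous_at)
    then have "(G \<longlongrightarrow> G t) (at_right t)" by (simp add: continuous_at filterlim_at_split)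
    then have "((\<lambda>y. slope G y z) \<longlongrightarrow> slope G t z) (at_right t)"
      using z by (intro tendsto_intros) auto
    then have "\<forall>\<^sub>F y in at_right t. slope G y z < D t + \<eta>"
      using order_tendstoD(2) z(1) by blast
    moreover have "\<forall>\<^sub>F y in at_right t. t < y \<and> y < min b (t + (z - t))" using z by (intro evI t) auto
    ultimately show "\<forall>\<^sub>F y in at_right t. dist (D y) (D t) < e"
    proof eventually_elim
      case (elim y)
      have 1: "D y \<le> slope G y z + \<eta>" by (rule F1) (use elim t z in auto)
      have 2: "D t \<le> slope G t y + \<eta>" by (rule F1) (use elim t z in auto)
      have 3: "slope G t y - \<eta> \<le> D y" by (rule F2) (use elim t z in auto)
      have "D y < D t + 2 * \<eta>" "D t \<le> D y + 2 * \<eta>" using 1 2 3 elim by auto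
      then show ?case using e by (auto simp: dist_real_def \<eta>_def abs_if)
    qed
  qed
  show ?thesis using that D cont by blast
qed

lemma tendsto_right_difference_quotient:
  fixes c :: "real \<Rightarrow> real"
  shows "((\<lambda>h. (c (t + h) - c t) / h) \<longlongrightarrow> l) (at_right 0) \<longleftrightarrow> ((\<lambda>y. (c y - c t) / (y - t)) \<longlongrightarrow> l) (at_right t)"
  by (subst (2) at_right_to_0) (simp add: filterlim_filtermap add.commute)

text \<open>Semiconvexity is available only for the product with the weight; the quotient rule for
  one-sided derivatives, with a weight of class C^1, carries both conclusions over to
  \<open>c\<close>.\<close>

lemma weighted_semiconvex_right_deriv:
  assumes sc: "semiconvex_on a b (\<lambda>t. w t * c t)" and lip: "L-lipschitz_on {a<..<b} (\<lambda>t. w t * c t)"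
    and w: "\<And>t. t \<in> {a<..<b} \<Longrightarrow> w t > 0" "\<And>t. t \<in> {a<..<b} \<Longrightarrow> (w has_real_derivative w' t) (at t)"
      "continuous_on {a<..<b} w'"
    and t: "t \<in> {a<..<b}"
  shows "\<exists>l. ((\<lambda>h. (c (t + h) - c t) / h) \<longlongrightarrow> l) (at_right 0)"
    and "(right_deriv c \<longlongrightarrow> right_deriv c t) (at_right t)"
proof -
  let ?G = "\<lambda>t. w t * c t"
  obtain D where D: "\<And>t. t \<in> {a<..<b} \<Longrightarrow> ((\<lambda>y. (?G y - ?G t) / (y - t)) \<longlongrightarrow> D t) (at_right t)"
    "\<And>t. t \<in> {a<..<b} \<Longrightarrow> (D \<longlongrightarrow> D t) (at_right t)"
    using semiconvex_right_derivative[OF sc lip] by blast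
  define E where "E t = (D t * w t - ?G t * w' t) / (w t * w t)" for t
  have lim: "((\<lambda>h. (c (t + h) - c t) / h) \<longlongrightarrow> E t) (at_right 0)" if t: "t \<in> {a<..<b}" for t
  proof -
    have "(?G has_real_derivative D t) (at t within {t<..})"
      using D(1)[OF t] by (simp add: has_field_derivative_iff)
    moreover have "(w has_real_derivative w' t) (at t within {t<..})"
      by (rule has_field_derivative_at_within[OF w(2)[OF t]])
    ultimately have "((\<lambda>y. ?G y / w y) has_real_derivative E t) (at t within {t<..})"
      unfolding E_def using w(1)[OF t] by (intro DERIV_quotient[THEN DERIV_cong]) (auto simp: power2_eq_square)
    then have "((\<lambda>y. (?G y / w y - ?G t / w t) / (y - t)) \<longlongrightarrow> E t) (at_right t)"
      by (simp add: has_field_derivative_iff)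
    moreover have "\<forall>\<^sub>F y in at_right t. (?G y / w y - ?G t / w t) / (y - t) = (c y - c t) / (y - t)"
    proof -
      have "\<forall>\<^sub>F y in at_right t. y \<in> {t<..<b}" using t by (intro eventually_at_right_real) auto
      then show ?thesis
      proof eventually_elim
        case (elim y)
        then have "w y > 0" "w t > 0" using w(1) t by auto
        then show ?case by simp
      qed
    qed
    ultimately have "((\<lambda>y. (c y - c t) / (y - t)) \<longlongrightarrow> E t) (at_right t)"
      by (rule Lim_transform_eventually)
    then show ?thesis by (simp add: tendsto_right_difference_quotient)
  qed
  show "\<exists>l. ((\<lambda>h. (c (t + h) - c t) / h) \<longlongrightarrow> l) (at_right 0)" using lim[OF t] by blast
  have rd: "right_deriv c t = E t" if "t \<in> {a<..<b}" for t
    unfolding right_deriv_def by (rule tendsto_Lim[OF _ lim[OF that]]) simp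
  have r: "(F \<longlongrightarrow> F t) (at_right t)" if "continuous_on {a<..<b} F" for F :: "real \<Rightarrow> real"
  proof -
    have "isCont F t" using that t by (simp add: continuous_on_eq_continuous_at)
    then show ?thesis by (simp add: continuous_at filterlim_at_split)
  qed
  have "continuous_on {a<..<b} w"
    using w(2) DERIV_isCont by (intro continuous_at_imp_continuous_on) blast
  then have "(E \<longlongrightarrow> E t) (at_right t)"
    unfolding E_def using w(1)[OF t]
    by (intro tendsto_intros D(2) t r w(3) lipschitz_on_continuous_on[OF lip]) auto
  moreover have "\<forall>\<^sub>F y in at_right t. E y = right_deriv c y"
  proof -
    have "\<forall>\<^sub>F y in at_right t. y \<in> {t<..<b}" using t by (intro eventually_at_right_real) auto
    then show ?thesis by eventually_elim (use rd t in auto)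
  qed
  ultimately have "(right_deriv c \<longlongrightarrow> E t) (at_right t)" by (rule Lim_transform_eventually)
  then show "(right_deriv c \<longlongrightarrow> right_deriv c t) (at_right t)" using rd[OF t] by simp
qed

text \<open>The double negations are kept so that the right side is literally a right difference
  quotient of the reflected function at \<open>- t\<close>.\<close>

lemma tendsto_left_difference_quotient:
  fixes c :: "real \<Rightarrow> real"
  shows "((\<lambda>h. (c (t + h) - c t) / h) \<longlongrightarrow> l) (at_left 0) \<longleftrightarrow>
    ((\<lambda>h. (c (- (- t + h)) - c (- (- t))) / h) \<longlongrightarrow> - l) (at_right 0)"
proof -
  have "((\<lambda>h. (c (t + h) - c t) / h) \<longlongrightarrow> l) (at_left 0)
    \<longleftrightarrow> ((\<lambda>h. (c (t - h) - c t) / - h) \<longlongrightarrow> l) (at_right 0)"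
    by (subst at_left_minus) (simp add: filterlim_filtermap)
  also have "\<dots> \<longleftrightarrow> ((\<lambda>h. - ((c (t - h) - c t) / - h)) \<longlongrightarrow> - l) (at_right 0)"
    using tendsto_minus_cancel_left[of "\<lambda>h. (c (t - h) - c t) / - h" "- l"] by simp
  finally show ?thesis by simp
qed

text \<open>Reflection exchanges the two slopes and changes their signs, so the inequality persists.
  Statements about left derivatives thereby reduce to those about right derivatives.\<close>

lemma semiconvex_on_reflect:
  assumes "semiconvex_on a b G" shows "semiconvex_on (- b) (- a) (\<lambda>t. G (- t))"
  unfolding semiconvex_on_def
proof (intro allI impI)
  fix \<eta> :: real assume "\<eta> > 0"
  then obtain \<delta> where \<delta>: "\<delta> > 0" "\<And>x z y. a < x \<Longrightarrow> x < z \<Longrightarrow> z < y \<Longrightarrow> y < b \<Longrightarrow> y - x < \<delta> \<Longrightarrow>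
      slope G x z \<le> slope G z y + \<eta>"
    using assms unfolding semiconvex_on_def by meson
  show "\<exists>\<delta>>0. \<forall>x z y. - b < x \<and> x < z \<and> z < y \<and> y < - a \<and> y - x < \<delta> \<longrightarrow>
     (G (- z) - G (- x)) / (z - x) \<le> (G (- y) - G (- z)) / (y - z) + \<eta>"
  proof (intro exI[of _ \<delta>] conjI allI impI \<delta>(1))
    fix x z y assume *: "- b < x \<and> x < z \<and> z < y \<and> y < - a \<and> y - x < \<delta>"
    then have "(G (- z) - G (- y)) / (- z - - y) \<le> (G (- x) - G (- z)) / (- x - - z) + \<eta>"
      by (intro \<delta>(2)) auto
    moreover have neg: "(p - q) / (- v - - u) = - ((q - p) / (u - v))" for p q u v :: real
      using minus_divide_left[of "q - p" "u - v"] by simp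
    have "(G (- z) - G (- y)) / (- z - - y) = - ((G (- y) - G (- z)) / (y - z))"
      "(G (- x) - G (- z)) / (- x - - z) = - ((G (- z) - G (- x)) / (z - x))" by (rule neg)+
    ultimately show "(G (- z) - G (- x)) / (z - x) \<le> (G (- y) - G (- z)) / (y - z) + \<eta>" by linarith
  qed
qed

lemma weighted_semiconvex_left_deriv:
  assumes sc: "semiconvex_on a b (\<lambda>t. w t * c t)" and lip: "L-lipschitz_on {a<..<b} (\<lambda>t. w t * c t)"
    and w: "\<And>t. t \<in> {a<..<b} \<Longrightarrow> w t > 0" "\<And>t. t \<in> {a<..<b} \<Longrightarrow> (w has_real_derivative w' t) (at t)"
      "continuous_on {a<..<b} w'"
    and t: "t \<in> {a<..<b}"
  shows "\<exists>l. ((\<lambda>h. (c (t + h) - c t) / h) \<longlongrightarrow> l) (at_left 0)"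
    and "(left_deriv c \<longlongrightarrow> left_deriv c t) (at_left t)"
proof -
  let ?c = "\<lambda>t. c (- t)"
  have lip': "L-lipschitz_on {- b<..<- a} (\<lambda>t. w (- t) * c (- t))"
  proof (rule lipschitz_onI)
    fix x y assume "x \<in> {- b<..<- a}" "y \<in> {- b<..<- a}"
    then show "dist (w (- x) * c (- x)) (w (- y) * c (- y)) \<le> L * dist x y"
      using lipschitz_onD[OF lip, of "- x" "- y"] by (simp add: dist_minus)
  qed (rule lipschitz_on_nonneg[OF lip])
  have w1: "w (- t) > 0" if "t \<in> {- b<..<- a}" for t using w(1) that by auto
  have w2: "((\<lambda>t. w (- t)) has_real_derivative - w' (- t)) (at t)" if "t \<in> {- b<..<- a}" for t
    using DERIV_mirror[of w "w' (- t)" t] w(2)[of "- t"] that by simp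
  have w3: "continuous_on {- b<..<- a} (\<lambda>t. - w' (- t))"
    by (intro continuous_on_minus continuous_on_compose2[OF w(3)]) (auto intro!: continuous_intros)
  note R = weighted_semiconvex_right_deriv[OF semiconvex_on_reflect[OF sc] lip' w1 w2 w3]
  have ex: "\<exists>l. ((\<lambda>h. (c (t + h) - c t) / h) \<longlongrightarrow> l) (at_left 0) \<and> left_deriv c t = - right_deriv ?c (- t)"
    if t: "t \<in> {a<..<b}" for t
  proof -
    have mt: "- t \<in> {- b<..<- a}" using t by simp
    obtain l where l: "((\<lambda>h. (?c (- t + h) - ?c (- t)) / h) \<longlongrightarrow> - (- l)) (at_right 0)"
      using R(1)[OF _ _ mt] by auto
    then have 1: "((\<lambda>h. (c (t + h) - c t) / h) \<longlongrightarrow> - l) (at_left 0)"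
      unfolding tendsto_left_difference_quotient .
    have "left_deriv c t = - l"
      unfolding left_deriv_def by (rule tendsto_Lim[OF _ 1]) simp
    moreover have "right_deriv ?c (- t) = l"
      unfolding right_deriv_def by (rule tendsto_Lim) (use l in simp_all)
    ultimately show ?thesis using 1 by auto
  qed
  show "\<exists>l. ((\<lambda>h. (c (t + h) - c t) / h) \<longlongrightarrow> l) (at_left 0)" using ex[OF t] by blast
  have "- t \<in> {- b<..<- a}" using t by simp
  then have "(right_deriv ?c \<longlongrightarrow> right_deriv ?c (- t)) (at_right (- t))" by (intro R(2)) auto
  then have "((\<lambda>y. - right_deriv ?c (- y)) \<longlongrightarrow> - right_deriv ?c (- t)) (at_left t)"
    by (subst at_left_minus) (auto simp: filterlim_filtermap intro: tendsto_minus)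
  moreover have "\<forall>\<^sub>F y in at_left t. - right_deriv ?c (- y) = left_deriv c y"
  proof -
    have "\<forall>\<^sub>F y in at_left t. y \<in> {a<..<t}" using t by (intro eventually_at_left_real) auto
    then show ?thesis by eventually_elim (use ex t in auto)
  qed
  ultimately have "(left_deriv c \<longlongrightarrow> - right_deriv ?c (- t)) (at_left t)" by (rule Lim_transform_eventually)
  then show "(left_deriv c \<longlongrightarrow> left_deriv c t) (at_left t)" using ex[OF t] by simp
qed

text \<open>For a rational \<open>q\<close> strictly between the one-sided derivatives,
  \<open>t\<close> is the unique strict minimum of \<open>c y - q * y\<close> on some interval with
  rational end points. Each triple of rationals accounts for at most one such \<open>t\<close>; no
  convexity enters.\<close>

lemma countable_left_less_right:
  fixes c :: "real \<Rightarrow> real"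
  shows "countable {t. \<exists>l r. ((\<lambda>h. (c (t + h) - c t) / h) \<longlongrightarrow> l) (at_left 0) \<and>
     ((\<lambda>h. (c (t + h) - c t) / h) \<longlongrightarrow> r) (at_right 0) \<and> l < r}" (is "countable ?A")
proof -
  define T where "T q a b = {x. a < x \<and> x < b \<and> (\<forall>y. a < y \<and> y < b \<and> y \<noteq> x \<longrightarrow> c x - q * x < c y - q * y)}" for q a b
  have "countable (T q a b)" for q a b
  proof (cases "T q a b = {}")
    case False
    then obtain x where x: "x \<in> T q a b" by blast
    have "T q a b \<subseteq> {x}"
    proof
      fix y assume y: "y \<in> T q a b"
      show "y \<in> {x}"
      proof (rule ccontr)
        assume "y \<notin> {x}"
        then have "c x - q * x < c y - q * y" "c y - q * y < c x - q * x"
          using x y by (auto simp: T_def)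
        then show False by simp
      qed
    qed
    then show ?thesis by (meson countable_finite finite.emptyI finite.insertI finite_subset)
  qed simp
  then have "countable (\<Union>q\<in>\<rat>. \<Union>a\<in>\<rat>. \<Union>b\<in>\<rat>. T q a b)"
    by (intro countable_UN countable_rat)
  moreover have "?A \<subseteq> (\<Union>q\<in>\<rat>. \<Union>a\<in>\<rat>. \<Union>b\<in>\<rat>. T q a b)"
  proof
    fix t assume "t \<in> ?A"
    then obtain l r where l: "((\<lambda>h. (c (t + h) - c t) / h) \<longlongrightarrow> l) (at_left 0)"
      and r: "((\<lambda>h. (c (t + h) - c t) / h) \<longlongrightarrow> r) (at_right 0)" and "l < r" by blast
    obtain q where q: "q \<in> \<rat>" "l < q" "q < r" using Rats_dense_in_real[OF \<open>l < r\<close>] by blast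
    obtain d1 where d1: "d1 < 0" "\<And>h. d1 < h \<Longrightarrow> h < 0 \<Longrightarrow> (c (t + h) - c t) / h < q"
      using order_tendstoD(2)[OF l q(2)] unfolding eventually_at_left_field by blast
    obtain d2 where d2: "d2 > 0" "\<And>h. 0 < h \<Longrightarrow> h < d2 \<Longrightarrow> q < (c (t + h) - c t) / h"
      using order_tendstoD(1)[OF r q(3)] unfolding eventually_at_right_field by blast
    obtain a where a: "a \<in> \<rat>" "t + d1 < a" "a < t" using Rats_dense_in_real[of "t + d1" t] d1 by auto
    obtain b where b: "b \<in> \<rat>" "t < b" "b < t + d2" using Rats_dense_in_real[of t "t + d2"] d2 by auto
    have "c t - q * t < c y - q * y" if y: "a < y" "y < b" "y \<noteq> t" for y
    proof (cases "y < t")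
      case True
      then have "(c (t + (y - t)) - c t) / (y - t) < q" using a y by (intro d1(2)) auto
      then show ?thesis using True by (simp add: neg_divide_less_eq algebra_simps)
    next
      case False
      then have "q < (c (t + (y - t)) - c t) / (y - t)" using b y by (intro d2(2)) auto
      then show ?thesis using False y by (simp add: pos_less_divide_eq algebra_simps)
    qed
    then have "t \<in> T q a b" using a b by (auto simp: T_def)
    then show "t \<in> (\<Union>q\<in>\<rat>. \<Union>a\<in>\<rat>. \<Union>b\<in>\<rat>. T q a b)" using q(1) a(1) b(1) by blast
  qed
  ultimately show ?thesis by (rule countable_subset[rotated])
qed

text \<open>Where the one-sided derivatives differ, either the left one is smaller or this holds for
  \<open>- c\<close>.\<close>

lemma countable_not_differentiable:
  fixes c :: "real \<Rightarrow> real"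
  assumes "\<And>t. t \<in> I \<Longrightarrow> \<exists>l. ((\<lambda>h. (c (t + h) - c t) / h) \<longlongrightarrow> l) (at_left 0)"
    "\<And>t. t \<in> I \<Longrightarrow> \<exists>r. ((\<lambda>h. (c (t + h) - c t) / h) \<longlongrightarrow> r) (at_right 0)"
  shows "countable {t \<in> I. \<not> c differentiable (at t)}"
proof (rule countable_subset[OF _ countable_Un[OF countable_left_less_right[of c] countable_left_less_right[of "\<lambda>t. - c t"]]], rule subsetI)
  fix t assume t: "t \<in> {t \<in> I. \<not> c differentiable (at t)}"
  obtain l where l: "((\<lambda>h. (c (t + h) - c t) / h) \<longlongrightarrow> l) (at_left 0)" using assms(1) t by blast
  obtain r where r: "((\<lambda>h. (c (t + h) - c t) / h) \<longlongrightarrow> r) (at_right 0)" using assms(2) t by blast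
  have "l \<noteq> r"
  proof
    assume "l = r"
    then have "(c has_real_derivative l) (at t)"
      using l r unfolding DERIV_def by (simp add: filterlim_at_split)
    then show False using t by (auto simp: real_differentiable_def)
  qed
  moreover have eq: "(- c (t + h) - - c t) / h = - ((c (t + h) - c t) / h)" for h
    using minus_divide_left[of "c (t + h) - c t" h] by simp
  have "((\<lambda>h. (- c (t + h) - - c t) / h) \<longlongrightarrow> - l) (at_left 0)"
    "((\<lambda>h. (- c (t + h) - - c t) / h) \<longlongrightarrow> - r) (at_right 0)"
    unfolding eq by (rule tendsto_minus[OF l] tendsto_minus[OF r])+
  ultimately show "t \<in> {t. \<exists>l r. ((\<lambda>h. (c (t + h) - c t) / h) \<longlongrightarrow> l) (at_left 0) \<and>
     ((\<lambda>h. (c (t + h) - c t) / h) \<longlongrightarrow> r) (at_right 0) \<and> l < r} \<union>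
     {t. \<exists>l r. ((\<lambda>h. (- c (t + h) - - c t) / h) \<longlongrightarrow> l) (at_left 0) \<and>
     ((\<lambda>h. (- c (t + h) - - c t) / h) \<longlongrightarrow> r) (at_right 0) \<and> l < r}"
    using l r by (cases "l < r") (blast, simp only: Un_iff mem_Collect_eq, intro disjI2 exI conjI, assumption+, linarith)
qed

subsection \<open>Dilations of the domain\<close>

lemma vsub_rescale:
  fixes u :: "'a::euclidean_space \<Rightarrow> real"
  assumes S: "open S" and \<mu>: "\<mu> > 0" and sub: "vsub P ((\<lambda>y. \<mu> *\<^sub>R y) ` S) u"
  shows "vsub (\<lambda>x \<xi> l. P (\<mu> *\<^sub>R x) (\<xi> /\<^sub>R \<mu>) (l / \<mu>\<^sup>2)) S (\<lambda>x. u (\<mu> *\<^sub>R x))"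
  unfolding vsub_def
proof (intro ballI allI impI)
  fix x \<phi> assume x: "x \<in> S" and t: "touches_above \<phi> (\<lambda>x. u (\<mu> *\<^sub>R x)) x"
  obtain r where r: "r > 0" "ball x r \<subseteq> S" "Ck_on 2 (ball x r) \<phi>"
    "\<And>y. y \<in> ball x r \<Longrightarrow> u (\<mu> *\<^sub>R y) - \<phi> y \<le> u (\<mu> *\<^sub>R x) - \<phi> x"
    using touches_aboveE[OF t S x] by metis
  \<comment> \<open>The summand 0 only gives the map the form \<open>a + s *\<^sub>R y\<close>
    required by the affine rules.\<close>
  define V where "V = {y. 0 + (1 / \<mu>) *\<^sub>R y \<in> ball x r}"
  define \<psi> where "\<psi> y = \<phi> (0 + (1 / \<mu>) *\<^sub>R y)" for y
  have V: "open V"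
    unfolding V_def using continuous_open_vimage[OF open_ball, of "\<lambda>y. 0 + (1 / \<mu>) *\<^sub>R y" x r]
    by (auto simp: vimage_def intro!: continuous_intros)
  have xb: "0 + (1 / \<mu>) *\<^sub>R (\<mu> *\<^sub>R x) = x" using \<mu> by simp
  have xV: "\<mu> *\<^sub>R x \<in> V" using r(1) \<mu> by (simp add: V_def)
  have "touches_above \<psi> u (\<mu> *\<^sub>R x)"
  proof (rule touches_aboveI[OF V xV])
    show "Ck_on 2 V \<psi>" unfolding V_def \<psi>_def by (rule Ck_on_affine[OF open_ball r(3)])
    fix y assume "y \<in> V"
    then have "u (\<mu> *\<^sub>R ((1 / \<mu>) *\<^sub>R y)) - \<phi> ((1 / \<mu>) *\<^sub>R y) \<le> u (\<mu> *\<^sub>R x) - \<phi> x"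
      by (intro r(4)) (simp add: V_def)
    then show "u y - \<psi> y \<le> u (\<mu> *\<^sub>R x) - \<psi> (\<mu> *\<^sub>R x)" using \<mu> by (simp add: \<psi>_def)
  qed
  from vsubD[OF sub _ this] have "P (\<mu> *\<^sub>R x) (grad \<psi> (\<mu> *\<^sub>R x)) (laplacian \<psi> (\<mu> *\<^sub>R x))" using x by blast
  moreover have "grad \<psi> (\<mu> *\<^sub>R x) = grad \<phi> x /\<^sub>R \<mu>"
    unfolding \<psi>_def using Ck_on_imp_differentiable[OF r(3), of x] r(1)
    by (subst grad_affine) (simp_all only: xb, simp_all add: inverse_eq_divide)
  moreover have "laplacian \<psi> (\<mu> *\<^sub>R x) = laplacian \<phi> x / \<mu>\<^sup>2"
    unfolding \<psi>_def using r(1)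
    by (subst laplacian_affine[OF open_ball _ r(3)]) (simp_all only: xb, simp_all add: power_one_over)
  ultimately show "P (\<mu> *\<^sub>R x) (grad \<phi> x /\<^sub>R \<mu>) (laplacian \<phi> x / \<mu>\<^sup>2)" by simp
qed

text \<open>On the fixed domain, and after multiplication by the square of \<open>\<mu>\<close>, the Hamiltonian is
  jointly convex in \<open>\<mu>\<close> and \<open>\<xi>\<close>.\<close>
lemma rescaled_subsolution_iff:
  fixes f :: "'a::euclidean_space \<Rightarrow> real"
  assumes S: "open S" and \<mu>: "\<mu> > 0"
  shows "(\<exists>u. continuous_on ((\<lambda>y. \<mu> *\<^sub>R y) ` S) u \<and>
      vsub (HJ_ineq p \<epsilon> f k) ((\<lambda>y. \<mu> *\<^sub>R y) ` S) u) \<longleftrightarrow>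
    (\<exists>v. continuous_on S v \<and>
      vsub (\<lambda>x \<xi> l. \<mu> powr (2 - p) * norm \<xi> powr p - \<epsilon> * l \<le> \<mu>\<^sup>2 * k + \<mu>\<^sup>2 * f (\<mu> *\<^sub>R x)) S v)"
    (is "?A \<longleftrightarrow> ?B")
proof
  have pw: "\<mu>\<^sup>2 * norm (\<xi> /\<^sub>R \<mu>) powr p = \<mu> powr (2 - p) * norm \<xi> powr p" for \<xi> :: 'a
  proof -
    have "norm (\<xi> /\<^sub>R \<mu>) powr p = norm \<xi> powr p / \<mu> powr p"
      using \<mu> by (simp add: powr_divide divide_inverse_commute[symmetric])
    moreover have "\<mu> powr (2 - p) = \<mu>\<^sup>2 / \<mu> powr p" using \<mu> by (simp add: powr_diff powr_numeral)
    ultimately show ?thesis by simp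
  qed
  {
    assume ?A
    then obtain u where u: "continuous_on ((\<lambda>y. \<mu> *\<^sub>R y) ` S) u"
      "vsub (HJ_ineq p \<epsilon> f k) ((\<lambda>y. \<mu> *\<^sub>R y) ` S) u" by blast
    have "continuous_on S (\<lambda>x. u (\<mu> *\<^sub>R x))"
      by (rule continuous_on_compose2[OF u(1)]) (auto intro!: continuous_intros)
    moreover have "vsub (\<lambda>x \<xi> l. \<mu> powr (2 - p) * norm \<xi> powr p - \<epsilon> * l \<le> \<mu>\<^sup>2 * k + \<mu>\<^sup>2 * f (\<mu> *\<^sub>R x)) S (\<lambda>x. u (\<mu> *\<^sub>R x))"
    proof (rule vsub_mono[OF vsub_rescale[OF S \<mu> u(2)]])
      fix x \<xi> :: 'a and l :: real
      assume "norm (\<xi> /\<^sub>R \<mu>) powr p - f (\<mu> *\<^sub>R x) - \<epsilon> * (l / \<mu>\<^sup>2) \<le> k"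
      then have "\<mu>\<^sup>2 * (norm (\<xi> /\<^sub>R \<mu>) powr p - f (\<mu> *\<^sub>R x) - \<epsilon> * (l / \<mu>\<^sup>2)) \<le> \<mu>\<^sup>2 * k"
        by (intro mult_left_mono) auto
      moreover have "\<mu>\<^sup>2 * (norm (\<xi> /\<^sub>R \<mu>) powr p - f (\<mu> *\<^sub>R x) - \<epsilon> * (l / \<mu>\<^sup>2))
        = \<mu>\<^sup>2 * norm (\<xi> /\<^sub>R \<mu>) powr p - \<mu>\<^sup>2 * f (\<mu> *\<^sub>R x) - \<epsilon> * l"
        using \<mu> by (simp only: right_diff_distrib) simp
      ultimately show "\<mu> powr (2 - p) * norm \<xi> powr p - \<epsilon> * l \<le> \<mu>\<^sup>2 * k + \<mu>\<^sup>2 * f (\<mu> *\<^sub>R x)"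
        unfolding pw by linarith
    qed
    ultimately show ?B by blast
  next
    assume ?B
    then obtain v where v: "continuous_on S v"
      "vsub (\<lambda>x \<xi> l. \<mu> powr (2 - p) * norm \<xi> powr p - \<epsilon> * l \<le> \<mu>\<^sup>2 * k + \<mu>\<^sup>2 * f (\<mu> *\<^sub>R x)) S v" by blast
    let ?S = "(\<lambda>y. \<mu> *\<^sub>R y) ` S"
    have S': "open ?S" using open_scaling[OF _ S, of \<mu>] \<mu> by simp
    \<comment> \<open>The converse is the same rescaling with factor \<open>1 / \<mu>\<close>, once
      \<open>S\<close> is written as a dilation of its own dilation.\<close>
    have S_eq: "S = (\<lambda>y. (1 / \<mu>) *\<^sub>R y) ` ?S" using \<mu> by (auto simp: image_image)
    have v2: "vsub (\<lambda>x \<xi> l. \<mu> powr (2 - p) * norm \<xi> powr p - \<epsilon> * l \<le> \<mu>\<^sup>2 * k + \<mu>\<^sup>2 * f (\<mu> *\<^sub>R x))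
        ((\<lambda>y. (1 / \<mu>) *\<^sub>R y) ` ?S) v"
      by (rule back_subst[of "\<lambda>S. vsub _ S v", OF v(2) S_eq])
    have \<mu>': "1 / \<mu> > 0" using \<mu> by simp
    have "continuous_on ?S (\<lambda>x. v ((1 / \<mu>) *\<^sub>R x))"
      by (rule continuous_on_compose2[OF v(1)]) (use \<mu> in \<open>auto intro!: continuous_intros\<close>)
    moreover have "vsub (HJ_ineq p \<epsilon> f k) ?S (\<lambda>x. v ((1 / \<mu>) *\<^sub>R x))"
    proof (rule vsub_mono[OF vsub_rescale[OF S' \<mu>' v2]])
      fix x \<xi> :: 'a and l :: real
      assume "\<mu> powr (2 - p) * norm (\<xi> /\<^sub>R (1 / \<mu>)) powr p - \<epsilon> * (l / (1 / \<mu>)\<^sup>2)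
        \<le> \<mu>\<^sup>2 * k + \<mu>\<^sup>2 * f (\<mu> *\<^sub>R ((1 / \<mu>) *\<^sub>R x))"
      moreover have "\<mu> powr (2 - p) * norm (\<xi> /\<^sub>R (1 / \<mu>)) powr p = \<mu>\<^sup>2 * norm \<xi> powr p"
        using pw[of "\<mu> *\<^sub>R \<xi>"] \<mu> by simp
      ultimately have "\<mu>\<^sup>2 * (norm \<xi> powr p - f x - \<epsilon> * l) \<le> \<mu>\<^sup>2 * k"
        using \<mu> by (simp add: power_one_over algebra_simps)
      then show "norm \<xi> powr p - f x - \<epsilon> * l \<le> k" using \<mu> by simp
    qed
    ultimately show ?A by blast
  }
qed

text \<open>Dilations may approach the boundary of \<open>U\<close> at the ends of the interval, so
  uniformity in \<open>x\<close> comes from the continuous extensions of \<open>f\<close> and its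
  partial derivatives to the closure, read on a compact set of pairs.\<close>

lemma C1_on_closure_dilation:
  fixes f :: "'a::euclidean_space \<Rightarrow> real"
  assumes U: "open U" "bounded U" and f: "C1_on_closure U f" and \<Omega>: "bounded \<Omega>"
    and sub: "\<And>t. t \<in> {a<..<b} \<Longrightarrow> (\<lambda>y. (1 + t) *\<^sub>R y) ` \<Omega> \<subseteq> U"
  obtains h L where "\<And>x t. x \<in> \<Omega> \<Longrightarrow> t \<in> {a<..<b} \<Longrightarrow>
      ((\<lambda>t. (1 + t)\<^sup>2 * f ((1 + t) *\<^sub>R x)) has_real_derivative h t x) (at t)"
    "\<And>x t. x \<in> \<Omega> \<Longrightarrow> t \<in> {a<..<b} \<Longrightarrow> \<bar>h t x\<bar> \<le> L"
    "\<And>\<eta>. \<eta> > 0 \<Longrightarrow> \<exists>\<delta>>0. \<forall>x\<in>\<Omega>. \<forall>s\<in>{a<..<b}. \<forall>t\<in>{a<..<b}. \<bar>s - t\<bar> < \<delta> \<longrightarrow> \<bar>h s x - h t x\<bar> < \<eta>"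
proof -
  have f1: "Ck_on 1 U f" and fc: "continuous_on (closure U) f"
    and fe: "\<forall>b\<in>Basis. \<exists>g. continuous_on (closure U) g \<and> (\<forall>x\<in>U. g x = partial_deriv b f x)"
    using f by (auto simp: C1_on_closure_def)
  obtain g where g: "\<And>b. b \<in> Basis \<Longrightarrow> continuous_on (closure U) (g b)"
    "\<And>b x. b \<in> Basis \<Longrightarrow> x \<in> U \<Longrightarrow> g b x = partial_deriv b f x"
    using bchoice[OF fe] by blast
  define h where "h t x = 2 * (1 + t) * f ((1 + t) *\<^sub>R x) + (1 + t)\<^sup>2 * (\<Sum>b\<in>Basis. g b ((1 + t) *\<^sub>R x) * (x \<bullet> b))" for t x
  define K where "K = closure ({a<..<b} \<times> \<Omega>)"
  have "bounded ({a<..<b} \<times> \<Omega>)" using \<Omega> by (intro bounded_Times) auto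
  then have cK: "compact K" by (simp add: K_def compact_closure)
  have dil: "(\<lambda>z. (1 + fst z) *\<^sub>R snd z) ` K \<subseteq> closure U"
    unfolding K_def
  proof (rule image_closure_subset)
    show "continuous_on (closure ({a<..<b} \<times> \<Omega>)) (\<lambda>z. (1 + fst z) *\<^sub>R snd z)" by (intro continuous_intros)
    show "(\<lambda>z. (1 + fst z) *\<^sub>R snd z) ` ({a<..<b} \<times> \<Omega>) \<subseteq> closure U"
      using sub closure_subset[of U] by fastforce
  qed simp
  have cd: "continuous_on K (\<lambda>z. F ((1 + fst z) *\<^sub>R snd z))" if "continuous_on (closure U) F" for F :: "'a \<Rightarrow> real"
    by (rule continuous_on_compose2[OF that _ dil]) (intro continuous_intros)
  have ch: "continuous_on K (\<lambda>z. h (fst z) (snd z))"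
    unfolding h_def by (intro continuous_on_add continuous_on_mult continuous_on_sum cd fc g(1)) (auto intro!: continuous_intros)
  have inK: "(t, x) \<in> K" if "x \<in> \<Omega>" "t \<in> {a<..<b}" for t x
    unfolding K_def using that closure_subset[of "{a<..<b} \<times> \<Omega>"] by blast
  have "bounded ((\<lambda>z. h (fst z) (snd z)) ` K)"
    by (rule compact_imp_bounded[OF compact_continuous_image[OF ch cK]])
  then obtain L where "\<forall>z\<in>K. \<bar>h (fst z) (snd z)\<bar> \<le> L" unfolding bounded_iff by auto
  then have L: "\<bar>h t x\<bar> \<le> L" if "x \<in> \<Omega>" "t \<in> {a<..<b}" for t x
    using inK[OF that] by force
  have uc: "\<exists>\<delta>>0. \<forall>x\<in>\<Omega>. \<forall>s\<in>{a<..<b}. \<forall>t\<in>{a<..<b}. \<bar>s - t\<bar> < \<delta> \<longrightarrow> \<bar>h s x - h t x\<bar> < \<eta>" if \<eta>: "\<eta> > 0" for \<eta>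
  proof -
    obtain \<delta> where \<delta>: "\<delta> > 0" "\<And>z z'. z \<in> K \<Longrightarrow> z' \<in> K \<Longrightarrow> dist z' z < \<delta> \<Longrightarrow> dist (h (fst z') (snd z')) (h (fst z) (snd z)) < \<eta>"
      using compact_uniformly_continuous[OF ch cK] \<eta> unfolding uniformly_continuous_on_def by metis
    show ?thesis
    proof (intro exI[of _ \<delta>] conjI ballI impI \<delta>(1))
      fix x s t assume *: "x \<in> \<Omega>" "s \<in> {a<..<b}" "t \<in> {a<..<b}" "\<bar>s - t\<bar> < \<delta>"
      then show "\<bar>h s x - h t x\<bar> < \<eta>"
        using \<delta>(2)[OF inK[OF *(1,3)] inK[OF *(1,2)]] by (simp add: dist_Pair_Pair dist_real_def)
    qed
  qed
  have der: "((\<lambda>t. (1 + t)\<^sup>2 * f ((1 + t) *\<^sub>R x)) has_real_derivative h t x) (at t)"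
    if x: "x \<in> \<Omega>" and t: "t \<in> {a<..<b}" for t x
  proof -
    have yU: "(1 + t) *\<^sub>R x \<in> U" using sub[OF t] x by blast
    have "f differentiable (at ((1 + t) *\<^sub>R x))" using Ck_on_imp_differentiable[OF f1 _ yU] by simp
    from has_derivative_grad[OF this]
    have D: "(f has_derivative (\<lambda>z. grad f ((1 + t) *\<^sub>R x) \<bullet> z)) (at ((1 + t) *\<^sub>R x))" .
    have "((\<lambda>t. f ((1 + t) *\<^sub>R x)) has_derivative (\<lambda>z. grad f ((1 + t) *\<^sub>R x) \<bullet> (z *\<^sub>R x))) (at t)"
      by (rule has_derivative_compose[where f = "\<lambda>t. (1 + t) *\<^sub>R x", OF _ D]) (auto intro!: derivative_eq_intros)
    moreover have "grad f ((1 + t) *\<^sub>R x) \<bullet> x = (\<Sum>b\<in>Basis. g b ((1 + t) *\<^sub>R x) * (x \<bullet> b))"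
      by (subst euclidean_inner) (auto intro!: sum.cong simp: grad_inner_Basis g(2) yU)
    ultimately have Df: "((\<lambda>t. f ((1 + t) *\<^sub>R x)) has_real_derivative (\<Sum>b\<in>Basis. g b ((1 + t) *\<^sub>R x) * (x \<bullet> b))) (at t)"
      by (simp add: has_field_derivative_def mult_commute_abs)
    have Dw: "((\<lambda>t. (1 + t)\<^sup>2) has_real_derivative 2 * (1 + t)) (at t)"
      by (auto intro!: derivative_eq_intros)
    show ?thesis using DERIV_mult[OF Dw Df] by (simp add: h_def algebra_simps)
  qed
  show ?thesis using that der L uc by blast
qed

text \<open>The mean value theorem on both sides of the intermediate point turns the convexity
  defect into \<open>\<theta> * (1 - \<theta>) * (t - s)\<close> times an oscillation of the
  derivative \<open>h\<close>. This prefactor is the one that cancels when passing to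
  slopes.\<close>

lemma uniform_semiconvexity:
  fixes g :: "real \<Rightarrow> real"
  assumes der: "\<And>t. t \<in> {a<..<b} \<Longrightarrow> (g has_real_derivative h t) (at t)"
    and osc: "\<And>s t. s \<in> {a<..<b} \<Longrightarrow> t \<in> {a<..<b} \<Longrightarrow> \<bar>s - t\<bar> < \<delta> \<Longrightarrow> \<bar>h s - h t\<bar> < \<eta>"
    and st: "a < s" "s < t" "t < b" "t - s < \<delta>" and \<theta>: "0 < \<theta>" "\<theta> < 1"
  shows "(1 - \<theta>) * g s + \<theta> * g t - g ((1 - \<theta>) * s + \<theta> * t) \<le> \<eta> * \<theta> * (1 - \<theta>) * (t - s)"
proof -
  define z where "z = (1 - \<theta>) * s + \<theta> * t"
  have zs: "z - s = \<theta> * (t - s)" "t - z = (1 - \<theta>) * (t - s)" by (simp_all add: z_def algebra_simps)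
  have "0 < \<theta> * (t - s)" "0 < (1 - \<theta>) * (t - s)" using \<theta> st by auto
  then have z: "s < z" "z < t" by (simp_all flip: zs)
  obtain u where u: "s < u" "u < z" "g z - g s = (z - s) * h u"
    using MVT2[OF z(1), of g h] der st z by force
  obtain v where v: "z < v" "v < t" "g t - g z = (t - z) * h v"
    using MVT2[OF z(2), of g h] der st z by force
  have "\<bar>h v - h u\<bar> < \<eta>" by (rule osc) (use u v st z in auto)
  then have "\<theta> * (1 - \<theta>) * (t - s) * (h v - h u) \<le> \<theta> * (1 - \<theta>) * (t - s) * \<eta>"
    using \<theta> st by (intro mult_left_mono) auto
  moreover have "(1 - \<theta>) * g s + \<theta> * g t - g z = \<theta> * (g t - g z) - (1 - \<theta>) * (g z - g s)"
    by (simp add: algebra_simps)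
  moreover have "\<theta> * (g t - g z) - (1 - \<theta>) * (g z - g s) = \<theta> * (1 - \<theta>) * (t - s) * (h v - h u)"
    unfolding u(3) v(3) zs by (simp add: algebra_simps)
  ultimately show ?thesis by (simp add: z_def mult.commute mult.left_commute)
qed

theorem corollary1p3:
  fixes \<epsilon> p \<kappa> \<epsilon>\<^sub>0 :: real
    and U \<Omega> :: "'a::euclidean_space set"
    and f :: "'a \<Rightarrow> real"
    and H :: "'a \<Rightarrow> 'a \<Rightarrow> real"
    and c :: "real \<Rightarrow> real"
  assumes "\<epsilon> > 0" and "p > 2"
    and "open U" and "bounded U" and "smooth_boundary U"
    and "C1_on_closure U f"
    and "\<And>x \<xi>. H x \<xi> = norm \<xi> powr p - f x"
    and "open \<Omega>" and "bounded \<Omega>" and "connected \<Omega>" and "C2_boundary \<Omega>"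
    and "closure \<Omega> \<subseteq> U"
    and "0 \<in> \<Omega>" and "\<And>x. x \<in> \<Omega> \<Longrightarrow> closed_segment 0 x \<subseteq> \<Omega>"
    and "\<kappa> > 0" and "cball 0 \<kappa> \<subseteq> \<Omega>"
    and "\<And>s x. s > 0 \<Longrightarrow> x \<in> (\<lambda>y. (1 + s) *\<^sub>R y) ` frontier \<Omega> \<Longrightarrow>
           infdist x (closure \<Omega>) \<ge> \<kappa> * s"
    and "0 < \<epsilon>\<^sub>0" and "\<epsilon>\<^sub>0 < 1"
    and "\<And>t. \<bar>t\<bar> < \<epsilon>\<^sub>0 \<Longrightarrow> (\<lambda>y. (1 + t) *\<^sub>R y) ` \<Omega> \<subseteq> U"
    and "\<And>t. t \<in> {-\<epsilon>\<^sub>0<..<\<epsilon>\<^sub>0} \<Longrightarrow>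
           c t = additive_eigenvalue H \<epsilon> ((\<lambda>y. (1 + t) *\<^sub>R y) ` \<Omega>)"
  shows "(\<exists>L. L-lipschitz_on {-\<epsilon>\<^sub>0<..<\<epsilon>\<^sub>0} c) \<and>
         mono_on {-\<epsilon>\<^sub>0<..<\<epsilon>\<^sub>0} c \<and>
         (\<forall>t\<in>{-\<epsilon>\<^sub>0<..<\<epsilon>\<^sub>0}.
            (\<exists>l. ((\<lambda>h. (c (t + h) - c t) / h) \<longlongrightarrow> l) (at_right 0)) \<and>
            (\<exists>l. ((\<lambda>h. (c (t + h) - c t) / h) \<longlongrightarrow> l) (at_left 0))) \<and>
         (\<forall>t\<in>{-\<epsilon>\<^sub>0<..<\<epsilon>\<^sub>0}.
            (left_deriv c \<longlongrightarrow> left_deriv c t) (at_left t) \<and>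
            (right_deriv c \<longlongrightarrow> right_deriv c t) (at_right t)) \<and>
         countable {t\<in>{-\<epsilon>\<^sub>0<..<\<epsilon>\<^sub>0}. \<not> c differentiable (at t)}"
proof -
  note \<epsilon> = \<open>\<epsilon> > 0\<close> and p = \<open>p > 2\<close> and H = assms(7) and \<Omega> = \<open>open \<Omega>\<close> and star = assms(14)
  note e0 = \<open>0 < \<epsilon>\<^sub>0\<close> \<open>\<epsilon>\<^sub>0 < 1\<close>
  define I where "I = {-\<epsilon>\<^sub>0<..<\<epsilon>\<^sub>0}"
  define S where "S t = (\<lambda>y. (1 + t) *\<^sub>R y) ` \<Omega>" for t
  define g where "g t x = (1 + t)\<^sup>2 * f ((1 + t) *\<^sub>R x)" for t x
  define \<Gamma> where "\<Gamma> t = (1 + t)\<^sup>2 * c t" for t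
  have I: "1 - \<epsilon>\<^sub>0 < 1 + t" "0 < 1 + t" "1 + t < 2" "\<bar>t\<bar> < \<epsilon>\<^sub>0" if "t \<in> I" for t
    using that e0 by (auto simp: I_def)
  have SU: "S t \<subseteq> U" if "t \<in> I" for t using assms(20) I(4)[OF that] by (simp add: S_def)
  have So: "open (S t)" if "t \<in> I" for t
    unfolding S_def using open_scaling[OF _ \<Omega>, of "1 + t"] I(2)[OF that] by simp
  have Sc: "connected (S t)" for t
    unfolding S_def by (intro connected_continuous_image assms(10)) (intro continuous_intros)
  have S0: "S t \<noteq> {}" for t using assms(13) by (auto simp: S_def)
  have fU: "continuous_on (closure U) f" using assms(6) by (simp add: C1_on_closure_def)
  have "bounded (f ` closure U)"
    by (rule compact_imp_bounded[OF compact_continuous_image[OF fU]]) (simp add: assms(4))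
  then obtain B where "\<forall>x\<in>closure U. \<bar>f x\<bar> \<le> B" unfolding bounded_iff by auto
  then have B: "\<bar>f x\<bar> \<le> B" if "x \<in> U" for x using that closure_subset[of U] by blast
  have fS: "continuous_on (S t) f" if "t \<in> I" for t
    using fU SU[OF that] closure_subset[of U] by (meson continuous_on_subset order_trans)
  have fB: "\<bar>f x\<bar> \<le> B" if "t \<in> I" "x \<in> S t" for t x using B SU that by blast
  have ct: "c t = additive_eigenvalue H \<epsilon> (S t)" if "t \<in> I" for t
    using assms(21) that by (simp add: I_def S_def)
  have ex: "\<exists>u. continuous_on (S t) u \<and> vsub (HJ_ineq p \<epsilon> f (c t)) (S t) u"
    if t: "t \<in> I" for t
    using additive_eigenvalue_attained(1)[OF p \<epsilon> So[OF t] Sc S0 fS[OF t] fB[OF t] H] by (simp add: ct[OF t])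
  have least: "c t \<le> k" if t: "t \<in> I" and "continuous_on (S t) u"
    "vsub (HJ_ineq p \<epsilon> f k) (S t) u" for t k u
    using additive_eigenvalue_attained(2)[OF p \<epsilon> So[OF t] Sc S0 fS[OF t] fB[OF t] H that(2,3)] by (simp add: ct[OF t])
  have upper: "c t \<le> B" if t: "t \<in> I" for t
    using additive_eigenvalue_attained(3)[OF p \<epsilon> So[OF t] Sc S0 fS[OF t] fB[OF t] H] by (simp add: ct[OF t])
  have ex': "\<exists>v. continuous_on \<Omega> v \<and>
      vsub (\<lambda>x \<xi> l. (1 + t) powr (2 - p) * norm \<xi> powr p - \<epsilon> * l \<le> \<Gamma> t + g t x) \<Omega> v" if t: "t \<in> I" for t
    using rescaled_subsolution_iff[OF \<Omega> I(2)[OF t], of p f \<epsilon> "c t"] ex[OF t]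
    by (simp add: S_def g_def \<Gamma>_def)
  \<comment> \<open>With \<open>ex'\<close>, this makes \<open>\<Gamma> t\<close> the least constant
    for the pulled-back inequality on the fixed domain, where different values of \<open>t\<close>
    can be compared.\<close>
  have least': "\<Gamma> t \<le> G" if t: "t \<in> I" and v: "continuous_on \<Omega> v"
    "vsub (\<lambda>x \<xi> l. (1 + t) powr (2 - p) * norm \<xi> powr p - \<epsilon> * l \<le> G + g t x) \<Omega> v" for t G v
  proof -
    have "(1 + t)\<^sup>2 * (G / (1 + t)\<^sup>2) = G" using I(2)[OF t] by simp
    then have "\<exists>u. continuous_on (S t) u \<and> vsub (HJ_ineq p \<epsilon> f (G / (1 + t)\<^sup>2)) (S t) u"
      using rescaled_subsolution_iff[OF \<Omega> I(2)[OF t], of p f \<epsilon> "G / (1 + t)\<^sup>2"] v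
      by (auto simp: S_def g_def)
    then have "c t \<le> G / (1 + t)\<^sup>2" using least[OF t] by blast
    then show ?thesis using I(2)[OF t] by (simp add: \<Gamma>_def pos_le_divide_eq mult.commute)
  qed
  have mono: "c s \<le> c t" if s: "s \<in> I" and t: "t \<in> I" and "s \<le> t" for s t
  proof -
    \<comment> \<open>Star-shapedness nests the dilations; a subsolution on the larger one restricts
      to the smaller one with the same constant.\<close>
    have "S s \<subseteq> S t"
    proof
      fix y assume "y \<in> S s"
      then obtain x where x: "x \<in> \<Omega>" "y = (1 + s) *\<^sub>R x" by (auto simp: S_def)
      have "((1 + s) / (1 + t)) *\<^sub>R x \<in> closed_segment 0 x"
        unfolding in_segment using I[OF s] I[OF t] \<open>s \<le> t\<close> by (intro exI[of _ "(1 + s) / (1 + t)"]) auto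
      then have "((1 + s) / (1 + t)) *\<^sub>R x \<in> \<Omega>" using star[OF x(1)] by blast
      moreover have "y = (1 + t) *\<^sub>R (((1 + s) / (1 + t)) *\<^sub>R x)" using x(2) I[OF t] by simp
      ultimately show "y \<in> S t" unfolding S_def by blast
    qed
    moreover obtain u where "continuous_on (S t) u" "vsub (HJ_ineq p \<epsilon> f (c t)) (S t) u"
      using ex[OF t] by blast
    ultimately show ?thesis using least[OF s, of u "c t"] continuous_on_subset[of "S t" u "S s"] vsub_subset[of _ "S t" u "S s"]
      by blast
  qed
  \<comment> \<open>A radius for which the ball about the origin lies in every dilation, so that one
    lower bound serves all \<open>t\<close>.\<close>
  define R where "R = (1 - \<epsilon>\<^sub>0) * \<kappa>"
  have R: "R > 0" using e0 assms(15) by (simp add: R_def)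
  obtain N where N: "\<And>S (u :: 'a \<Rightarrow> real) x k. open S \<Longrightarrow> continuous_on S u \<Longrightarrow> cball x R \<subseteq> S \<Longrightarrow>
      vsub (growth_ineq p \<epsilon> k) S u \<Longrightarrow> N \<le> k"
    using subsolution_constant_lower_bound[OF p \<epsilon> R, where 'a='a] by metis
  have lower: "N - B \<le> c t" if t: "t \<in> I" for t
  proof -
    obtain u where u: "continuous_on (S t) u" "vsub (HJ_ineq p \<epsilon> f (c t)) (S t) u"
      using ex[OF t] by blast
    have "cball 0 R \<subseteq> S t"
    proof
      fix y :: 'a assume "y \<in> cball 0 R"
      then have "norm y \<le> (1 - \<epsilon>\<^sub>0) * \<kappa>" by (simp add: R_def)
      also have "\<dots> \<le> (1 + t) * \<kappa>" using I[OF t] assms(15) by (intro mult_right_mono) auto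
      finally have "(1 / (1 + t)) *\<^sub>R y \<in> cball 0 \<kappa>" using I[OF t] by (simp add: field_simps)
      then have "(1 / (1 + t)) *\<^sub>R y \<in> \<Omega>" using assms(16) by blast
      moreover have "y = (1 + t) *\<^sub>R ((1 / (1 + t)) *\<^sub>R y)" using I[OF t] by simp
      ultimately show "y \<in> S t" unfolding S_def by blast
    qed
    moreover have "vsub (growth_ineq p \<epsilon> (c t + B)) (S t) u"
    proof (rule vsub_mono[OF u(2)])
      fix x \<xi> :: 'a and l assume "x \<in> S t" "norm \<xi> powr p - f x - \<epsilon> * l \<le> c t"
      then show "norm \<xi> powr p - \<epsilon> * l \<le> c t + B" using fB[OF t, of x] by linarith
    qed
    ultimately show ?thesis using N[OF So[OF t] u(1)] by force
  qed
  define C where "C = \<bar>N\<bar> + \<bar>B\<bar>"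
  have C: "\<bar>c t\<bar> \<le> C" if t: "t \<in> I" for t
    using upper[OF t] lower[OF t] unfolding C_def by linarith
  have C0: "C \<ge> 0" by (simp add: C_def)

  \<comment> \<open>Lipschitz estimates for \<open>c\<close> and \<Gamma>\<close>
  obtain h L where h: "\<And>x t. x \<in> \<Omega> \<Longrightarrow> t \<in> I \<Longrightarrow> ((\<lambda>t. g t x) has_real_derivative h t x) (at t)"
    "\<And>x t. x \<in> \<Omega> \<Longrightarrow> t \<in> I \<Longrightarrow> \<bar>h t x\<bar> \<le> L"
    "\<And>\<eta>. \<eta> > 0 \<Longrightarrow> \<exists>\<delta>>0. \<forall>x\<in>\<Omega>. \<forall>s\<in>I. \<forall>t\<in>I. \<bar>s - t\<bar> < \<delta> \<longrightarrow> \<bar>h s x - h t x\<bar> < \<eta>"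
  proof (rule C1_on_closure_dilation[OF assms(3,4,6,9), of "-\<epsilon>\<^sub>0" \<epsilon>\<^sub>0])
    show "(\<lambda>y. (1 + t) *\<^sub>R y) ` \<Omega> \<subseteq> U" if "t \<in> {-\<epsilon>\<^sub>0<..<\<epsilon>\<^sub>0}" for t
      by (rule assms(20)) (use that in auto)
  qed (rule that; unfold g_def I_def; assumption)
  have L0: "L \<ge> 0" using h(2)[OF assms(13), of 0] e0 by (force simp: I_def)
  \<comment> \<open>Only the increase of \<Gamma> is estimated: as \<open>2 - p\<close> is negative,
    the gradient coefficient decreases in \<open>t\<close>, so a subsolution for \<open>s\<close>
    serves for \<open>t\<close> after paying for the change of \<open>g\<close>. The opposite bound
    for \<open>c\<close> is monotonicity.\<close>
  have step: "\<Gamma> t \<le> \<Gamma> s + L * (t - s)" if s: "s \<in> I" and t: "t \<in> I" and "s < t" for s t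
  proof -
    obtain v where v: "continuous_on \<Omega> v"
      "vsub (\<lambda>x \<xi> l. (1 + s) powr (2 - p) * norm \<xi> powr p - \<epsilon> * l \<le> \<Gamma> s + g s x) \<Omega> v" using ex'[OF s] by blast
    show ?thesis
    proof (rule least'[OF t v(1)], rule vsub_mono[OF v(2)])
      fix x \<xi> :: 'a and l assume x: "x \<in> \<Omega>"
        and *: "(1 + s) powr (2 - p) * norm \<xi> powr p - \<epsilon> * l \<le> \<Gamma> s + g s x"
      have "(1 + t) powr (2 - p) \<le> (1 + s) powr (2 - p)"
        using p I[OF s] \<open>s < t\<close> by (intro powr_mono2') auto
      then have "(1 + t) powr (2 - p) * norm \<xi> powr p \<le> (1 + s) powr (2 - p) * norm \<xi> powr p"
        by (intro mult_right_mono) auto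
      moreover have "g s x - g t x \<le> L * (t - s)"
      proof -
        obtain z where z: "s < z" "z < t" "g t x - g s x = (t - s) * h z x"
          using MVT2[OF \<open>s < t\<close>, of "\<lambda>t. g t x" "\<lambda>t. h t x"] h(1)[OF x] s t by (force simp: I_def)
        have "\<bar>h z x\<bar> \<le> L" using h(2)[OF x] z s t by (auto simp: I_def)
        then have "- L * (t - s) \<le> h z x * (t - s)" using \<open>s < t\<close> by (intro mult_right_mono) auto
        then show ?thesis using z(3) by (simp add: mult.commute)
      qed
      ultimately show "(1 + t) powr (2 - p) * norm \<xi> powr p - \<epsilon> * l \<le> (\<Gamma> s + L * (t - s)) + g t x"
        using * by linarith
    qed
  qed
  \<comment> \<open>A positive lower bound of \<open>(1 + t)\<^sup>2\<close>, used to return from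
    \<Gamma> to \<open>c\<close>; here \<open>\<epsilon>\<^sub>0 < 1\<close> is essential.\<close>
  define m where "m = (1 - \<epsilon>\<^sub>0)\<^sup>2"
  have m: "m > 0" using e0 by (simp add: m_def)
  define L1 where "L1 = (4 * C + L) / m"
  have L1: "L1 \<ge> 0" using C0 L0 m by (simp add: L1_def)
  have sq: "\<bar>(1 + t)\<^sup>2 - (1 + s)\<^sup>2\<bar> \<le> 4 * (t - s)" if s: "s \<in> I" and t: "t \<in> I" and "s < t" for s t
  proof -
    have "(1 + t)\<^sup>2 - (1 + s)\<^sup>2 = (2 + s + t) * (t - s)" by (simp add: power2_eq_square algebra_simps)
    moreover have "(2 + s + t) * (t - s) \<le> 4 * (t - s)" using I[OF s] I[OF t] that by (intro mult_right_mono) auto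
    moreover have "0 \<le> (2 + s + t) * (t - s)" using I[OF s] I[OF t] that by (intro mult_nonneg_nonneg) auto
    ultimately show ?thesis by simp
  qed
  have lip: "c t - c s \<le> L1 * (t - s)" if s: "s \<in> I" and t: "t \<in> I" and "s < t" for s t
  proof -
    have "m * (c t - c s) \<le> (1 + t)\<^sup>2 * (c t - c s)"
      using I[OF t] e0 mono[OF s t] that by (intro mult_right_mono) (auto simp: m_def intro!: power_mono)
    also have "\<dots> = (\<Gamma> t - \<Gamma> s) - ((1 + t)\<^sup>2 - (1 + s)\<^sup>2) * c s" by (simp add: \<Gamma>_def algebra_simps)
    also have "\<dots> \<le> L * (t - s) + \<bar>(1 + t)\<^sup>2 - (1 + s)\<^sup>2\<bar> * \<bar>c s\<bar>"
      using step[OF that] abs_ge_minus_self[of "((1 + t)\<^sup>2 - (1 + s)\<^sup>2) * c s"] by (simp add: abs_mult)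
    also have "\<dots> \<le> L * (t - s) + 4 * (t - s) * C"
      using sq[OF that] C[OF s] that by (intro add_left_mono mult_mono) auto
    also have "\<dots> = m * (L1 * (t - s))" using m by (simp add: L1_def field_simps)
    finally show ?thesis using m by simp
  qed
  have lip_c: "L1-lipschitz_on I c"
  proof (rule lipschitz_onI[OF _ L1])
    have *: "dist (c s) (c t) \<le> L1 * dist s t" if "s \<in> I" "t \<in> I" "s < t" for s t
      using lip[OF that] mono[OF that(1,2)] that by (simp add: dist_real_def)
    fix s t assume "s \<in> I" "t \<in> I"
    then show "dist (c s) (c t) \<le> L1 * dist s t"
      using *[of s t] *[of t s] by (cases s t rule: linorder_cases) (auto simp: dist_commute)
  qed
  have lip_\<Gamma>: "(4 * C + 4 * L1)-lipschitz_on I \<Gamma>"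
  proof (rule lipschitz_onI)
    have *: "dist (\<Gamma> s) (\<Gamma> t) \<le> (4 * C + 4 * L1) * dist s t" if st: "s \<in> I" "t \<in> I" "s < t" for s t
    proof -
      have "\<Gamma> t - \<Gamma> s = ((1 + t)\<^sup>2 - (1 + s)\<^sup>2) * c t + (1 + s)\<^sup>2 * (c t - c s)"
        by (simp add: \<Gamma>_def algebra_simps)
      then have "\<bar>\<Gamma> t - \<Gamma> s\<bar> \<le> \<bar>(1 + t)\<^sup>2 - (1 + s)\<^sup>2\<bar> * \<bar>c t\<bar> + (1 + s)\<^sup>2 * \<bar>c t - c s\<bar>"
        by (metis abs_mult abs_triangle_ineq abs_power2)
      also have "\<dots> \<le> 4 * (t - s) * C + 2\<^sup>2 * (L1 * (t - s))"
        using sq[OF st] C[OF st(2)] lip[OF st] mono[OF st(1,2)] I[OF st(1)] L1 st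
        by (intro add_mono mult_mono power_mono) auto
      finally show ?thesis using st by (simp add: dist_real_def algebra_simps)
    qed
    fix s t assume "s \<in> I" "t \<in> I"
    then show "dist (\<Gamma> s) (\<Gamma> t) \<le> (4 * C + 4 * L1) * dist s t"
      using *[of s t] *[of t s] by (cases s t rule: linorder_cases) (auto simp: dist_commute)
  qed (use C0 L1 in auto)

  \<comment> \<open>Semiconvexity of \<Gamma>\<close>
  have sc: "semiconvex_on (-\<epsilon>\<^sub>0) \<epsilon>\<^sub>0 \<Gamma>"
    unfolding semiconvex_on_def
  proof (intro allI impI)
    fix \<eta> :: real assume \<eta>: "\<eta> > 0"
    obtain \<delta> where \<delta>: "\<delta> > 0" "\<And>x s t. x \<in> \<Omega> \<Longrightarrow> s \<in> I \<Longrightarrow> t \<in> I \<Longrightarrow> \<bar>s - t\<bar> < \<delta> \<Longrightarrow> \<bar>h s x - h t x\<bar> < \<eta>"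
      using h(3)[OF \<eta>] by blast
    show "\<exists>\<delta>>0. \<forall>x z y. -\<epsilon>\<^sub>0 < x \<and> x < z \<and> z < y \<and> y < \<epsilon>\<^sub>0 \<and> y - x < \<delta> \<longrightarrow>
     slope \<Gamma> x z \<le> slope \<Gamma> z y + \<eta>"
    proof (intro exI[of _ \<delta>] conjI allI impI \<delta>(1))
      fix s z t assume *: "-\<epsilon>\<^sub>0 < s \<and> s < z \<and> z < t \<and> t < \<epsilon>\<^sub>0 \<and> t - s < \<delta>"
      then have sI: "s \<in> I" and tI: "t \<in> I" and zI: "z \<in> I" by (auto simp: I_def)
      define \<theta> where "\<theta> = (z - s) / (t - s)"
      have \<theta>: "0 < \<theta>" "\<theta> < 1" using * by (auto simp: \<theta>_def)
      have zs: "z - s = \<theta> * (t - s)" using * by (simp add: \<theta>_def)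
      then have tz: "t - z = (1 - \<theta>) * (t - s)" and zeq: "z = (1 - \<theta>) * s + \<theta> * t" by (simp_all add: algebra_simps)
      obtain v0 where v0: "continuous_on \<Omega> v0"
        "vsub (\<lambda>x \<xi> l. (1 + s) powr (2 - p) * norm \<xi> powr p - \<epsilon> * l \<le> \<Gamma> s + g s x) \<Omega> v0" using ex'[OF sI] by blast
      obtain v1 where v1: "continuous_on \<Omega> v1"
        "vsub (\<lambda>x \<xi> l. (1 + t) powr (2 - p) * norm \<xi> powr p - \<epsilon> * l \<le> \<Gamma> t + g t x) \<Omega> v1" using ex'[OF tI] by blast
      have cg: "continuous_on \<Omega> (\<lambda>x. k + g \<tau> x)" if "\<tau> \<in> I" for \<tau> k
      proof -
        have "continuous_on \<Omega> (\<lambda>x. f ((1 + \<tau>) *\<^sub>R x))"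
          by (rule continuous_on_compose2[OF fS[OF that]]) (auto simp: S_def intro!: continuous_intros)
        then show ?thesis unfolding g_def by (intro continuous_intros)
      qed
      have \<mu>: "1 + z = (1 - \<theta>) * (1 + s) + \<theta> * (1 + t)" by (subst zeq) (simp add: algebra_simps)
      have sub: "vsub (\<lambda>x \<xi> l. (1 + z) powr (2 - p) * norm \<xi> powr p - \<epsilon> * l
          \<le> (1 - \<theta>) * (\<Gamma> s + g s x) + \<theta> * (\<Gamma> t + g t x)) \<Omega> (\<lambda>x. (1 - \<theta>) * v0 x + \<theta> * v1 x)"
        by (rule vsub_convex_combination[OF \<Omega> v0(1) v1(1) cg[OF sI] cg[OF tI] I(2)[OF sI] I(2)[OF tI] \<theta> p \<epsilon> \<mu> v0(2) v1(2)])
      \<comment> \<open>The convex combination solves the inequality with the average of the data;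
        replacing the average of \<open>g\<close> by its value at \<open>z\<close> costs the
        convexity defect, which is added to the constant.\<close>
      have "\<Gamma> z \<le> (1 - \<theta>) * \<Gamma> s + \<theta> * \<Gamma> t + \<eta> * \<theta> * (1 - \<theta>) * (t - s)"
      proof (rule least'[OF zI _ vsub_mono[OF sub]])
        show "continuous_on \<Omega> (\<lambda>x. (1 - \<theta>) * v0 x + \<theta> * v1 x)" by (intro continuous_intros v0 v1)
        fix x \<xi> :: 'a and l assume x: "x \<in> \<Omega>"
          and le: "(1 + z) powr (2 - p) * norm \<xi> powr p - \<epsilon> * l \<le> (1 - \<theta>) * (\<Gamma> s + g s x) + \<theta> * (\<Gamma> t + g t x)"
        have "(1 - \<theta>) * g s x + \<theta> * g t x - g z x \<le> \<eta> * \<theta> * (1 - \<theta>) * (t - s)"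
          unfolding zeq
        proof (rule uniform_semiconvexity[where a = "-\<epsilon>\<^sub>0" and b = \<epsilon>\<^sub>0 and h = "\<lambda>t. h t x" and \<delta> = \<delta>])
        qed (use h(1)[OF x] \<delta>(2)[OF x] * \<theta> in \<open>auto simp: I_def\<close>)
        then show "(1 + z) powr (2 - p) * norm \<xi> powr p - \<epsilon> * l
          \<le> ((1 - \<theta>) * \<Gamma> s + \<theta> * \<Gamma> t + \<eta> * \<theta> * (1 - \<theta>) * (t - s)) + g z x"
          using le by (simp add: distrib_left)
      qed
      then have le: "(1 - \<theta>) * (\<Gamma> z - \<Gamma> s) \<le> \<theta> * (\<Gamma> t - \<Gamma> z) + \<eta> * (\<theta> * (1 - \<theta>) * (t - s))"
        by (simp add: algebra_simps)
      \<comment> \<open>Dividing by this quantity turns the weighted increments into the two slopes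
        and leaves exactly \<eta>.\<close>
      define q where "q = \<theta> * (1 - \<theta>) * (t - s)"
      have q: "q > 0" using \<theta> * by (simp add: q_def)
      have "slope \<Gamma> s z = (1 - \<theta>) * (\<Gamma> z - \<Gamma> s) / q" using \<theta> by (simp add: zs q_def)
      also have "\<dots> \<le> (\<theta> * (\<Gamma> t - \<Gamma> z) + \<eta> * q) / q"
        using le q by (intro divide_right_mono) (auto simp: q_def)
      also have "\<dots> = slope \<Gamma> z t + \<eta>" using \<theta> q * by (simp add: tz q_def add_divide_distrib)
      finally show "slope \<Gamma> s z \<le> slope \<Gamma> z t + \<eta>" .
    qed
  qed

  \<comment> \<open>Return from \<Gamma> to \<open>c\<close> through the weight
    \<open>(1 + t)\<^sup>2\<close>\<close>
  have w: "(1 + t)\<^sup>2 > 0" if "t \<in> {-\<epsilon>\<^sub>0<..<\<epsilon>\<^sub>0}" for t using I(2)[of t] that by (simp add: I_def)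
  have w': "((\<lambda>t. (1 + t)\<^sup>2) has_real_derivative 2 * (1 + t)) (at t)" for t :: real
    by (auto intro!: derivative_eq_intros)
  have w'': "continuous_on {-\<epsilon>\<^sub>0<..<\<epsilon>\<^sub>0} (\<lambda>t. 2 * (1 + t))" by (intro continuous_intros)
  note sc' = sc[unfolded \<Gamma>_def[abs_def]] and lip' = lip_\<Gamma>[unfolded \<Gamma>_def[abs_def] I_def]
  note rd = weighted_semiconvex_right_deriv[OF sc' lip' w w' w'']
  note ld = weighted_semiconvex_left_deriv[OF sc' lip' w w' w'']
  have "countable {t\<in>{-\<epsilon>\<^sub>0<..<\<epsilon>\<^sub>0}. \<not> c differentiable (at t)}"
    by (rule countable_not_differentiable) (use rd(1) ld(1) in blast)+
  moreover have "mono_on {-\<epsilon>\<^sub>0<..<\<epsilon>\<^sub>0} c"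
    by (rule mono_onI) (use mono in \<open>auto simp: I_def\<close>)
  ultimately show ?thesis using lip_c rd ld unfolding I_def by blast
qed

end
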